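(* Let $R$ be a commutative ring with identity and let $d\geq 0$ be an integer. Then $\mathrm{fPD}(R)\leq d$ if and only if the following holds: for every finitely generated ideal $I$ of $R$, if $\mathrm{Ext}_R^i(R/I,R)=0$ for each $i=0,\dots,d$, then $\mathrm{Ext}_R^i(R/I,R)=0$ for all $i\geq 0$.
   Context: All rings are commutative with identity. An $R$-module $M$ is said to have a finite projective resolution if there exist a non-negative integer $n$ and an exact sequence $0\to P_n\to P_{n-1}\to\cdots\to P_1\to P_0\to M\to 0$ with each $P_i$ a finitely generated projective $R$-module. The small finitistic (projective) dimension $\mathrm{fPD}(R)$ is the supremum (in $\mathbb{N}\cup\{\infty\}$) of the projective dimensions $\mathrm{pd}_R M$ over all $R$-modules $M$ having a finite projective resolution. *)

theory Defs
  imports "HOL-Library.Extended_Nat" "HOL-Algebra.Module" "HOL-Algebra.Ideal"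
begin

section \<open>Modules over a commutative ring\<close>

text \<open>
  Modules are the records of the library with the locale \<^locale>\<open>module\<close>. The multiplicative
  fields \<^term>\<open>mult\<close> and \<^term>\<open>one\<close> that such a record inherits from the ring records are
  irrelevant for the module structure.
\<close>

definition trivial_module :: "('a, 'm) module \<Rightarrow> bool"
  where "trivial_module M \<longleftrightarrow> carrier M = {\<zero>\<^bsub>M\<^esub>}"

definition linear_maps ::
  "('a, 'b) ring_scheme \<Rightarrow> ('a, 'm) module \<Rightarrow> ('a, 'n) module \<Rightarrow> ('m \<Rightarrow> 'n) set"
  where "linear_maps R M N =
    {f \<in> hom (add_monoid M) (add_monoid N).
       \<forall>a\<in>carrier R. \<forall>x\<in>carrier M. f (a \<odot>\<^bsub>M\<^esub> x) = a \<odot>\<^bsub>N\<^esub> f x}"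

definition regular_module :: "('a, 'b) ring_scheme \<Rightarrow> ('a, 'a) module"
  where "regular_module R =
    \<lparr>carrier = carrier R, mult = mult R, one = \<one>\<^bsub>R\<^esub>, zero = \<zero>\<^bsub>R\<^esub>, add = add R, smult = mult R\<rparr>"

text \<open>The quotient of a module by a submodule \<^term>\<open>N\<close>: elements are the additive cosets.\<close>

definition quotient_module :: "('a, 'm) module \<Rightarrow> 'm set \<Rightarrow> ('a, 'm set) module"
  where "quotient_module M N =
    \<lparr>carrier = a_rcosets\<^bsub>M\<^esub> N, mult = undefined, one = undefined, zero = N, add = set_add M,
     smult = (\<lambda>a X. \<Union>x\<in>X. N +>\<^bsub>M\<^esub> (a \<odot>\<^bsub>M\<^esub> x))\<rparr>"

text \<open>
  The module of linear maps. The carrier uses extensional functions, so that equality in it is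
  equality of maps on \<^term>\<open>carrier M\<close>.
\<close>

definition Hom_module ::
  "('a, 'b) ring_scheme \<Rightarrow> ('a, 'm) module \<Rightarrow> ('a, 'n) module \<Rightarrow> ('a, 'm \<Rightarrow> 'n) module"
  where "Hom_module R M N =
    \<lparr>carrier = linear_maps R M N \<inter> extensional (carrier M), mult = undefined, one = undefined,
     zero = (\<lambda>x\<in>carrier M. \<zero>\<^bsub>N\<^esub>),
     add = (\<lambda>f g. \<lambda>x\<in>carrier M. f x \<oplus>\<^bsub>N\<^esub> g x),
     smult = (\<lambda>a f. \<lambda>x\<in>carrier M. a \<odot>\<^bsub>N\<^esub> f x)\<rparr>"

definition fg_module :: "('a, 'b) ring_scheme \<Rightarrow> ('a, 'm) module \<Rightarrow> bool"
  where "fg_module R M \<longleftrightarrow>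
    (\<exists>S. finite S \<and> S \<subseteq> carrier M \<and>
      (\<forall>x\<in>carrier M. \<exists>c\<in>S \<rightarrow> carrier R. x = finsum M (\<lambda>s. c s \<odot>\<^bsub>M\<^esub> s) S))"

definition fg_ideal :: "('a, 'b) ring_scheme \<Rightarrow> 'a set \<Rightarrow> bool"
  where "fg_ideal R I \<longleftrightarrow> (\<exists>S. finite S \<and> S \<subseteq> carrier R \<and> I = genideal R S)"


section \<open>Projective modules and projective resolutions\<close>

text \<open>
  A definition cannot quantify over modules with carriers in all types. For a module with elements
  of type \<open>'m\<close> over a ring with elements of type \<open>'a\<close>, the auxiliary modules below have elements
  of type \<open>('a \<times> 'm) list\<close>. This type is infinite and at least as large as \<open>'a\<close> and \<open>'m\<close>, so it
  contains an isomorphic copy of \<^term>\<open>M\<close>, of every finitely generated module, and of the free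
  module on any subset of the type, and with a module also all its submodules and quotients.
  Hence \<^term>\<open>M\<close> has a free resolution in it, and neither projectivity nor the existence of a
  projective resolution of a given length changes if larger types are allowed.
\<close>

type_synonym ('a, 'm) aux_module = "('a, ('a \<times> 'm) list) module"

definition projective_module :: "('a, 'b) ring_scheme \<Rightarrow> ('a, 'm) module \<Rightarrow> bool"
  where "projective_module R P \<longleftrightarrow> module R P \<and>
    (\<forall>(A :: ('a, 'm) aux_module) (B :: ('a, 'm) aux_module).
       module R A \<longrightarrow> module R B \<longrightarrow>
       (\<forall>g \<in> linear_maps R A B. g ` carrier A = carrier B \<longrightarrow>
         (\<forall>f \<in> linear_maps R P B. \<exists>h \<in> linear_maps R P A. \<forall>x\<in>carrier P. g (h x) = f x)))"

text \<open>
  \<open>\<dots> \<rightarrow> P 2 \<rightarrow> P 1 \<rightarrow> P 0 \<rightarrow> M \<rightarrow> 0\<close> is exact with all \<open>P i\<close> projective, where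
  \<open>\<delta> i : P (i + 1) \<rightarrow> P i\<close> and \<open>\<epsilon> : P 0 \<rightarrow> M\<close>.
\<close>

definition projective_resolution ::
  "('a, 'b) ring_scheme \<Rightarrow> (nat \<Rightarrow> ('a, 'u) module) \<Rightarrow> (nat \<Rightarrow> 'u \<Rightarrow> 'u) \<Rightarrow> ('u \<Rightarrow> 'm)
    \<Rightarrow> ('a, 'm) module \<Rightarrow> bool"
  where "projective_resolution R P \<delta> \<epsilon> M \<longleftrightarrow>
    (\<forall>i. projective_module R (P i)) \<and>
    (\<forall>i. \<delta> i \<in> linear_maps R (P (Suc i)) (P i)) \<and>
    \<epsilon> \<in> linear_maps R (P 0) M \<and>
    \<epsilon> ` carrier (P 0) = carrier M \<and>
    \<delta> 0 ` carrier (P 1) = a_kernel (P 0) M \<epsilon> \<and>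
    (\<forall>i. \<delta> (Suc i) ` carrier (P (Suc (Suc i))) = a_kernel (P (Suc i)) (P i) (\<delta> i))"

text \<open>
  A finite exact sequence \<open>0 \<rightarrow> P n \<rightarrow> \<dots> \<rightarrow> P 0 \<rightarrow> M \<rightarrow> 0\<close> is a resolution that vanishes in all
  degrees above \<open>n\<close>.
\<close>

definition has_projective_resolution_of_length ::
  "('a, 'b) ring_scheme \<Rightarrow> ('a, 'm) module \<Rightarrow> nat \<Rightarrow> bool"
  where "has_projective_resolution_of_length R M n \<longleftrightarrow>
    (\<exists>(P :: nat \<Rightarrow> ('a, 'm) aux_module) \<delta> \<epsilon>.
       projective_resolution R P \<delta> \<epsilon> M \<and> (\<forall>i>n. trivial_module (P i)))"

definition has_finite_projective_resolution ::
  "('a, 'b) ring_scheme \<Rightarrow> ('a, 'm) module \<Rightarrow> bool"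
  where "has_finite_projective_resolution R M \<longleftrightarrow>
    (\<exists>n (P :: nat \<Rightarrow> ('a, 'm) aux_module) \<delta> \<epsilon>.
       projective_resolution R P \<delta> \<epsilon> M \<and> (\<forall>i>n. trivial_module (P i)) \<and>
       (\<forall>i. fg_module R (P i)))"

text \<open>The infimum of the empty set is \<open>\<infinity>\<close>; the zero module has projective dimension \<open>0\<close>.\<close>

definition proj_dim :: "('a, 'b) ring_scheme \<Rightarrow> ('a, 'm) module \<Rightarrow> enat"
  where "proj_dim R M = Inf {enat n | n. has_projective_resolution_of_length R M n}"

text \<open>
  A module with a finite projective resolution is finitely generated, hence isomorphic to one
  with elements in the type \<open>'a list\<close>; so the supremum is the one over all such modules.
\<close>

definition fPD :: "('a, 'b) ring_scheme \<Rightarrow> enat"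
  where "fPD R =
    Sup {proj_dim R M | M :: ('a, 'a list) module.
           module R M \<and> has_finite_projective_resolution R M}"


section \<open>Ext\<close>

text \<open>
  For a complex \<open>\<dots> \<rightarrow> P 1 \<rightarrow> P 0\<close> this is the \<open>i\<close>-th cohomology module of the complex
  \<open>0 \<rightarrow> Hom(P 0, N) \<rightarrow> Hom(P 1, N) \<rightarrow> \<dots>\<close>.
\<close>

definition Hom_differential ::
  "(nat \<Rightarrow> ('a, 'u) module) \<Rightarrow> (nat \<Rightarrow> 'u \<Rightarrow> 'u) \<Rightarrow> nat \<Rightarrow> ('u \<Rightarrow> 'n) \<Rightarrow> 'u \<Rightarrow> 'n"
  where "Hom_differential P \<delta> i f = (\<lambda>x\<in>carrier (P (Suc i)). f (\<delta> i x))"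

definition Hom_cocycles ::
  "('a, 'b) ring_scheme \<Rightarrow> (nat \<Rightarrow> ('a, 'u) module) \<Rightarrow> (nat \<Rightarrow> 'u \<Rightarrow> 'u)
    \<Rightarrow> ('a, 'n) module \<Rightarrow> nat \<Rightarrow> ('u \<Rightarrow> 'n) set"
  where "Hom_cocycles R P \<delta> N i =
    a_kernel (Hom_module R (P i) N) (Hom_module R (P (Suc i)) N) (Hom_differential P \<delta> i)"

primrec Hom_coboundaries ::
  "('a, 'b) ring_scheme \<Rightarrow> (nat \<Rightarrow> ('a, 'u) module) \<Rightarrow> (nat \<Rightarrow> 'u \<Rightarrow> 'u)
    \<Rightarrow> ('a, 'n) module \<Rightarrow> nat \<Rightarrow> ('u \<Rightarrow> 'n) set"
  where
    "Hom_coboundaries R P \<delta> N 0 = {\<zero>\<^bsub>Hom_module R (P 0) N\<^esub>}"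
  | "Hom_coboundaries R P \<delta> N (Suc i) =
       Hom_differential P \<delta> i ` carrier (Hom_module R (P i) N)"

definition Hom_cohomology ::
  "('a, 'b) ring_scheme \<Rightarrow> (nat \<Rightarrow> ('a, 'u) module) \<Rightarrow> (nat \<Rightarrow> 'u \<Rightarrow> 'u)
    \<Rightarrow> ('a, 'n) module \<Rightarrow> nat \<Rightarrow> ('a, ('u \<Rightarrow> 'n) set) module"
  where "Hom_cohomology R P \<delta> N i =
    quotient_module ((Hom_module R (P i) N)\<lparr>carrier := Hom_cocycles R P \<delta> N i\<rparr>)
      (Hom_coboundaries R P \<delta> N i)"

text \<open>
  The chosen resolution exists, and the result is independent of it up to isomorphism.
\<close>

definition Ext ::
  "('a, 'b) ring_scheme \<Rightarrow> nat \<Rightarrow> ('a, 'm) module \<Rightarrow> ('a, 'n) module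
    \<Rightarrow> ('a, (('a \<times> 'm) list \<Rightarrow> 'n) set) module"
  where "Ext R i M N =
    (let (P, \<delta>) = (SOME (P :: nat \<Rightarrow> ('a, 'm) aux_module, \<delta>).
                     \<exists>\<epsilon>. projective_resolution R P \<delta> \<epsilon> M)
     in Hom_cohomology R P \<delta> N i)"

end

theory Submission
  imports Defs
begin

text \<open>
  Let \<open>I = (x\<^sub>1, \<dots>, x\<^sub>n)\<close>. If \<open>Ext\<^sup>i(R/I, R) = 0\<close> for \<open>i \<le> d\<close>, then the dual Koszul complex of
  \<open>x\<^sub>1, \<dots>, x\<^sub>n\<close> is exact up to degree \<open>d\<close>. If \<open>Ext\<close> vanishes in all degrees, exactness in the top
  degree \<open>n\<close> gives \<open>I = R\<close>; so the criterion says that \<open>I = R\<close> as soon as \<open>Ext\<close> vanishes up to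
  degree \<open>d\<close>.

  If \<open>fPD(R) \<le> d\<close>, the truncation of the dual Koszul complex resolves its cokernel by \<open>d + 2\<close> finite
  free modules, so its first map \<open>R \<rightarrow> R\<^sup>n\<close> splits, which means \<open>I = R\<close>.

  Conversely, let \<open>0 \<rightarrow> Q\<^sub>n \<rightarrow> Q\<^sub>n\<^sub>-\<^sub>1 \<rightarrow> \<dots>\<close> be a finite projective resolution with \<open>n > d\<close>. If an element
  \<open>e\<close> of \<open>Q\<^sub>n\<close> is unimodular modulo \<open>I\<close> and is mapped into \<open>I Q\<^sub>n\<^sub>-\<^sub>1\<close>, then \<open>Ext\<^sup>i(R/I, R) = 0\<close> for
  \<open>i < n\<close>, hence \<open>I = R\<close>. As the smallest such \<open>I\<close> is always the unit ideal, \<open>Q\<^sub>n \<rightarrow> Q\<^sub>n\<^sub>-\<^sub>1\<close> splits and the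
  resolution can be shortened.
\<close>


section \<open>Linear maps and submodules\<close>

text \<open>Only the vanishing of \<open>Ext\<close> matters, so long exact sequences and connecting
  maps are replaced by statements about cocycles and coboundaries of one projective resolution of
  \<open>R/I\<close>. That \<open>I\<close> kills \<open>Ext\<close> becomes the fact that
  multiplication by an element of \<open>I\<close> on this resolution is null-homotopic.

  The passage from unit ideals to a splitting is global, without localisation. For \<open>e\<close>
  in the top module and a functional \<open>f\<close> on it, the relevant ideal is generated by
  \<open>1 - f e\<close> and the finitely many coordinates of the image \<open>\<phi> e\<close>.
  That it contains \<open>1\<close> reads \<open>1 = \<psi> (\<phi> e) + r (1 - f e)\<close> with a
  single functional \<open>\<psi>\<close> and a single scalar \<open>r\<close>. Such equations take
  the place of the hypothesis of Nakayama's lemma, and finitely many of them, one for each member of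
  a dual basis, produce a left inverse of \<open>\<phi>\<close>.

  A second obstacle is typing. Projectivity, resolutions and \<open>fPD\<close> prescribe carrier
  types, while Koszul modules, cokernels and free covers arise in others. Lifting arguments are
  therefore made independent of carrier types, and finished objects are recoded as lists.\<close>

lemma linear_mapsI:
  assumes "\<And>x. x \<in> carrier M \<Longrightarrow> f x \<in> carrier N"
    and "\<And>x y. x \<in> carrier M \<Longrightarrow> y \<in> carrier M \<Longrightarrow> f (x \<oplus>\<^bsub>M\<^esub> y) = f x \<oplus>\<^bsub>N\<^esub> f y"
    and "\<And>a x. a \<in> carrier R \<Longrightarrow> x \<in> carrier M \<Longrightarrow> f (a \<odot>\<^bsub>M\<^esub> x) = a \<odot>\<^bsub>N\<^esub> f x"
  shows "f \<in> linear_maps R M N"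
  using assms by (auto simp: linear_maps_def hom_def)

lemma linear_map_closed:
  "f \<in> linear_maps R M N \<Longrightarrow> x \<in> carrier M \<Longrightarrow> f x \<in> carrier N"
  by (auto simp: linear_maps_def hom_def)

lemma linear_map_add:
  "f \<in> linear_maps R M N \<Longrightarrow> x \<in> carrier M \<Longrightarrow> y \<in> carrier M \<Longrightarrow> f (x \<oplus>\<^bsub>M\<^esub> y) = f x \<oplus>\<^bsub>N\<^esub> f y"
  by (auto simp: linear_maps_def hom_def)

lemma linear_map_smult:
  "f \<in> linear_maps R M N \<Longrightarrow> a \<in> carrier R \<Longrightarrow> x \<in> carrier M \<Longrightarrow> f (a \<odot>\<^bsub>M\<^esub> x) = a \<odot>\<^bsub>N\<^esub> f x"
  by (auto simp: linear_maps_def hom_def)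

lemma linear_map_zero:
  assumes "module R M" "module R N" "f \<in> linear_maps R M N"
  shows "f \<zero>\<^bsub>M\<^esub> = \<zero>\<^bsub>N\<^esub>"
proof -
  interpret M: module R M by fact
  interpret N: module R N by fact
  have "f (\<zero>\<^bsub>R\<^esub> \<odot>\<^bsub>M\<^esub> \<zero>\<^bsub>M\<^esub>) = \<zero>\<^bsub>R\<^esub> \<odot>\<^bsub>N\<^esub> f \<zero>\<^bsub>M\<^esub>"
    using assms(3) by (intro linear_map_smult[of f R]) auto
  then show ?thesis using linear_map_closed[OF assms(3)] by simp
qed

lemma linear_map_uminus:
  assumes "module R M" "module R N" "f \<in> linear_maps R M N" "x \<in> carrier M"
  shows "f (\<ominus>\<^bsub>M\<^esub> x) = \<ominus>\<^bsub>N\<^esub> f x"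
proof -
  interpret M: module R M by fact
  interpret N: module R N by fact
  have "f x \<oplus>\<^bsub>N\<^esub> f (\<ominus>\<^bsub>M\<^esub> x) = \<zero>\<^bsub>N\<^esub>"
    using assms linear_map_add[OF assms(3), of x "\<ominus>\<^bsub>M\<^esub> x"] linear_map_zero[OF assms(1-3)]
    by (simp add: M.M.r_neg)
  then show ?thesis using assms linear_map_closed[OF assms(3)]
    by (metis N.M.minus_equality N.M.a_comm M.M.a_inv_closed)
qed

lemma linear_map_minus:
  assumes "module R M" "module R N" "f \<in> linear_maps R M N" "x \<in> carrier M" "y \<in> carrier M"
  shows "f (x \<ominus>\<^bsub>M\<^esub> y) = f x \<ominus>\<^bsub>N\<^esub> f y"
proof -
  interpret M: module R M by fact
  show ?thesis using assms linear_map_uminus[OF assms(1-3)] 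
    by (simp add: a_minus_def linear_map_add[OF assms(3)])
qed

lemma linear_map_finsum:
  assumes "module R M" "module R N" "f \<in> linear_maps R M N" "g \<in> A \<rightarrow> carrier M" "finite A"
  shows "f (finsum M g A) = finsum N (\<lambda>x. f (g x)) A"
proof -
  interpret M: module R M by fact
  interpret N: module R N by fact
  from assms(5,4) show ?thesis
  proof (induct A)
    case empty
    then show ?case using linear_map_zero[OF assms(1-3)] by simp
  next
    case (insert a A)
    then have "g \<in> A \<rightarrow> carrier M" "g a \<in> carrier M" by auto
    moreover have "(\<lambda>x. f (g x)) \<in> A \<rightarrow> carrier N" "f (g a) \<in> carrier N"
      using calculation linear_map_closed[OF assms(3)] by auto
    ultimately show ?case using insert
      by (simp add: linear_map_add[OF assms(3)])
  qed
qed

lemma linear_maps_comp: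
  "f \<in> linear_maps R M N \<Longrightarrow> g \<in> linear_maps R N L \<Longrightarrow> (\<lambda>x. g (f x)) \<in> linear_maps R M L"
  by (auto simp: linear_maps_def hom_def Pi_iff)

lemma linear_maps_id: "(\<lambda>x. x) \<in> linear_maps R M M"
  by (auto simp: linear_maps_def hom_def)

lemma linear_maps_cong:
  assumes "module R M" "f \<in> linear_maps R M N" "\<And>x. x \<in> carrier M \<Longrightarrow> g x = f x"
  shows "g \<in> linear_maps R M N"
proof -
  interpret M: module R M by fact
  show ?thesis using assms(2,3) by (auto simp: linear_maps_def hom_def Pi_def)
qed

lemma linear_maps_add:
  assumes "module R N" "f \<in> linear_maps R M N" "g \<in> linear_maps R M N"
  shows "(\<lambda>x. f x \<oplus>\<^bsub>N\<^esub> g x) \<in> linear_maps R M N"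
proof -
  interpret N: module R N by fact
  show ?thesis using assms(2,3)
    by (auto intro!: linear_mapsI simp: linear_map_closed[of _ R M N] linear_map_add[of _ R M N]
      linear_map_smult[of _ R M N] N.M.a_ac N.smult_r_distr)
qed

lemma linear_maps_smult:
  assumes "module R N" "f \<in> linear_maps R M N" "a \<in> carrier R"
  shows "(\<lambda>x. a \<odot>\<^bsub>N\<^esub> f x) \<in> linear_maps R M N"
proof -
  interpret N: module R N by fact
  have "a \<odot>\<^bsub>N\<^esub> (b \<odot>\<^bsub>N\<^esub> y) = b \<odot>\<^bsub>N\<^esub> (a \<odot>\<^bsub>N\<^esub> y)" if "b \<in> carrier R" "y \<in> carrier N" for b y
    using that assms by (metis N.smult_assoc1 N.R.m_comm)
  then show ?thesis using assms(2,3)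
    by (auto intro!: linear_mapsI simp: linear_map_closed[of _ R M N] linear_map_add[of _ R M N]
      linear_map_smult[of _ R M N] N.smult_r_distr)
qed

lemma linear_maps_uminus:
  assumes "module R N" "f \<in> linear_maps R M N"
  shows "(\<lambda>x. \<ominus>\<^bsub>N\<^esub> f x) \<in> linear_maps R M N"
proof -
  interpret N: module R N by fact
  show ?thesis using assms(2)
    by (auto intro!: linear_mapsI simp: linear_map_closed[of _ R M N] linear_map_add[of _ R M N]
      linear_map_smult[of _ R M N] N.M.minus_add N.smult_r_minus)
qed

lemma linear_maps_minus:
  assumes "module R N" "f \<in> linear_maps R M N" "g \<in> linear_maps R M N"
  shows "(\<lambda>x. f x \<ominus>\<^bsub>N\<^esub> g x) \<in> linear_maps R M N"
  using linear_maps_add[OF assms(1,2) linear_maps_uminus[OF assms(1,3)]] by (simp add: a_minus_def)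

lemma linear_maps_const_zero:
  assumes "module R N" shows "(\<lambda>x. \<zero>\<^bsub>N\<^esub>) \<in> linear_maps R M N"
proof -
  interpret N: module R N by fact
  show ?thesis by (auto intro!: linear_mapsI)
qed

lemma linear_maps_finsum:
  assumes "module R M" "module R N" "finite A" "\<And>a. a \<in> A \<Longrightarrow> f a \<in> linear_maps R M N"
  shows "(\<lambda>x. \<Oplus>\<^bsub>N\<^esub>a\<in>A. f a x) \<in> linear_maps R M N"
proof -
  interpret M: module R M by fact
  interpret N: module R N by fact
  from assms(3,4) show ?thesis
  proof (induct A)
    case empty then show ?case by (simp add: linear_maps_const_zero[OF assms(2)])
  next
    case (insert a A)
    have "(\<lambda>x. f a x \<oplus>\<^bsub>N\<^esub> (\<Oplus>\<^bsub>N\<^esub>a\<in>A. f a x)) \<in> linear_maps R M N"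
      using insert by (intro linear_maps_add[OF assms(2)]) auto
    then show ?case
    proof (rule linear_maps_cong[OF assms(1)])
      fix x assume x: "x \<in> carrier M"
      have "(\<lambda>a. f a x) \<in> A \<rightarrow> carrier N" "f a x \<in> carrier N"
        using insert.prems x linear_map_closed[of _ R M N] by blast+
      then show "(\<Oplus>\<^bsub>N\<^esub>a\<in>insert a A. f a x) = f a x \<oplus>\<^bsub>N\<^esub> (\<Oplus>\<^bsub>N\<^esub>a\<in>A. f a x)"
        using insert by simp
    qed
  qed
qed

lemma linear_maps_smult_const:
  assumes "module R N" "f \<in> linear_maps R M (regular_module R)" "n \<in> carrier N"
  shows "(\<lambda>x. f x \<odot>\<^bsub>N\<^esub> n) \<in> linear_maps R M N"
proof -
  interpret N: module R N by fact
  have "x \<in> carrier M \<Longrightarrow> f x \<in> carrier R" for x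
    using linear_map_closed[OF assms(2)] by (simp add: regular_module_def)
  then show ?thesis using linear_map_add[OF assms(2)] linear_map_smult[OF assms(2)] assms(3)
    by (auto intro!: linear_mapsI simp: N.smult_l_distr N.smult_assoc1 regular_module_def)
qed

lemma regular_module_simps [simp]:
  "carrier (regular_module R) = carrier R"
  "\<zero>\<^bsub>regular_module R\<^esub> = \<zero>\<^bsub>R\<^esub>"
  "add (regular_module R) = add R"
  "smult (regular_module R) = mult R"
  by (auto simp: regular_module_def)

lemma (in cring) module_regular: "module R (regular_module R)"
proof (rule moduleI)
  show "abelian_group (regular_module R)"
  proof (rule abelian_groupI)
    show "\<exists>y\<in>carrier (regular_module R). y \<oplus>\<^bsub>regular_module R\<^esub> x = \<zero>\<^bsub>regular_module R\<^esub>"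
      if "x \<in> carrier (regular_module R)" for x
      using that by (auto intro!: bexI[of _ "\<ominus> x"] simp: l_neg)
  qed (auto simp: a_ac)
qed (auto simp: l_distr r_distr m_assoc is_cring)

lemma (in cring) regular_module_a_inv:
  "x \<in> carrier R \<Longrightarrow> \<ominus>\<^bsub>regular_module R\<^esub> x = \<ominus> x"
proof -
  interpret r: module R "regular_module R" by (rule module_regular)
  assume "x \<in> carrier R"
  then show ?thesis using r.smult_l_minus[of \<one> x] by (simp add: l_minus)
qed

lemma (in cring) regular_module_minus:
  "x \<in> carrier R \<Longrightarrow> y \<in> carrier R \<Longrightarrow> x \<ominus>\<^bsub>regular_module R\<^esub> y = x \<ominus> y"
  by (simp add: a_minus_def regular_module_a_inv)

section \<open>Submodules, kernels and images\<close>

abbreviation sub_module :: "('a, 'm) module \<Rightarrow> 'm set \<Rightarrow> ('a, 'm) module"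
  where "sub_module M A \<equiv> M\<lparr>carrier := A\<rparr>"

text \<open>Closure under negation comes from the scalar \<open>-1\<close>, so closure under sums
  and scalars suffices.\<close>

lemma module_sub_module:
  assumes "module R M" "A \<subseteq> carrier M" "\<zero>\<^bsub>M\<^esub> \<in> A"
    "\<And>x y. x \<in> A \<Longrightarrow> y \<in> A \<Longrightarrow> x \<oplus>\<^bsub>M\<^esub> y \<in> A"
    "\<And>a x. a \<in> carrier R \<Longrightarrow> x \<in> A \<Longrightarrow> a \<odot>\<^bsub>M\<^esub> x \<in> A"
  shows "submodule A R M" "module R (sub_module M A)"
proof -
  interpret M: module R M by fact
  have "\<ominus>\<^bsub>M\<^esub> x \<in> A" if "x \<in> A" for x
    using assms(2) assms(5)[of "\<ominus>\<^bsub>R\<^esub> \<one>\<^bsub>R\<^esub>" x] that M.smult_l_minus[of "\<one>\<^bsub>R\<^esub>" x] by auto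
  then show "submodule A R M" using assms by (intro M.submoduleI) auto
  then show "module R (sub_module M A)"
    using submodule.submodule_is_module[of A R M] assms(1) by simp
qed

lemma module_kernel:
  assumes "module R M" "module R N" "f \<in> linear_maps R M N"
  shows "submodule {x \<in> carrier M. f x = \<zero>\<^bsub>N\<^esub>} R M"
    "module R (sub_module M {x \<in> carrier M. f x = \<zero>\<^bsub>N\<^esub>})"
proof -
  interpret M: module R M by fact
  interpret N: module R N by fact
  note * = linear_map_add[OF assms(3)] linear_map_smult[OF assms(3)] linear_map_zero[OF assms]
  show "submodule {x \<in> carrier M. f x = \<zero>\<^bsub>N\<^esub>} R M"
    "module R (sub_module M {x \<in> carrier M. f x = \<zero>\<^bsub>N\<^esub>})"
    by (rule module_sub_module[OF assms(1)]; auto simp: *)+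
qed

lemma module_image:
  assumes "module R M" "module R N" "f \<in> linear_maps R M N"
  shows "submodule (f ` carrier M) R N" "module R (sub_module N (f ` carrier M))"
proof -
  interpret M: module R M by fact
  interpret N: module R N by fact
  have 1: "f ` carrier M \<subseteq> carrier N" using linear_map_closed[OF assms(3)] by auto
  have 2: "\<zero>\<^bsub>N\<^esub> \<in> f ` carrier M" using linear_map_zero[OF assms] by (metis M.M.zero_closed imageI)
  have 3: "x \<oplus>\<^bsub>N\<^esub> y \<in> f ` carrier M" if "x \<in> f ` carrier M" "y \<in> f ` carrier M" for x y
    using that by (force simp: linear_map_add[OF assms(3), symmetric])
  have 4: "a \<odot>\<^bsub>N\<^esub> x \<in> f ` carrier M" if "a \<in> carrier R" "x \<in> f ` carrier M" for x a
    using that by (force simp: linear_map_smult[OF assms(3), symmetric])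
  show "submodule (f ` carrier M) R N" "module R (sub_module N (f ` carrier M))"
    using 1 2 3 4 by (rule module_sub_module[OF assms(2)]; blast)+
qed

lemma linear_maps_into_sub_module:
  "f \<in> linear_maps R M (sub_module N A) \<Longrightarrow> A \<subseteq> carrier N \<Longrightarrow> f \<in> linear_maps R M N"
  by (auto simp: linear_maps_def hom_def)

lemma linear_maps_sub_moduleI:
  "f \<in> linear_maps R M N \<Longrightarrow> (\<And>x. x \<in> carrier M \<Longrightarrow> f x \<in> A) \<Longrightarrow> f \<in> linear_maps R M (sub_module N A)"
  by (auto simp: linear_maps_def hom_def)

lemma linear_maps_from_sub_module:
  "f \<in> linear_maps R M N \<Longrightarrow> A \<subseteq> carrier M \<Longrightarrow> f \<in> linear_maps R (sub_module M A) N"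
  by (auto simp: linear_maps_def hom_def subset_iff)

text \<open>
  The definitions prescribe the carrier types of auxiliary modules, so modules constructed in other
  types have to be moved along injections.
\<close>

definition transport_module :: "('m \<Rightarrow> 'n) \<Rightarrow> ('a, 'm) module \<Rightarrow> ('a, 'n) module"
  where "transport_module J M =
    \<lparr>carrier = J ` carrier M, mult = undefined, one = undefined, zero = J \<zero>\<^bsub>M\<^esub>,
     add = (\<lambda>x y. J (inv_into (carrier M) J x \<oplus>\<^bsub>M\<^esub> inv_into (carrier M) J y)),
     smult = (\<lambda>a x. J (a \<odot>\<^bsub>M\<^esub> inv_into (carrier M) J x))\<rparr>"

lemma carrier_transport_module [simp]: "carrier (transport_module J M) = J ` carrier M"
  by (simp add: transport_module_def)

lemma transport_module:
  assumes "module R M" "inj_on J (carrier M)"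
  shows "module R (transport_module J M)"
    and "J \<in> linear_maps R M (transport_module J M)"
    and "inv_into (carrier M) J \<in> linear_maps R (transport_module J M) M"
proof -
  interpret M: module R M by fact
  have [simp]: "inv_into (carrier M) J (J x) = x" if "x \<in> carrier M" for x
    using assms(2) that by simp
  show "module R (transport_module J M)"
  proof (rule moduleI)
    show "abelian_group (transport_module J M)"
    proof (rule abelian_groupI)
      show "\<exists>y\<in>carrier (transport_module J M). y \<oplus>\<^bsub>transport_module J M\<^esub> x = \<zero>\<^bsub>transport_module J M\<^esub>"
        if "x \<in> carrier (transport_module J M)" for x
      proof (rule bexI)
        show "J (\<ominus>\<^bsub>M\<^esub> inv_into (carrier M) J x) \<oplus>\<^bsub>transport_module J M\<^esub> x = \<zero>\<^bsub>transport_module J M\<^esub>"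
          using that by (auto simp: transport_module_def M.M.l_neg)
      qed (use that in auto)
    qed (auto simp: transport_module_def M.M.a_ac)
  qed (auto simp: transport_module_def M.smult_l_distr M.smult_r_distr M.smult_assoc1 M.R.is_cring)
  show "J \<in> linear_maps R M (transport_module J M)"
    by (rule linear_mapsI) (auto simp: transport_module_def)
  show "inv_into (carrier M) J \<in> linear_maps R (transport_module J M) M"
    by (rule linear_mapsI) (auto simp: transport_module_def)
qed


section \<open>Free modules and dual bases\<close>

text \<open>Elements are total functions vanishing outside \<open>X\<close>: equality in the module
  is plain equality of functions, and evaluation at any index whatsoever is linear.\<close>

definition free_module :: "('a, 'b) ring_scheme \<Rightarrow> 'x set \<Rightarrow> ('a, 'x \<Rightarrow> 'a) module"
  where "free_module R X =
    \<lparr>carrier = {f. (\<forall>x. f x \<in> carrier R) \<and> (\<forall>x. x \<notin> X \<longrightarrow> f x = \<zero>\<^bsub>R\<^esub>) \<and> finite {x \<in> X. f x \<noteq> \<zero>\<^bsub>R\<^esub>}},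
     mult = undefined, one = undefined, zero = (\<lambda>x. \<zero>\<^bsub>R\<^esub>),
     add = (\<lambda>f g x. f x \<oplus>\<^bsub>R\<^esub> g x), smult = (\<lambda>a f x. a \<otimes>\<^bsub>R\<^esub> f x)\<rparr>"

lemma free_module_simps [simp]:
  "\<zero>\<^bsub>free_module R X\<^esub> = (\<lambda>x. \<zero>\<^bsub>R\<^esub>)"
  "f \<oplus>\<^bsub>free_module R X\<^esub> g = (\<lambda>x. f x \<oplus>\<^bsub>R\<^esub> g x)"
  "a \<odot>\<^bsub>free_module R X\<^esub> f = (\<lambda>x. a \<otimes>\<^bsub>R\<^esub> f x)"
  by (auto simp: free_module_def)

lemma free_module_carrier:
  "f \<in> carrier (free_module R X) \<longleftrightarrow>
    (\<forall>x. f x \<in> carrier R) \<and> (\<forall>x. x \<notin> X \<longrightarrow> f x = \<zero>\<^bsub>R\<^esub>) \<and> finite {x \<in> X. f x \<noteq> \<zero>\<^bsub>R\<^esub>}"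
  by (auto simp: free_module_def)

text \<open>
  A dual basis of \<open>P\<close>: it characterises projectivity without reference to any universe of test
  modules, so that it mediates between the different carrier types.
\<close>

definition dual_basis ::
  "('a, 'b) ring_scheme \<Rightarrow> ('a, 'm) module \<Rightarrow> 's set \<Rightarrow> ('s \<Rightarrow> 'm) \<Rightarrow> ('s \<Rightarrow> 'm \<Rightarrow> 'a) \<Rightarrow> bool"
  where "dual_basis R P S e c \<longleftrightarrow>
    e \<in> S \<rightarrow> carrier P \<and> (\<forall>s\<in>S. c s \<in> linear_maps R P (regular_module R)) \<and>
    (\<forall>x\<in>carrier P. finite {s \<in> S. c s x \<noteq> \<zero>\<^bsub>R\<^esub>} \<and>
      x = finsum P (\<lambda>s. c s x \<odot>\<^bsub>P\<^esub> e s) {s \<in> S. c s x \<noteq> \<zero>\<^bsub>R\<^esub>})"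

lemma dual_basisD:
  assumes "dual_basis R P S e c"
  shows "s \<in> S \<Longrightarrow> e s \<in> carrier P"
    and "s \<in> S \<Longrightarrow> c s \<in> linear_maps R P (regular_module R)"
    and "s \<in> S \<Longrightarrow> x \<in> carrier P \<Longrightarrow> c s x \<in> carrier R"
    and "x \<in> carrier P \<Longrightarrow> finite {s \<in> S. c s x \<noteq> \<zero>\<^bsub>R\<^esub>}"
    and "x \<in> carrier P \<Longrightarrow> x = finsum P (\<lambda>s. c s x \<odot>\<^bsub>P\<^esub> e s) {s \<in> S. c s x \<noteq> \<zero>\<^bsub>R\<^esub>}"
proof -
  show c: "s \<in> S \<Longrightarrow> c s \<in> linear_maps R P (regular_module R)" using assms unfolding dual_basis_def by blast
  show "s \<in> S \<Longrightarrow> x \<in> carrier P \<Longrightarrow> c s x \<in> carrier R" using linear_map_closed[OF c] by simp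
qed (use assms in \<open>unfold dual_basis_def, blast\<close>)+

text \<open>The index set of a dual basis expansion depends on the element expanded. Enlarging it to
  a common finite set makes two expansions comparable.\<close>

lemma finsum_smult_superset:
  assumes "module R N" "a \<in> S \<rightarrow> carrier N" "r \<in> S \<rightarrow> carrier R" "finite T" "T \<subseteq> S"
    "{s \<in> S. r s \<noteq> \<zero>\<^bsub>R\<^esub>} \<subseteq> T"
  shows "finsum N (\<lambda>s. r s \<odot>\<^bsub>N\<^esub> a s) {s \<in> S. r s \<noteq> \<zero>\<^bsub>R\<^esub>} = finsum N (\<lambda>s. r s \<odot>\<^bsub>N\<^esub> a s) T"
proof -
  interpret N: module R N by fact
  show ?thesis
    using assms(2-6)
    by (intro N.M.add.finprod_mono_neutral_cong_left) (auto simp: Pi_iff subset_iff)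
qed

context cring begin

lemma module_free_module: "module R (free_module R X)"
proof (rule moduleI)
  show "abelian_group (free_module R X)"
  proof (rule abelian_groupI)
    show "\<exists>y\<in>carrier (free_module R X). y \<oplus>\<^bsub>free_module R X\<^esub> f = \<zero>\<^bsub>free_module R X\<^esub>"
      if f: "f \<in> carrier (free_module R X)" for f
    proof (rule bexI)
      have "{x \<in> X. \<ominus> f x \<noteq> \<zero>} \<subseteq> {x \<in> X. f x \<noteq> \<zero>}" by auto
      then show "(\<lambda>x. \<ominus> f x) \<in> carrier (free_module R X)"
        using f by (auto simp: free_module_carrier intro: finite_subset)
    qed (use f in \<open>auto simp: free_module_carrier l_neg\<close>)
    fix f g assume fg: "f \<in> carrier (free_module R X)" "g \<in> carrier (free_module R X)"
    have "{x \<in> X. f x \<oplus> g x \<noteq> \<zero>} \<subseteq> {x \<in> X. f x \<noteq> \<zero>} \<union> {x \<in> X. g x \<noteq> \<zero>}" by auto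
    moreover have "finite ({x \<in> X. f x \<noteq> \<zero>} \<union> {x \<in> X. g x \<noteq> \<zero>})"
      using fg by (auto simp: free_module_carrier)
    ultimately have "finite {x \<in> X. f x \<oplus> g x \<noteq> \<zero>}" by (rule finite_subset)
    then show "f \<oplus>\<^bsub>free_module R X\<^esub> g \<in> carrier (free_module R X)"
      using fg by (auto simp: free_module_carrier)
  qed (auto simp: free_module_carrier a_ac)
  fix a f assume *: "a \<in> carrier R" "f \<in> carrier (free_module R X)"
  have "{x \<in> X. a \<otimes> f x \<noteq> \<zero>} \<subseteq> {x \<in> X. f x \<noteq> \<zero>}" using * by auto
  then show "a \<odot>\<^bsub>free_module R X\<^esub> f \<in> carrier (free_module R X)"
    using * by (auto simp: free_module_carrier intro: finite_subset)
qed (auto simp: l_distr r_distr m_assoc is_cring free_module_carrier)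

lemma finsum_free_module_apply:
  assumes "finite T" "F \<in> T \<rightarrow> carrier (free_module R X)"
  shows "finsum (free_module R X) F T y = finsum R (\<lambda>t. F t y) T"
proof -
  interpret F: module R "free_module R X" by (rule module_free_module)
  from assms show ?thesis
  proof (induct T)
    case (insert t T)
    then have "F \<in> T \<rightarrow> carrier (free_module R X)" "F t \<in> carrier (free_module R X)" by auto
    moreover from this have "(\<lambda>t. F t y) \<in> T \<rightarrow> carrier R" "F t y \<in> carrier R"
      by (auto simp: free_module_carrier Pi_iff)
    ultimately show ?case using insert by simp
  qed simp
qed

abbreviation (input) free_basis :: "'x \<Rightarrow> 'x \<Rightarrow> 'a"
  where "free_basis x \<equiv> (\<lambda>y. if y = x then \<one> else \<zero>)"

lemma free_basis_carrier: "x \<in> X \<Longrightarrow> free_basis x \<in> carrier (free_module R X)"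
proof -
  assume x: "x \<in> X"
  have "{y \<in> X. (if y = x then \<one> else \<zero>) \<noteq> \<zero>} \<subseteq> {x}" by auto
  then have "finite {y \<in> X. (if y = x then \<one> else \<zero>) \<noteq> \<zero>}" by (rule finite_subset) simp
  then show ?thesis using x by (auto simp: free_module_carrier)
qed

lemma linear_maps_free_coordinate: "(\<lambda>f. f x) \<in> linear_maps R (free_module R X) (regular_module R)"
  by (rule linear_mapsI) (auto simp: free_module_carrier)

lemma dual_basis_free_module:
  "dual_basis R (free_module R X) X free_basis (\<lambda>x f. f x)"
  unfolding dual_basis_def
proof (intro conjI ballI)
  show "free_basis \<in> X \<rightarrow> carrier (free_module R X)" by (intro Pi_I free_basis_carrier)
  show "(\<lambda>f. f x) \<in> linear_maps R (free_module R X) (regular_module R)" for x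
    by (rule linear_maps_free_coordinate)
  fix f assume f: "f \<in> carrier (free_module R X)"
  let ?T = "{x \<in> X. f x \<noteq> \<zero>}"
  show fin: "finite ?T" using f by (auto simp: free_module_carrier)
  have fc: "f y \<in> carrier R" for y using f by (auto simp: free_module_carrier)
  interpret F: module R "free_module R X" by (rule module_free_module)
  have cl: "(\<lambda>s. f s \<odot>\<^bsub>free_module R X\<^esub> free_basis s) \<in> ?T \<rightarrow> carrier (free_module R X)"
    using free_basis_carrier fc by (auto intro!: F.smult_closed simp del: free_module_simps)
  show "f = finsum (free_module R X) (\<lambda>s. f s \<odot>\<^bsub>free_module R X\<^esub> free_basis s) ?T"
  proof
    fix y
    have "finsum (free_module R X) (\<lambda>s. f s \<odot>\<^bsub>free_module R X\<^esub> free_basis s) ?T y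
        = finsum R (\<lambda>s. if y = s then f s else \<zero>) ?T"
      unfolding finsum_free_module_apply[OF fin cl] using fc by (intro finsum_cong') auto
    also have "\<dots> = f y"
    proof (cases "y \<in> ?T")
      case True
      then show ?thesis using fc fin by (intro finsum_singleton) auto
    next
      case False
      then have "finsum R (\<lambda>s. if y = s then f s else \<zero>) ?T = finsum R (\<lambda>s. \<zero>) ?T"
        by (intro finsum_cong') auto
      also have "\<dots> = f y" using False f by (auto simp: free_module_carrier)
      finally show ?thesis .
    qed
    finally show "f y = finsum (free_module R X) (\<lambda>s. f s \<odot>\<^bsub>free_module R X\<^esub> free_basis s) ?T y" ..
  qed
qed

end

text \<open>This is the coordinate map from \<open>P\<close> to the free module on \<open>S\<close>,
  followed by the map sending basis elements to the \<open>a s\<close>. It need not send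
  \<open>e s\<close> to \<open>a s\<close>, since the \<open>e s\<close> may satisfy
  relations.\<close>

lemma dual_basis_combination:
  assumes P: "module R P" and N: "module R N" and d: "dual_basis R P S e c" and a: "a \<in> S \<rightarrow> carrier N"
  shows "(\<lambda>x. finsum N (\<lambda>s. c s x \<odot>\<^bsub>N\<^esub> a s) {s \<in> S. c s x \<noteq> \<zero>\<^bsub>R\<^esub>}) \<in> linear_maps R P N"
    (is "?h \<in> _")
proof -
  interpret P: module R P by fact
  interpret N: module R N by fact
  note c = dual_basisD(2)[OF d] and cc = dual_basisD(3)[OF d] and fin = dual_basisD(4)[OF d]
  have cadd: "c s (x \<oplus>\<^bsub>P\<^esub> y) = c s x \<oplus>\<^bsub>R\<^esub> c s y" if "s \<in> S" "x \<in> carrier P" "y \<in> carrier P" for s x y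
    using linear_map_add[OF c] that by simp
  have csm: "c s (r \<odot>\<^bsub>P\<^esub> x) = r \<otimes>\<^bsub>R\<^esub> c s x" if "s \<in> S" "x \<in> carrier P" "r \<in> carrier R" for s x r
    using linear_map_smult[OF c] that by simp
  have h: "?h x = finsum N (\<lambda>s. c s x \<odot>\<^bsub>N\<^esub> a s) T"
    if "x \<in> carrier P" "finite T" "T \<subseteq> S" "{s \<in> S. c s x \<noteq> \<zero>\<^bsub>R\<^esub>} \<subseteq> T" for x T
    using that a cc by (intro finsum_smult_superset[OF N]) (auto simp: Pi_iff)
  have mem: "(\<lambda>s. c s x \<odot>\<^bsub>N\<^esub> a s) \<in> T \<rightarrow> carrier N" if "T \<subseteq> S" "x \<in> carrier P" for x T
    using that a cc by (auto simp: Pi_iff subset_iff)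
  show ?thesis
  proof (rule linear_mapsI)
    show "?h x \<in> carrier N" if "x \<in> carrier P" for x
      using mem[OF _ that, of "{s \<in> S. c s x \<noteq> \<zero>\<^bsub>R\<^esub>}"] by (intro N.M.finsum_closed) auto
  next
    fix x y assume x: "x \<in> carrier P" and y: "y \<in> carrier P"
    let ?T = "{s \<in> S. c s x \<noteq> \<zero>\<^bsub>R\<^esub>} \<union> {s \<in> S. c s y \<noteq> \<zero>\<^bsub>R\<^esub>}"
    have T: "finite ?T" "?T \<subseteq> S" using fin x y by auto
    have "{s \<in> S. c s (x \<oplus>\<^bsub>P\<^esub> y) \<noteq> \<zero>\<^bsub>R\<^esub>} \<subseteq> ?T" using x y by (auto simp: cadd)
    then have "?h (x \<oplus>\<^bsub>P\<^esub> y) = finsum N (\<lambda>s. c s (x \<oplus>\<^bsub>P\<^esub> y) \<odot>\<^bsub>N\<^esub> a s) ?T"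
      using x y T by (intro h) auto
    also have "\<dots> = finsum N (\<lambda>s. c s x \<odot>\<^bsub>N\<^esub> a s \<oplus>\<^bsub>N\<^esub> c s y \<odot>\<^bsub>N\<^esub> a s) ?T"
      using mem[OF T(2) x] mem[OF T(2) y] x y a cc
      by (intro N.M.finsum_cong') (auto simp: cadd N.smult_l_distr Pi_iff)
    also have "\<dots> = finsum N (\<lambda>s. c s x \<odot>\<^bsub>N\<^esub> a s) ?T \<oplus>\<^bsub>N\<^esub> finsum N (\<lambda>s. c s y \<odot>\<^bsub>N\<^esub> a s) ?T"
      using mem[OF T(2) x] mem[OF T(2) y] by (intro N.M.finsum_addf)
    also have "finsum N (\<lambda>s. c s x \<odot>\<^bsub>N\<^esub> a s) ?T = ?h x" using x T by (intro h[symmetric]) auto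
    also have "finsum N (\<lambda>s. c s y \<odot>\<^bsub>N\<^esub> a s) ?T = ?h y" using y T by (intro h[symmetric]) auto
    finally show "?h (x \<oplus>\<^bsub>P\<^esub> y) = ?h x \<oplus>\<^bsub>N\<^esub> ?h y" .
  next
    fix r x assume r: "r \<in> carrier R" and x: "x \<in> carrier P"
    let ?T = "{s \<in> S. c s x \<noteq> \<zero>\<^bsub>R\<^esub>}"
    have "{s \<in> S. c s (r \<odot>\<^bsub>P\<^esub> x) \<noteq> \<zero>\<^bsub>R\<^esub>} \<subseteq> ?T" using x r by (auto simp: csm)
    then have "?h (r \<odot>\<^bsub>P\<^esub> x) = finsum N (\<lambda>s. c s (r \<odot>\<^bsub>P\<^esub> x) \<odot>\<^bsub>N\<^esub> a s) ?T"
      using x r fin by (intro h) auto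
    also have "\<dots> = finsum N (\<lambda>s. r \<odot>\<^bsub>N\<^esub> (c s x \<odot>\<^bsub>N\<^esub> a s)) ?T"
      using a cc x r by (intro N.M.finsum_cong') (auto simp: csm N.smult_assoc1 Pi_iff)
    also have "\<dots> = r \<odot>\<^bsub>N\<^esub> ?h x"
      using mem[of ?T, OF _ x] fin[OF x] r by (intro N.finsum_smult_ldistr[symmetric]) auto
    finally show "?h (r \<odot>\<^bsub>P\<^esub> x) = r \<odot>\<^bsub>N\<^esub> ?h x" .
  qed
qed

text \<open>Preimages under \<open>g\<close> of the values \<open>f (e s)\<close> are combined with
  the coordinates; expanding \<open>x\<close> along the dual basis shows that \<open>g\<close>
  carries the result to \<open>f x\<close>. Asking only that \<open>f\<close> land in the image of
  \<open>g\<close> lets exactness be used without passing to a submodule.\<close>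

lemma dual_basis_lift:
  assumes P: "module R P" and A: "module R A" and B: "module R B" and d: "dual_basis R P S e c"
    and g: "g \<in> linear_maps R A B" and f: "f \<in> linear_maps R P B"
    and im: "\<And>x. x \<in> carrier P \<Longrightarrow> f x \<in> g ` carrier A"
  obtains h where "h \<in> linear_maps R P A" "\<And>x. x \<in> carrier P \<Longrightarrow> g (h x) = f x"
proof -
  interpret P: module R P by fact
  interpret A: module R A by fact
  interpret B: module R B by fact
  note e = dual_basisD(1)[OF d]
  have "\<exists>a\<in>carrier A. g a = f (e s)" if "s \<in> S" for s using im[OF e[OF that]] by force
  then obtain a where a: "\<And>s. s \<in> S \<Longrightarrow> a s \<in> carrier A \<and> g (a s) = f (e s)" by metis
  let ?h = "\<lambda>x. finsum A (\<lambda>s. c s x \<odot>\<^bsub>A\<^esub> a s) {s \<in> S. c s x \<noteq> \<zero>\<^bsub>R\<^esub>}"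
  have h: "?h \<in> linear_maps R P A" using a by (intro dual_basis_combination[OF P A d]) auto
  note c = dual_basisD(3)[OF d]
  have "g (?h x) = f x" if x: "x \<in> carrier P" for x
  proof -
    let ?T = "{s \<in> S. c s x \<noteq> \<zero>\<^bsub>R\<^esub>}"
    have T: "finite ?T" and xT: "x = finsum P (\<lambda>s. c s x \<odot>\<^bsub>P\<^esub> e s) ?T"
      using dual_basisD(4,5)[OF d x] by blast+
    have "g (?h x) = finsum B (\<lambda>s. g (c s x \<odot>\<^bsub>A\<^esub> a s)) ?T"
      using a c x T by (intro linear_map_finsum[OF A B g]) auto
    also have "\<dots> = finsum B (\<lambda>s. f (c s x \<odot>\<^bsub>P\<^esub> e s)) ?T"
      using a c x e linear_map_closed[OF f]
      by (intro B.M.finsum_cong') (auto simp: linear_map_smult[OF g] linear_map_smult[OF f])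
    also have "\<dots> = f (finsum P (\<lambda>s. c s x \<odot>\<^bsub>P\<^esub> e s) ?T)"
      using c x e T by (intro linear_map_finsum[OF P B f, symmetric]) auto
    finally show ?thesis using xT by simp
  qed
  then show thesis using h that by blast
qed

lemma dual_basis_projective:
  assumes "module R P" "dual_basis R P S e c"
  shows "projective_module R P"
  unfolding projective_module_def
proof (intro conjI allI impI ballI)
  fix A B :: "('a, ('a \<times> 'c) list) module" and g f
  assume *: "module R A" "module R B" "g \<in> linear_maps R A B" "g ` carrier A = carrier B"
    "f \<in> linear_maps R P B"
  have "f x \<in> g ` carrier A" if "x \<in> carrier P" for x
    using *(4) linear_map_closed[OF *(5) that] by simp
  from dual_basis_lift[OF assms(1) *(1,2) assms(2) *(3,5) this]
  show "\<exists>h\<in>linear_maps R P A. \<forall>x\<in>carrier P. g (h x) = f x" by metis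
qed (fact assms(1))

lemma dual_basis_retract:
  assumes P: "module R P" and P': "module R P'" and d: "dual_basis R P S e c"
    and i: "i \<in> linear_maps R P' P" and p: "p \<in> linear_maps R P P'"
    and pi: "\<And>x. x \<in> carrier P' \<Longrightarrow> p (i x) = x"
  shows "dual_basis R P' S (\<lambda>s. p (e s)) (\<lambda>s x. c s (i x))"
  unfolding dual_basis_def
proof (intro conjI ballI)
  interpret P: module R P by fact
  interpret P': module R P' by fact
  note e = dual_basisD(1)[OF d]
  note c = dual_basisD(3)[OF d]
  show "(\<lambda>s. p (e s)) \<in> S \<rightarrow> carrier P'" using e linear_map_closed[OF p] by auto
  show "(\<lambda>x. c s (i x)) \<in> linear_maps R P' (regular_module R)" if "s \<in> S" for s
    using dual_basisD(2)[OF d that] by (rule linear_maps_comp[OF i])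
  fix x assume x: "x \<in> carrier P'"
  have ix: "i x \<in> carrier P" using linear_map_closed[OF i x] .
  let ?T = "{s \<in> S. c s (i x) \<noteq> \<zero>\<^bsub>R\<^esub>}"
  have T: "finite ?T" and xT: "i x = finsum P (\<lambda>s. c s (i x) \<odot>\<^bsub>P\<^esub> e s) ?T"
    using dual_basisD(4,5)[OF d ix] by blast+
  show "finite ?T" by fact
  have "x = p (finsum P (\<lambda>s. c s (i x) \<odot>\<^bsub>P\<^esub> e s) ?T)" using pi[OF x] xT by simp
  also have "\<dots> = finsum P' (\<lambda>s. p (c s (i x) \<odot>\<^bsub>P\<^esub> e s)) ?T"
    using c ix e T by (intro linear_map_finsum[OF P P' p]) auto
  also have "\<dots> = finsum P' (\<lambda>s. c s (i x) \<odot>\<^bsub>P'\<^esub> p (e s)) ?T"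
    using c ix e linear_map_closed[OF p] by (intro P'.M.finsum_cong') (auto simp: linear_map_smult[OF p])
  finally show "x = finsum P' (\<lambda>s. c s (i x) \<odot>\<^bsub>P'\<^esub> p (e s)) ?T" .
qed

lemma dual_basis_transport:
  assumes "module R P" "inj_on J (carrier P)" "dual_basis R P S e c"
  shows "dual_basis R (transport_module J P) S (\<lambda>s. J (e s)) (\<lambda>s x. c s (inv_into (carrier P) J x))"
proof -
  note t = transport_module[OF assms(1,2)]
  show ?thesis
    by (rule dual_basis_retract[OF assms(1) t(1) assms(3) t(3,2)]) (auto simp: f_inv_into_f)
qed

lemma finite_dual_basis:
  assumes "module R P" "dual_basis R P S e c" "finite S" "x \<in> carrier P"
  shows "x = finsum P (\<lambda>s. c s x \<odot>\<^bsub>P\<^esub> e s) S"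
proof -
  have "finsum P (\<lambda>s. c s x \<odot>\<^bsub>P\<^esub> e s) {s \<in> S. c s x \<noteq> \<zero>\<^bsub>R\<^esub>} = finsum P (\<lambda>s. c s x \<odot>\<^bsub>P\<^esub> e s) S"
    using dual_basisD(1,3)[OF assms(2)] assms(3,4) by (intro finsum_smult_superset[OF assms(1)]) auto
  then show ?thesis using dual_basisD(5)[OF assms(2,4)] by simp
qed

text \<open>A finitely supported function is determined by the list of its nonzero values.\<close>

lemma free_module_inj_list:
  "\<exists>J :: ('x \<Rightarrow> 'a) \<Rightarrow> ('a \<times> 'x) list. inj_on J (carrier (free_module R X))"
proof -
  let ?supp = "\<lambda>f :: 'x \<Rightarrow> 'a. {x \<in> X. f x \<noteq> \<zero>\<^bsub>R\<^esub>}"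
  define J where "J f = (SOME l. set l = (\<lambda>x. (f x, x)) ` ?supp f)" for f
  have J: "set (J f) = (\<lambda>x. (f x, x)) ` ?supp f" if "f \<in> carrier (free_module R X)" for f
  proof -
    have "finite ((\<lambda>x. (f x, x)) ` ?supp f)" using that by (simp add: free_module_carrier)
    from finite_list[OF this] show ?thesis unfolding J_def by (rule someI_ex)
  qed
  have "inj_on J (carrier (free_module R X))"
  proof (rule inj_onI)
    fix f g assume f: "f \<in> carrier (free_module R X)" and g: "g \<in> carrier (free_module R X)" and "J f = J g"
    then have *: "(\<lambda>x. (f x, x)) ` ?supp f = (\<lambda>x. (g x, x)) ` ?supp g"
      unfolding J[OF f, symmetric] J[OF g, symmetric] by simp
    show "f = g"
    proof
      fix x
      have 1: "f x = g x" if "x \<in> ?supp f"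
      proof -
        from that * have "(f x, x) \<in> (\<lambda>x. (g x, x)) ` ?supp g" by blast
        then show ?thesis by auto
      qed
      have 2: "f x = g x" if "x \<in> ?supp g"
      proof -
        from that * have "(g x, x) \<in> (\<lambda>x. (f x, x)) ` ?supp f" by blast
        then show ?thesis by auto
      qed
      have "x \<notin> X \<Longrightarrow> f x = g x" using f g by (simp add: free_module_carrier)
      with 1 2 show "f x = g x" by (cases "f x = \<zero>\<^bsub>R\<^esub>"; cases "x \<in> X"; fastforce)
    qed
  qed
  then show ?thesis by blast
qed

section \<open>Projectivity and finite generation in terms of dual bases\<close>

lemma projective_moduleD:
  fixes P :: "('a, 'm) module" and A B :: "('a, 'm) aux_module"
  assumes "projective_module R P" "module R A" "module R B" "g \<in> linear_maps R A B"
    "g ` carrier A = carrier B" "f \<in> linear_maps R P B"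
  shows "\<exists>h\<in>linear_maps R P A. \<forall>x\<in>carrier P. g (h x) = f x"
  using assms by (simp add: projective_module_def)

text \<open>A section of the surjection from the free module on \<open>S\<close> has the wanted
  functionals as its coordinates. Since projectivity is tested only on modules of lists, both free
  module and \<open>P\<close> are first recoded, by \<open>J\<close> and \<open>K\<close>.\<close>

lemma projective_imp_dual_basis:
  fixes P :: "('a, 'm) module"
  assumes proj: "projective_module R P" and S: "S \<subseteq> carrier P"
    and span: "\<And>x. x \<in> carrier P \<Longrightarrow> \<exists>T r. finite T \<and> T \<subseteq> S \<and> r \<in> T \<rightarrow> carrier R \<and>
      x = finsum P (\<lambda>s. r s \<odot>\<^bsub>P\<^esub> s) T"
  shows "\<exists>c. dual_basis R P S (\<lambda>x. x) c"
proof -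
  have P: "module R P" using proj by (simp add: projective_module_def)
  interpret P: module R P by fact
  let ?F = "free_module R S"
  have F: "module R ?F" by (rule P.R.module_free_module)
  let ?\<pi> = "\<lambda>f. finsum P (\<lambda>s. f s \<odot>\<^bsub>P\<^esub> s) {s \<in> S. f s \<noteq> \<zero>\<^bsub>R\<^esub>}"
  have \<pi>: "?\<pi> \<in> linear_maps R ?F P"
    using S by (intro dual_basis_combination[OF F P P.R.dual_basis_free_module]) auto
  have \<pi>s: "?\<pi> ` carrier ?F = carrier P"
  proof
    show "?\<pi> ` carrier ?F \<subseteq> carrier P" using linear_map_closed[OF \<pi>] by auto
    show "carrier P \<subseteq> ?\<pi> ` carrier ?F"
    proof
      fix x assume "x \<in> carrier P"
      then obtain T r where T: "finite T" "T \<subseteq> S" "r \<in> T \<rightarrow> carrier R"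
        and x: "x = finsum P (\<lambda>s. r s \<odot>\<^bsub>P\<^esub> s) T" using span by blast
      let ?f = "\<lambda>s. if s \<in> T then r s else \<zero>\<^bsub>R\<^esub>"
      have sup: "{s \<in> S. ?f s \<noteq> \<zero>\<^bsub>R\<^esub>} \<subseteq> T" by auto
      have "finite {s \<in> S. ?f s \<noteq> \<zero>\<^bsub>R\<^esub>}" using finite_subset[OF sup T(1)] .
      then have "?f \<in> carrier ?F" using T by (auto simp: free_module_carrier)
      moreover have "?\<pi> ?f = finsum P (\<lambda>s. ?f s \<odot>\<^bsub>P\<^esub> s) T"
        using S T sup by (intro finsum_smult_superset[OF P]) auto
      moreover have "\<dots> = x" unfolding x using S T by (intro P.M.finsum_cong') auto
      ultimately show "x \<in> ?\<pi> ` carrier ?F" by (intro image_eqI[of _ ?\<pi> ?f]) simp_all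
    qed
  qed
  obtain J :: "('m \<Rightarrow> 'a) \<Rightarrow> ('a \<times> 'm) list" where J: "inj_on J (carrier ?F)"
    using free_module_inj_list[of R S] by blast
  \<comment> \<open>One-letter words with a dummy ring entry embed \<open>P\<close> into the
    prescribed type.\<close>
  define K :: "'m \<Rightarrow> ('a \<times> 'm) list" where "K = (\<lambda>x. [(undefined, x)])"
  have K: "inj_on K (carrier P)" by (auto simp: K_def inj_on_def)
  note tA = transport_module[OF F J] and tB = transport_module[OF P K]
  let ?J' = "inv_into (carrier ?F) J"
  let ?g = "\<lambda>y. K (?\<pi> (?J' y))"
  have g: "?g \<in> linear_maps R (transport_module J ?F) (transport_module K P)"
    using linear_maps_comp[OF linear_maps_comp[OF tA(3) \<pi>] tB(2)] .
  have "?J' ` J ` carrier ?F = carrier ?F" using J by (rule inv_into_image_cancel) simp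
  then have "?g ` carrier (transport_module J ?F) = K ` ?\<pi> ` carrier ?F"
    unfolding carrier_transport_module by (simp only: image_image[symmetric, of "\<lambda>y. K (?\<pi> y)" ?J'] image_image[symmetric, of K ?\<pi>])
  then have gs: "?g ` carrier (transport_module J ?F) = carrier (transport_module K P)"
    unfolding \<pi>s by simp
  obtain h where h: "h \<in> linear_maps R P (transport_module J ?F)"
    and gh: "\<And>x. x \<in> carrier P \<Longrightarrow> ?g (h x) = K x"
    using projective_moduleD[OF proj tA(1) tB(1) g gs tB(2)] by blast
  define \<sigma> where "\<sigma> = (\<lambda>x. ?J' (h x))"
  have \<sigma>: "\<sigma> \<in> linear_maps R P ?F" unfolding \<sigma>_def by (rule linear_maps_comp[OF h tA(3)])
  have \<pi>\<sigma>: "?\<pi> (\<sigma> x) = x" if "x \<in> carrier P" for x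
    using gh[OF that] by (simp add: \<sigma>_def K_def)
  have "dual_basis R P S (\<lambda>x. x) (\<lambda>s x. \<sigma> x s)"
    unfolding dual_basis_def
  proof (intro conjI ballI)
    show "(\<lambda>x. x) \<in> S \<rightarrow> carrier P" using S by auto
    show "(\<lambda>x. \<sigma> x s) \<in> linear_maps R P (regular_module R)" for s
      by (rule linear_maps_comp[OF \<sigma> P.R.linear_maps_free_coordinate])
    fix x assume x: "x \<in> carrier P"
    show "finite {s \<in> S. \<sigma> x s \<noteq> \<zero>\<^bsub>R\<^esub>}"
      using linear_map_closed[OF \<sigma> x] by (auto simp: free_module_carrier)
    show "x = finsum P (\<lambda>s. \<sigma> x s \<odot>\<^bsub>P\<^esub> s) {s \<in> S. \<sigma> x s \<noteq> \<zero>\<^bsub>R\<^esub>}"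
      using \<pi>\<sigma>[OF x] by simp
  qed
  then show ?thesis by blast
qed

lemma projective_dual_basis:
  assumes "projective_module R P"
  shows "\<exists>c. dual_basis R P (carrier P) (\<lambda>x. x) c"
proof (rule projective_imp_dual_basis[OF assms subset_refl])
  have "module R P" using assms by (simp add: projective_module_def)
  then interpret P: module R P .
  show "\<exists>T r. finite T \<and> T \<subseteq> carrier P \<and> r \<in> T \<rightarrow> carrier R \<and> x = finsum P (\<lambda>s. r s \<odot>\<^bsub>P\<^esub> s) T"
    if "x \<in> carrier P" for x
    using that by (intro exI[of _ "{x}"] exI[of _ "\<lambda>_. \<one>\<^bsub>R\<^esub>"]) simp
qed

text \<open>The detour through a dual basis frees \<open>A\<close> and \<open>B\<close> from the
  carrier type prescribed by \<open>projective_module\<close>, and replaces surjectivity of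
  \<open>g\<close> by a condition on the image of \<open>f\<close>.\<close>

lemma projective_lift:
  assumes P: "projective_module R P" and A: "module R A" and B: "module R B"
    and g: "g \<in> linear_maps R A B" and f: "f \<in> linear_maps R P B"
    and im: "\<And>x. x \<in> carrier P \<Longrightarrow> f x \<in> g ` carrier A"
  obtains h where "h \<in> linear_maps R P A" "\<And>x. x \<in> carrier P \<Longrightarrow> g (h x) = f x"
proof -
  have mP: "module R P" using P by (simp add: projective_module_def)
  obtain c where c: "dual_basis R P (carrier P) (\<lambda>x. x) c" using projective_dual_basis[OF P] by blast
  show thesis by (rule dual_basis_lift[OF mP A B c g f]) (use im that in blast)+
qed

lemma projective_retract:
  assumes P: "projective_module R P" and P': "module R P'"
    and i: "i \<in> linear_maps R P' P" and p: "p \<in> linear_maps R P P'"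
    and pi: "\<And>x. x \<in> carrier P' \<Longrightarrow> p (i x) = x"
  shows "projective_module R P'"
proof -
  have mP: "module R P" using P by (simp add: projective_module_def)
  obtain c where c: "dual_basis R P (carrier P) (\<lambda>x. x) c" using projective_dual_basis[OF P] by blast
  show ?thesis
    using dual_basis_projective[OF P' dual_basis_retract[OF mP P' c i p pi]] .
qed

lemma fg_projective_dual_basis:
  assumes "projective_module R P" "fg_module R P"
  obtains S c where "finite S" "dual_basis R P S (\<lambda>x. x) c"
proof -
  obtain S where S: "finite S" "S \<subseteq> carrier P"
    and sp: "\<forall>x\<in>carrier P. \<exists>c\<in>S \<rightarrow> carrier R. x = finsum P (\<lambda>s. c s \<odot>\<^bsub>P\<^esub> s) S"
    using assms(2) unfolding fg_module_def by blast
  have "\<exists>T r. finite T \<and> T \<subseteq> S \<and> r \<in> T \<rightarrow> carrier R \<and> x = finsum P (\<lambda>s. r s \<odot>\<^bsub>P\<^esub> s) T"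
    if "x \<in> carrier P" for x
    using bspec[OF sp that] S(1) by (intro exI[of _ S]) auto
  from projective_imp_dual_basis[OF assms(1) S(2) this]
  show thesis using S(1) that by metis
qed

text \<open>A generating family may repeat elements, whereas \<open>fg_module\<close> speaks of a
  set of generators. Coefficients of equal generators are collected by showing that the span
  \<open>?W\<close> of the image set is closed under sums.\<close>

lemma fg_moduleI:
  assumes M: "module R M" and X: "finite X" and e: "e \<in> X \<rightarrow> carrier M"
    and sp: "\<And>y. y \<in> carrier M \<Longrightarrow> \<exists>c\<in>X \<rightarrow> carrier R. y = finsum M (\<lambda>x. c x \<odot>\<^bsub>M\<^esub> e x) X"
  shows "fg_module R M"
proof -
  interpret M: module R M by fact
  let ?S = "e ` X"
  let ?W = "{y. \<exists>c\<in>?S \<rightarrow> carrier R. y = finsum M (\<lambda>s. c s \<odot>\<^bsub>M\<^esub> s) ?S}"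
  have S: "finite ?S" "?S \<subseteq> carrier M" using X e by auto
  have add: "y \<oplus>\<^bsub>M\<^esub> z \<in> ?W" if "y \<in> ?W" "z \<in> ?W" for y z
  proof -
    obtain c c' where c: "c \<in> ?S \<rightarrow> carrier R" "c' \<in> ?S \<rightarrow> carrier R"
      and yz: "y = finsum M (\<lambda>s. c s \<odot>\<^bsub>M\<^esub> s) ?S" "z = finsum M (\<lambda>s. c' s \<odot>\<^bsub>M\<^esub> s) ?S"
      using \<open>y \<in> ?W\<close> \<open>z \<in> ?W\<close> by blast
    have "finsum M (\<lambda>s. (c s \<oplus>\<^bsub>R\<^esub> c' s) \<odot>\<^bsub>M\<^esub> s) ?S = finsum M (\<lambda>s. c s \<odot>\<^bsub>M\<^esub> s \<oplus>\<^bsub>M\<^esub> c' s \<odot>\<^bsub>M\<^esub> s) ?S"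
      using c S by (intro M.M.finsum_cong') (auto simp: M.smult_l_distr Pi_iff)
    also have "\<dots> = y \<oplus>\<^bsub>M\<^esub> z" unfolding yz using c S by (intro M.M.finsum_addf) (auto simp: Pi_iff)
    finally have "y \<oplus>\<^bsub>M\<^esub> z = finsum M (\<lambda>s. (c s \<oplus>\<^bsub>R\<^esub> c' s) \<odot>\<^bsub>M\<^esub> s) ?S" ..
    moreover have "(\<lambda>s. c s \<oplus>\<^bsub>R\<^esub> c' s) \<in> ?S \<rightarrow> carrier R" using c by auto
    ultimately show ?thesis by (intro CollectI bexI[of _ "\<lambda>s. c s \<oplus>\<^bsub>R\<^esub> c' s"])
  qed
  have zero: "\<zero>\<^bsub>M\<^esub> \<in> ?W"
  proof -
    have "finsum M (\<lambda>s. \<zero>\<^bsub>R\<^esub> \<odot>\<^bsub>M\<^esub> s) ?S = \<zero>\<^bsub>M\<^esub>" using S by (intro M.M.add.finprod_one_eqI) auto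
    then show ?thesis by (intro CollectI bexI[of _ "\<lambda>_. \<zero>\<^bsub>R\<^esub>"]) auto
  qed
  have mem: "r \<odot>\<^bsub>M\<^esub> t \<in> ?W" if "t \<in> ?S" "r \<in> carrier R" for r t
  proof -
    have "finsum M (\<lambda>s. (if t = s then r else \<zero>\<^bsub>R\<^esub>) \<odot>\<^bsub>M\<^esub> s) ?S = finsum M (\<lambda>s. if t = s then r \<odot>\<^bsub>M\<^esub> s else \<zero>\<^bsub>M\<^esub>) ?S"
      using S that by (intro M.M.finsum_cong') auto
    also have "\<dots> = r \<odot>\<^bsub>M\<^esub> t" using S that by (intro M.M.finsum_singleton) auto
    finally show ?thesis using that
      by (intro CollectI bexI[of _ "\<lambda>s. if t = s then r else \<zero>\<^bsub>R\<^esub>"]) auto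
  qed
  have sum: "finsum M (\<lambda>x. c x \<odot>\<^bsub>M\<^esub> e x) Y \<in> ?W" if "finite Y" "Y \<subseteq> X" "c \<in> X \<rightarrow> carrier R" for c Y
    using that
  proof (induct Y)
    case empty then show ?case using zero by simp
  next
    case (insert a Y)
    have "(\<lambda>x. c x \<odot>\<^bsub>M\<^esub> e x) \<in> Y \<rightarrow> carrier M" "c a \<odot>\<^bsub>M\<^esub> e a \<in> carrier M"
      using insert.prems e by (auto simp: Pi_iff subset_iff)
    then have "finsum M (\<lambda>x. c x \<odot>\<^bsub>M\<^esub> e x) (insert a Y) = c a \<odot>\<^bsub>M\<^esub> e a \<oplus>\<^bsub>M\<^esub> finsum M (\<lambda>x. c x \<odot>\<^bsub>M\<^esub> e x) Y"
      using insert by simp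
    moreover have "c a \<odot>\<^bsub>M\<^esub> e a \<in> ?W" using insert by (intro mem) auto
    ultimately show ?case using insert add by auto
  qed
  have "\<forall>y\<in>carrier M. y \<in> ?W"
  proof
    fix y assume "y \<in> carrier M"
    then obtain c where "c \<in> X \<rightarrow> carrier R" "y = finsum M (\<lambda>x. c x \<odot>\<^bsub>M\<^esub> e x) X" using sp by blast
    then show "y \<in> ?W" using sum[of X c] X by auto
  qed
  then show ?thesis unfolding fg_module_def using S by blast
qed

lemma finite_dual_basis_fg:
  assumes "module R P" "dual_basis R P S e c" "finite S"
  shows "fg_module R P"
proof (rule fg_moduleI[OF assms(1,3)])
  show "e \<in> S \<rightarrow> carrier P" using assms(2) by (simp add: dual_basis_def)
  fix y assume y: "y \<in> carrier P"
  have "(\<lambda>s. c s y) \<in> S \<rightarrow> carrier R" using dual_basisD(3)[OF assms(2) _ y] by auto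
  then show "\<exists>c\<in>S \<rightarrow> carrier R. y = finsum P (\<lambda>x. c x \<odot>\<^bsub>P\<^esub> e x) S"
    using finite_dual_basis[OF assms y] by (intro bexI[of _ "\<lambda>s. c s y"])
qed

lemma fg_module_surj:
  assumes M: "module R M" and N: "module R N" and fg: "fg_module R M"
    and g: "g \<in> linear_maps R M N" and s: "g ` carrier M = carrier N"
  shows "fg_module R N"
proof -
  interpret M: module R M by fact
  interpret N: module R N by fact
  obtain S where S: "finite S" "S \<subseteq> carrier M"
    and sp: "\<forall>x\<in>carrier M. \<exists>c\<in>S \<rightarrow> carrier R. x = finsum M (\<lambda>s. c s \<odot>\<^bsub>M\<^esub> s) S"
    using fg unfolding fg_module_def by blast
  show ?thesis
  proof (rule fg_moduleI[OF N S(1), of g])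
    show "g \<in> S \<rightarrow> carrier N" using S linear_map_closed[OF g] by auto
    fix y assume "y \<in> carrier N"
    then obtain x where x: "x \<in> carrier M" "y = g x" using s by blast
    then obtain c where c: "c \<in> S \<rightarrow> carrier R" "x = finsum M (\<lambda>s. c s \<odot>\<^bsub>M\<^esub> s) S" using sp by blast
    have "g x = finsum N (\<lambda>t. g (c t \<odot>\<^bsub>M\<^esub> t)) S"
      unfolding c(2) using c(1) S by (intro linear_map_finsum[OF M N g]) (auto simp: Pi_iff)
    also have "\<dots> = finsum N (\<lambda>t. c t \<odot>\<^bsub>N\<^esub> g t) S"
      using c(1) S linear_map_closed[OF g] by (intro N.M.finsum_cong') (auto simp: linear_map_smult[OF g] Pi_iff subset_iff)
    finally show "\<exists>c\<in>S \<rightarrow> carrier R. y = finsum N (\<lambda>x. c x \<odot>\<^bsub>N\<^esub> g x) S" using c(1) x by blast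
  qed
qed

text \<open>An element is encoded by the coefficients of a chosen expression in the generators. This
  places finitely generated modules in the type \<open>'a list\<close> over which \<open>fPD\<close>
  ranges.\<close>

lemma fg_module_inj_list:
  fixes M :: "('a, 'm) module"
  assumes M: "module R M" and fg: "fg_module R M"
  shows "\<exists>J :: 'm \<Rightarrow> 'a list. inj_on J (carrier M)"
proof -
  interpret M: module R M by fact
  obtain S where S: "finite S" "S \<subseteq> carrier M"
    and sp: "\<forall>x\<in>carrier M. \<exists>c\<in>S \<rightarrow> carrier R. x = finsum M (\<lambda>s. c s \<odot>\<^bsub>M\<^esub> s) S"
    using fg unfolding fg_module_def by blast
  define c where "c x = (SOME c. c \<in> S \<rightarrow> carrier R \<and> x = finsum M (\<lambda>s. c s \<odot>\<^bsub>M\<^esub> s) S)" for x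
  have c: "c x \<in> S \<rightarrow> carrier R \<and> x = finsum M (\<lambda>s. c x s \<odot>\<^bsub>M\<^esub> s) S" if "x \<in> carrier M" for x
  proof -
    have "\<exists>c. c \<in> S \<rightarrow> carrier R \<and> x = finsum M (\<lambda>s. c s \<odot>\<^bsub>M\<^esub> s) S" using bspec[OF sp that] by blast
    then show ?thesis unfolding c_def by (rule someI_ex)
  qed
  obtain l where l: "set l = S" using S finite_list by blast
  have "inj_on (\<lambda>x. map (c x) l) (carrier M)"
  proof (rule inj_onI)
    fix x y assume xy: "x \<in> carrier M" "y \<in> carrier M" "map (c x) l = map (c y) l"
    then have eq: "c x s = c y s" if "s \<in> S" for s using l that by auto
    have "finsum M (\<lambda>s. c x s \<odot>\<^bsub>M\<^esub> s) S = finsum M (\<lambda>s. c y s \<odot>\<^bsub>M\<^esub> s) S"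
      using eq S(2) c[OF xy(2)] by (intro M.M.finsum_cong') (auto simp: Pi_iff subset_iff)
    then show "x = y" using c[OF xy(1)] c[OF xy(2)] by simp
  qed
  then show ?thesis by blast
qed

text \<open>The scalar multiple of a coset is defined as a union over all representatives; the main
  point is that all cosets in this union coincide (\<open>smq\<close>).\<close>

lemma quotient_module:
  assumes M: "module R M" and N: "submodule N R M"
  shows "module R (quotient_module M N)"
    and "(\<lambda>x. N +>\<^bsub>M\<^esub> x) \<in> linear_maps R M (quotient_module M N)"
    and "(\<lambda>x. N +>\<^bsub>M\<^esub> x) ` carrier M = carrier (quotient_module M N)"
    and "\<And>x. x \<in> carrier M \<Longrightarrow> N +>\<^bsub>M\<^esub> x = \<zero>\<^bsub>quotient_module M N\<^esub> \<longleftrightarrow> x \<in> N"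
proof -
  interpret M: module R M by fact
  let ?Q = "quotient_module M N"
  have NM: "N \<subseteq> carrier M" using M.submoduleE(1)[OF N] .
  have sm: "\<And>a b. a \<in> carrier R \<Longrightarrow> b \<in> N \<Longrightarrow> a \<odot>\<^bsub>M\<^esub> b \<in> N" using M.submoduleE(4)[OF N] .
  interpret N: abelian_subgroup N M
    using N by (intro abelian_subgroupI3 additive_subgroupI M.M.abelian_group_axioms) (auto simp: submodule_def)
  have carr: "carrier ?Q = (\<lambda>x. N +>\<^bsub>M\<^esub> x) ` carrier M"
    by (auto simp: quotient_module_def A_RCOSETS_def')
  have z: "\<zero>\<^bsub>?Q\<^esub> = N" by (simp add: quotient_module_def)
  have z0: "N = N +>\<^bsub>M\<^esub> \<zero>\<^bsub>M\<^esub>" using NM M.M.a_coset_add_zero by simp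
  have ad: "(N +>\<^bsub>M\<^esub> x) \<oplus>\<^bsub>?Q\<^esub> (N +>\<^bsub>M\<^esub> y) = N +>\<^bsub>M\<^esub> (x \<oplus>\<^bsub>M\<^esub> y)" if "x \<in> carrier M" "y \<in> carrier M" for x y
    using that N.a_rcos_sum by (simp add: quotient_module_def)
  have eqN: "N +>\<^bsub>M\<^esub> y = N +>\<^bsub>M\<^esub> x" if "x \<in> carrier M" "y \<in> N +>\<^bsub>M\<^esub> x" for x y
    using that by (metis M.M.a_repr_independence N.a_subgroup)
  have smq: "a \<odot>\<^bsub>?Q\<^esub> (N +>\<^bsub>M\<^esub> x) = N +>\<^bsub>M\<^esub> (a \<odot>\<^bsub>M\<^esub> x)" if a: "a \<in> carrier R" and x: "x \<in> carrier M" for a x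
  proof -
    have "N +>\<^bsub>M\<^esub> (a \<odot>\<^bsub>M\<^esub> y) = N +>\<^bsub>M\<^esub> (a \<odot>\<^bsub>M\<^esub> x)" if "y \<in> N +>\<^bsub>M\<^esub> x" for y
    proof (rule eqN)
      obtain n where n: "n \<in> N" "y = n \<oplus>\<^bsub>M\<^esub> x" using \<open>y \<in> N +>\<^bsub>M\<^esub> x\<close> by (auto simp: a_r_coset_def')
      then have "a \<odot>\<^bsub>M\<^esub> y = a \<odot>\<^bsub>M\<^esub> n \<oplus>\<^bsub>M\<^esub> a \<odot>\<^bsub>M\<^esub> x" using a x NM by (auto simp: M.smult_r_distr)
      then show "a \<odot>\<^bsub>M\<^esub> y \<in> N +>\<^bsub>M\<^esub> a \<odot>\<^bsub>M\<^esub> x" using sm[OF a n(1)] by (auto simp: a_r_coset_def')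
    qed (use a x in auto)
    then have "(\<Union>y\<in>N +>\<^bsub>M\<^esub> x. N +>\<^bsub>M\<^esub> (a \<odot>\<^bsub>M\<^esub> y)) = (\<Union>y\<in>N +>\<^bsub>M\<^esub> x. N +>\<^bsub>M\<^esub> (a \<odot>\<^bsub>M\<^esub> x))" by simp
    also have "\<dots> = N +>\<^bsub>M\<^esub> (a \<odot>\<^bsub>M\<^esub> x)" using x N.a_rcos_self by fastforce
    finally show ?thesis by (simp add: quotient_module_def)
  qed
  show "module R ?Q"
  proof (rule moduleI)
    show "abelian_group ?Q"
    proof (rule abelian_groupI)
      show "\<zero>\<^bsub>?Q\<^esub> \<in> carrier ?Q" using z0 M.M.zero_closed unfolding z carr by blast
      show "\<exists>y\<in>carrier ?Q. y \<oplus>\<^bsub>?Q\<^esub> X = \<zero>\<^bsub>?Q\<^esub>" if X: "X \<in> carrier ?Q" for X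
      proof -
        obtain x where x: "x \<in> carrier M" "X = N +>\<^bsub>M\<^esub> x" using X carr by auto
        then have "(N +>\<^bsub>M\<^esub> (\<ominus>\<^bsub>M\<^esub> x)) \<oplus>\<^bsub>?Q\<^esub> X = \<zero>\<^bsub>?Q\<^esub>" using z z0 by (simp add: ad M.M.l_neg)
        then show ?thesis using x by (intro bexI[of _ "N +>\<^bsub>M\<^esub> (\<ominus>\<^bsub>M\<^esub> x)"]) (auto simp: carr)
      qed
      show "\<zero>\<^bsub>?Q\<^esub> \<oplus>\<^bsub>?Q\<^esub> X = X" if X: "X \<in> carrier ?Q" for X
      proof -
        obtain x where x: "x \<in> carrier M" "X = N +>\<^bsub>M\<^esub> x" using X carr by auto
        show ?thesis using ad[of "\<zero>\<^bsub>M\<^esub>" x] x z z0 by simp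
      qed
    qed (auto simp: carr ad M.M.a_ac)
  qed (auto simp: carr ad smq M.R.is_cring M.smult_l_distr M.smult_r_distr M.smult_assoc1)
  show "(\<lambda>x. N +>\<^bsub>M\<^esub> x) \<in> linear_maps R M ?Q"
    by (rule linear_mapsI) (auto simp: carr ad smq)
  show "(\<lambda>x. N +>\<^bsub>M\<^esub> x) ` carrier M = carrier ?Q" using carr ..
  show "N +>\<^bsub>M\<^esub> x = \<zero>\<^bsub>?Q\<^esub> \<longleftrightarrow> x \<in> N" if x: "x \<in> carrier M" for x
    unfolding z using eqN[of "\<zero>\<^bsub>M\<^esub>" x] z0 N.a_rcos_self[OF x] x by auto
qed


section \<open>Cohomology with respect to a projective resolution\<close>

text \<open>
  The complex \<open>Hom(P, N)\<close> without the extensionality of \<^const>\<open>Hom_module\<close>: maps only matter on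
  carriers.
\<close>

definition is_cocycle ::
  "('a, 'b) ring_scheme \<Rightarrow> (nat \<Rightarrow> ('a, 'u) module) \<Rightarrow> (nat \<Rightarrow> 'u \<Rightarrow> 'u) \<Rightarrow> ('a, 'n) module
    \<Rightarrow> nat \<Rightarrow> ('u \<Rightarrow> 'n) \<Rightarrow> bool"
  where "is_cocycle R P \<delta> N i f \<longleftrightarrow>
    f \<in> linear_maps R (P i) N \<and> (\<forall>x\<in>carrier (P (Suc i)). f (\<delta> i x) = \<zero>\<^bsub>N\<^esub>)"

primrec is_coboundary ::
  "('a, 'b) ring_scheme \<Rightarrow> (nat \<Rightarrow> ('a, 'u) module) \<Rightarrow> (nat \<Rightarrow> 'u \<Rightarrow> 'u) \<Rightarrow> ('a, 'n) module
    \<Rightarrow> nat \<Rightarrow> ('u \<Rightarrow> 'n) \<Rightarrow> bool"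
  where
    "is_coboundary R P \<delta> N 0 f \<longleftrightarrow> (\<forall>x\<in>carrier (P 0). f x = \<zero>\<^bsub>N\<^esub>)"
  | "is_coboundary R P \<delta> N (Suc i) f \<longleftrightarrow>
      (\<exists>g\<in>linear_maps R (P i) N. \<forall>x\<in>carrier (P (Suc i)). f x = g (\<delta> i x))"

definition cohomology_vanishes ::
  "('a, 'b) ring_scheme \<Rightarrow> (nat \<Rightarrow> ('a, 'u) module) \<Rightarrow> (nat \<Rightarrow> 'u \<Rightarrow> 'u) \<Rightarrow> ('a, 'n) module
    \<Rightarrow> nat \<Rightarrow> bool"
  where "cohomology_vanishes R P \<delta> N i \<longleftrightarrow>
    (\<forall>f. is_cocycle R P \<delta> N i f \<longrightarrow> is_coboundary R P \<delta> N i f)"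

lemma is_coboundary_cong:
  "(\<And>x. x \<in> carrier (P i) \<Longrightarrow> f x = g x) \<Longrightarrow> is_coboundary R P \<delta> N i f \<longleftrightarrow> is_coboundary R P \<delta> N i g"
  by (cases i) auto

lemma is_cocycleD:
  assumes "is_cocycle R P \<delta> N i f"
  shows "f \<in> linear_maps R (P i) N" "x \<in> carrier (P (Suc i)) \<Longrightarrow> f (\<delta> i x) = \<zero>\<^bsub>N\<^esub>"
  using assms by (auto simp: is_cocycle_def)

locale proj_resolution =
  fixes R :: "('a, 'b) ring_scheme" (structure)
    and P :: "nat \<Rightarrow> ('a, 'u) module" and \<delta> :: "nat \<Rightarrow> 'u \<Rightarrow> 'u" and \<epsilon> :: "'u \<Rightarrow> 'm"
    and M :: "('a, 'm) module"
  assumes module_M: "module R M" and resolution: "projective_resolution R P \<delta> \<epsilon> M"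
begin

lemma projective: "projective_module R (P i)"
  using resolution by (simp add: projective_resolution_def)

lemma module_P: "module R (P i)"
  using projective by (simp add: projective_module_def)

lemma d_linear: "\<delta> i \<in> linear_maps R (P (Suc i)) (P i)"
  using resolution by (simp add: projective_resolution_def)

lemma augmentation_linear: "\<epsilon> \<in> linear_maps R (P 0) M"
  using resolution by (simp add: projective_resolution_def)

lemma augmentation_surj: "\<epsilon> ` carrier (P 0) = carrier M"
  using resolution by (simp add: projective_resolution_def)

lemma d_image_0: "\<delta> 0 ` carrier (P (Suc 0)) = {x \<in> carrier (P 0). \<epsilon> x = \<zero>\<^bsub>M\<^esub>}"
  using resolution by (simp add: projective_resolution_def a_kernel_def')

lemma d_image_Suc: "\<delta> (Suc i) ` carrier (P (Suc (Suc i))) = {x \<in> carrier (P (Suc i)). \<delta> i x = \<zero>\<^bsub>P i\<^esub>}"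
  using resolution by (simp add: projective_resolution_def a_kernel_def')

lemma d_closed [simp]: "x \<in> carrier (P (Suc i)) \<Longrightarrow> \<delta> i x \<in> carrier (P i)"
  using linear_map_closed[OF d_linear] .

lemma d_d: "x \<in> carrier (P (Suc (Suc i))) \<Longrightarrow> \<delta> i (\<delta> (Suc i) x) = \<zero>\<^bsub>P i\<^esub>"
  using d_image_Suc[of i] by blast

lemma augmentation_d: "x \<in> carrier (P (Suc 0)) \<Longrightarrow> \<epsilon> (\<delta> 0 x) = \<zero>\<^bsub>M\<^esub>"
  using d_image_0 by blast

section \<open>Coboundaries under sums and coefficient maps, and the link to the quotient
  modules\<close>

lemma is_coboundary_add:
  assumes N: "module R N" and f: "is_coboundary R P \<delta> N i f" and g: "is_coboundary R P \<delta> N i g"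
  shows "is_coboundary R P \<delta> N i (\<lambda>x. f x \<oplus>\<^bsub>N\<^esub> g x)"
proof -
  interpret N: module R N by fact
  show ?thesis
  proof (cases i)
    case 0 then show ?thesis using f g by auto
  next
    case (Suc j)
    then obtain f' g' where "f' \<in> linear_maps R (P j) N" "g' \<in> linear_maps R (P j) N"
      "\<forall>x\<in>carrier (P (Suc j)). f x = f' (\<delta> j x)" "\<forall>x\<in>carrier (P (Suc j)). g x = g' (\<delta> j x)"
      using f g by auto
    then show ?thesis using Suc linear_maps_add[OF N, of f' "P j" g']
      by (auto intro!: bexI[of _ "\<lambda>x. f' x \<oplus>\<^bsub>N\<^esub> g' x"])
  qed
qed

lemma is_coboundary_uminus:
  assumes N: "module R N" and f: "is_coboundary R P \<delta> N i f"
  shows "is_coboundary R P \<delta> N i (\<lambda>x. \<ominus>\<^bsub>N\<^esub> f x)"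
proof -
  interpret N: module R N by fact
  show ?thesis
  proof (cases i)
    case 0 then show ?thesis using f by auto
  next
    case (Suc j)
    then obtain f' where "f' \<in> linear_maps R (P j) N" "\<forall>x\<in>carrier (P (Suc j)). f x = f' (\<delta> j x)"
      using f by auto
    then show ?thesis using Suc linear_maps_uminus[OF N, of f' "P j"]
      by (auto intro!: bexI[of _ "\<lambda>x. \<ominus>\<^bsub>N\<^esub> f' x"])
  qed
qed

lemma is_coboundary_map:
  assumes "h \<in> linear_maps R N L" "module R N" "module R L" "is_coboundary R P \<delta> N i f"
  shows "is_coboundary R P \<delta> L i (\<lambda>x. h (f x))"
proof (cases i)
  case 0 then show ?thesis using assms(4) linear_map_zero[OF assms(2,3,1)] by auto
next
  case (Suc j)
  then obtain f' where "f' \<in> linear_maps R (P j) N" "\<forall>x\<in>carrier (P (Suc j)). f x = f' (\<delta> j x)"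
    using assms(4) by auto
  then show ?thesis using Suc linear_maps_comp[of f' R "P j" N h L] assms(1)
    by (auto intro!: bexI[of _ "\<lambda>x. h (f' x)"])
qed

lemma is_cocycle_map:
  assumes "h \<in> linear_maps R N L" "module R N" "module R L" "is_cocycle R P \<delta> N i f"
  shows "is_cocycle R P \<delta> L i (\<lambda>x. h (f x))"
  using assms linear_maps_comp[of f R "P i" N h L] linear_map_zero[OF assms(2,3,1)]
  by (auto simp: is_cocycle_def)

text \<open>Restriction to the carrier turns arbitrary linear maps into extensional ones without
  affecting being a cocycle or a coboundary. The quotient is trivial exactly if every coset of a
  cocycle is the set of coboundaries.\<close>

lemma trivial_Hom_cohomology_iff:
  fixes N :: "('a, 'n) module"
  assumes N: "module R N"
  shows "trivial_module (Hom_cohomology R P \<delta> N i) \<longleftrightarrow> cohomology_vanishes R P \<delta> N i"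
proof -
  interpret N: module R N by fact
  interpret Pi: module R "P i" by (rule module_P)
  let ?H = "Hom_module R (P i) N"
  let ?Z = "Hom_cocycles R P \<delta> N i" and ?B = "Hom_coboundaries R P \<delta> N i"
  have restr: "restrict f (carrier (P j)) \<in> carrier (Hom_module R (P j) N)"
    if "f \<in> linear_maps R (P j) N" for f j
    using that linear_maps_cong[OF module_P that] by (auto simp: Hom_module_def)
  have HD: "f \<in> linear_maps R (P j) N \<and> f \<in> extensional (carrier (P j))"
    if "f \<in> carrier (Hom_module R (P j) N)" for f j using that by (auto simp: Hom_module_def)
  have addH: "f \<oplus>\<^bsub>?H\<^esub> g = (\<lambda>x\<in>carrier (P i). f x \<oplus>\<^bsub>N\<^esub> g x)" for f g by (simp add: Hom_module_def)
  have Z: "f \<in> ?Z \<longleftrightarrow> f \<in> carrier ?H \<and> is_cocycle R P \<delta> N i f" for f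
  proof -
    have "(\<lambda>x\<in>carrier (P (Suc i)). f (\<delta> i x)) = (\<lambda>x\<in>carrier (P (Suc i)). \<zero>\<^bsub>N\<^esub>) \<longleftrightarrow>
        (\<forall>x\<in>carrier (P (Suc i)). f (\<delta> i x) = \<zero>\<^bsub>N\<^esub>)"
      unfolding fun_eq_iff by (auto simp: restrict_def)
    then show ?thesis
      by (auto simp: Hom_cocycles_def a_kernel_def' Hom_differential_def is_cocycle_def Hom_module_def)
  qed
  have B: "f \<in> ?B \<longleftrightarrow> f \<in> carrier ?H \<and> is_coboundary R P \<delta> N i f" for f
  proof (cases i)
    case 0
    have "f = (\<lambda>x\<in>carrier (P 0). \<zero>\<^bsub>N\<^esub>) \<longleftrightarrow>
        f \<in> carrier (Hom_module R (P 0) N) \<and> (\<forall>x\<in>carrier (P 0). f x = \<zero>\<^bsub>N\<^esub>)"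
    proof safe
      show "(\<lambda>x\<in>carrier (P 0). \<zero>\<^bsub>N\<^esub>) \<in> carrier (Hom_module R (P 0) N)"
        by (rule restr[OF linear_maps_const_zero[OF N]])
      assume f: "f \<in> carrier (Hom_module R (P 0) N)" and z: "\<forall>x\<in>carrier (P 0). f x = \<zero>\<^bsub>N\<^esub>"
      show "f = (\<lambda>x\<in>carrier (P 0). \<zero>\<^bsub>N\<^esub>)"
        using HD[OF f] z by (intro extensionalityI[of _ "carrier (P 0)"]) auto
    qed auto
    then show ?thesis using 0 by (simp add: Hom_module_def)
  next
    case (Suc j)
    show ?thesis
    proof
      assume "f \<in> ?B"
      then obtain g where g: "g \<in> carrier (Hom_module R (P j) N)"
        and f: "f = (\<lambda>x\<in>carrier (P i). g (\<delta> j x))" using Suc by (auto simp: Hom_differential_def)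
      have "(\<lambda>x. g (\<delta> j x)) \<in> linear_maps R (P i) N"
        using linear_maps_comp[OF d_linear] HD[OF g] Suc by blast
      then have "f \<in> carrier ?H" unfolding f by (rule restr)
      moreover have "is_coboundary R P \<delta> N i f" using HD[OF g] Suc by (auto simp: f)
      ultimately show "f \<in> carrier ?H \<and> is_coboundary R P \<delta> N i f" by blast
    next
      assume f: "f \<in> carrier ?H \<and> is_coboundary R P \<delta> N i f"
      then obtain g where g: "g \<in> linear_maps R (P j) N" "\<forall>x\<in>carrier (P i). f x = g (\<delta> j x)"
        using Suc by auto
      have "f = Hom_differential P \<delta> j (restrict g (carrier (P j)))"
        using HD[of f i] f g(2) Suc
        by (intro extensionalityI[of _ "carrier (P i)"]) (auto simp: Hom_differential_def)
      then show "f \<in> ?B" using restr[OF g(1)] unfolding Suc Hom_coboundaries.simps by blast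
    qed
  qed
  let ?z = "\<lambda>x\<in>carrier (P i). \<zero>\<^bsub>N\<^esub>"
  have zH: "?z \<in> carrier ?H" by (rule restr[OF linear_maps_const_zero[OF N]])
  have zc: "is_coboundary R P \<delta> N i ?z"
  proof -
    have "is_coboundary R P \<delta> N i (\<lambda>x. \<zero>\<^bsub>N\<^esub>)"
      using linear_maps_const_zero[OF N] by (cases i) (auto intro: bexI[of _ "\<lambda>_. \<zero>\<^bsub>N\<^esub>"])
    then show ?thesis by (subst is_coboundary_cong[of P i _ "\<lambda>x. \<zero>\<^bsub>N\<^esub>"]) auto
  qed
  have zB: "?z \<in> ?B" using B zH zc by blast
  \<comment> \<open>The carrier of a trivial quotient is exactly one coset, so the set of cocycles
    has to be nonempty.\<close>
  have zZ: "?z \<in> ?Z" using zH HD[OF zH] linear_map_closed[OF d_linear] by (auto simp: Z is_cocycle_def)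
  have cos: "?B +>\<^bsub>?H\<lparr>carrier := ?Z\<rparr>\<^esub> f = {\<lambda>x\<in>carrier (P i). b x \<oplus>\<^bsub>N\<^esub> f x | b. b \<in> ?B}" for f
    by (auto simp: a_r_coset_def' addH)
  have triv: "trivial_module (Hom_cohomology R P \<delta> N i) \<longleftrightarrow>
      (\<Union>f\<in>?Z. {?B +>\<^bsub>?H\<lparr>carrier := ?Z\<rparr>\<^esub> f}) = {?B}"
    by (simp add: trivial_module_def Hom_cohomology_def quotient_module_def A_RCOSETS_def')
  show ?thesis
  proof
    assume t: "trivial_module (Hom_cohomology R P \<delta> N i)"
    show "cohomology_vanishes R P \<delta> N i" unfolding cohomology_vanishes_def
    proof (intro allI impI)
      fix f assume f: "is_cocycle R P \<delta> N i f"
      let ?f = "restrict f (carrier (P i))"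
      have fH: "?f \<in> carrier ?H" using restr is_cocycleD(1)[OF f] by blast
      have "is_cocycle R P \<delta> N i ?f"
        using f HD[OF fH] linear_map_closed[OF d_linear[of i]] by (auto simp: is_cocycle_def)
      then have "?f \<in> ?Z" using Z fH by blast
      then have "?B +>\<^bsub>?H\<lparr>carrier := ?Z\<rparr>\<^esub> ?f = ?B" using t unfolding triv by blast
      moreover have "(\<lambda>x\<in>carrier (P i). ?z x \<oplus>\<^bsub>N\<^esub> ?f x) \<in> ?B +>\<^bsub>?H\<lparr>carrier := ?Z\<rparr>\<^esub> ?f"
        unfolding cos using zB by blast
      ultimately have "(\<lambda>x\<in>carrier (P i). ?z x \<oplus>\<^bsub>N\<^esub> ?f x) \<in> ?B" by simp
      then have "is_coboundary R P \<delta> N i (\<lambda>x\<in>carrier (P i). ?z x \<oplus>\<^bsub>N\<^esub> ?f x)" using B by blast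
      then show "is_coboundary R P \<delta> N i f"
        by (subst is_coboundary_cong[of P i f "\<lambda>x\<in>carrier (P i). ?z x \<oplus>\<^bsub>N\<^esub> ?f x"])
          (use linear_map_closed[OF is_cocycleD(1)[OF f]] in auto)
    qed
  next
    assume v: "cohomology_vanishes R P \<delta> N i"
    have "?B +>\<^bsub>?H\<lparr>carrier := ?Z\<rparr>\<^esub> f = ?B" if "f \<in> ?Z" for f
    proof -
      have f: "f \<in> carrier ?H" "is_coboundary R P \<delta> N i f"
        using that v unfolding Z cohomology_vanishes_def by blast+
      note fl = conjunct1[OF HD[OF f(1)]]
      show ?thesis
      proof
        show "?B +>\<^bsub>?H\<lparr>carrier := ?Z\<rparr>\<^esub> f \<subseteq> ?B"
        proof
          fix g assume "g \<in> ?B +>\<^bsub>?H\<lparr>carrier := ?Z\<rparr>\<^esub> f"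
          then obtain b where b: "b \<in> ?B" "g = (\<lambda>x\<in>carrier (P i). b x \<oplus>\<^bsub>N\<^esub> f x)" unfolding cos by blast
          then have bl: "b \<in> linear_maps R (P i) N" "is_coboundary R P \<delta> N i b" using B HD by blast+
          have "g \<in> carrier ?H" unfolding b(2) by (rule restr[OF linear_maps_add[OF N bl(1) fl]])
          moreover have "is_coboundary R P \<delta> N i g"
            unfolding b(2) using is_coboundary_add[OF N bl(2) f(2)] 
            by (subst is_coboundary_cong[of P i _ "\<lambda>x. b x \<oplus>\<^bsub>N\<^esub> f x"]) auto
          ultimately show "g \<in> ?B" using B by blast
        qed
        show "?B \<subseteq> ?B +>\<^bsub>?H\<lparr>carrier := ?Z\<rparr>\<^esub> f"
        proof
          fix g assume g: "g \<in> ?B"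
          then have gl: "g \<in> linear_maps R (P i) N" "is_coboundary R P \<delta> N i g" "g \<in> extensional (carrier (P i))"
            using B HD by blast+
          let ?b = "\<lambda>x\<in>carrier (P i). g x \<oplus>\<^bsub>N\<^esub> \<ominus>\<^bsub>N\<^esub> f x"
          have "?b \<in> carrier ?H"
            by (rule restr[OF linear_maps_add[OF N gl(1) linear_maps_uminus[OF N fl]]])
          moreover have "is_coboundary R P \<delta> N i ?b"
            using is_coboundary_add[OF N gl(2) is_coboundary_uminus[OF N f(2)]]
            by (subst is_coboundary_cong[of P i _ "\<lambda>x. g x \<oplus>\<^bsub>N\<^esub> \<ominus>\<^bsub>N\<^esub> f x"]) auto
          ultimately have "?b \<in> ?B" using B by blast
          moreover have "g = (\<lambda>x\<in>carrier (P i). ?b x \<oplus>\<^bsub>N\<^esub> f x)"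
            using gl(3) linear_map_closed[OF gl(1)] linear_map_closed[OF fl]
            by (intro extensionalityI[of _ "carrier (P i)"]) (auto simp: N.M.a_assoc N.M.l_neg)
          ultimately show "g \<in> ?B +>\<^bsub>?H\<lparr>carrier := ?Z\<rparr>\<^esub> f" unfolding cos by blast
        qed
      qed
    qed
    then show "trivial_module (Hom_cohomology R P \<delta> N i)" unfolding triv using zZ by blast
  qed
qed

text \<open>Each coordinate of a cocycle is a cocycle with values in \<open>R\<close>, hence a
  coboundary. The primitives are reassembled with the \<open>e s\<close>; finiteness of
  \<open>S\<close> makes their sum a linear map.\<close>

lemma cohomology_vanishes_finite_dual_basis:
  assumes v: "cohomology_vanishes R P \<delta> (regular_module R) i"
    and Q: "module R Q" and d: "dual_basis R Q S e c" and S: "finite S"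
  shows "cohomology_vanishes R P \<delta> Q i"
  unfolding cohomology_vanishes_def
proof (intro allI impI)
  fix f assume f: "is_cocycle R P \<delta> Q i f"
  interpret Q: module R Q by fact
  note fl = is_cocycleD(1)[OF f]
  have cf: "is_coboundary R P \<delta> (regular_module R) i (\<lambda>x. c s (f x))" if "s \<in> S" for s
    using v is_cocycle_map[OF dual_basisD(2)[OF d that] Q Q.R.module_regular f]
    unfolding cohomology_vanishes_def by blast
  show "is_coboundary R P \<delta> Q i f"
  proof (cases i)
    case 0
    have "f x = \<zero>\<^bsub>Q\<^esub>" if "x \<in> carrier (P 0)" for x
    proof -
      have fx: "f x \<in> carrier Q" using linear_map_closed[OF fl] that 0 by simp
      have "c s (f x) = \<zero>" if "s \<in> S" for s using cf[OF that] 0 \<open>x \<in> carrier (P 0)\<close> by simp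
      then have "finsum Q (\<lambda>s. c s (f x) \<odot>\<^bsub>Q\<^esub> e s) S = \<zero>\<^bsub>Q\<^esub>"
        using dual_basisD(1)[OF d] by (intro Q.M.add.finprod_one_eqI) simp
      then show ?thesis using finite_dual_basis[OF Q d S fx] by simp
    qed
    then show ?thesis using 0 by simp
  next
    case (Suc j)
    have "\<forall>s\<in>S. \<exists>g. g \<in> linear_maps R (P j) (regular_module R) \<and> (\<forall>x\<in>carrier (P (Suc j)). c s (f x) = g (\<delta> j x))"
      using cf Suc by (auto simp: Bex_def)
    then obtain g where g: "\<And>s. s \<in> S \<Longrightarrow> g s \<in> linear_maps R (P j) (regular_module R)"
      "\<And>s x. s \<in> S \<Longrightarrow> x \<in> carrier (P (Suc j)) \<Longrightarrow> c s (f x) = g s (\<delta> j x)" by metis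
    let ?g = "\<lambda>y. finsum Q (\<lambda>s. g s y \<odot>\<^bsub>Q\<^esub> e s) S"
    have "?g \<in> linear_maps R (P j) Q"
      using g(1) dual_basisD(1)[OF d] by (intro linear_maps_finsum[OF module_P Q S] linear_maps_smult_const[OF Q])
    moreover have "f x = ?g (\<delta> j x)" if "x \<in> carrier (P (Suc j))" for x
    proof -
      have fx: "f x \<in> carrier Q" using linear_map_closed[OF fl] that Suc by simp
      have "finsum Q (\<lambda>s. c s (f x) \<odot>\<^bsub>Q\<^esub> e s) S = ?g (\<delta> j x)"
        using g that dual_basisD(1)[OF d] linear_map_closed[OF g(1)] by (intro Q.M.finsum_cong') auto
      then show ?thesis using finite_dual_basis[OF Q d S fx] by simp
    qed
    ultimately show ?thesis using Suc by auto
  qed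
qed

section \<open>Dimension shifting along short exact sequences\<close>

text \<open>The segment \<open>H^i(B) \<rightarrow> H^i(C) \<rightarrow> H^(i+1)(A)\<close> of the
  long exact sequence. A lift \<open>f'\<close> of \<open>f\<close> to \<open>B\<close> has its
  differential in \<open>A\<close>, where this is a cocycle and thus the differential of some
  \<open>b\<close>.\<close>

lemma cohomology_vanishes_quotient:
  assumes mods: "module R A" "module R B" "module R C"
    and \<alpha>: "\<alpha> \<in> linear_maps R A B" "inj_on \<alpha> (carrier A)"
    and \<beta>: "\<beta> \<in> linear_maps R B C" "\<beta> ` carrier B = carrier C"
    and ex: "\<alpha> ` carrier A = {y \<in> carrier B. \<beta> y = \<zero>\<^bsub>C\<^esub>}"
    and vB: "cohomology_vanishes R P \<delta> B i" and vA: "cohomology_vanishes R P \<delta> A (Suc i)"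
  shows "cohomology_vanishes R P \<delta> C i"
  unfolding cohomology_vanishes_def
proof (intro allI impI)
  fix f assume f: "is_cocycle R P \<delta> C i f"
  interpret B: module R B by fact
  interpret C: module R C by fact
  note fl = is_cocycleD(1)[OF f]
  obtain f' where f': "f' \<in> linear_maps R (P i) B" "\<And>x. x \<in> carrier (P i) \<Longrightarrow> \<beta> (f' x) = f x"
    by (rule projective_lift[OF projective mods(2,3) \<beta>(1) fl]) (use linear_map_closed[OF fl] \<beta>(2) in auto)
  have fd: "(\<lambda>x. f' (\<delta> i x)) \<in> linear_maps R (P (Suc i)) B" by (rule linear_maps_comp[OF d_linear f'(1)])
  have "f' (\<delta> i x) \<in> \<alpha> ` carrier A" if "x \<in> carrier (P (Suc i))" for x
    unfolding ex using that f'(2) is_cocycleD(2)[OF f that] linear_map_closed[OF fd] by simp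
  with projective_lift[OF projective mods(1,2) \<alpha>(1) fd] obtain a
    where a: "a \<in> linear_maps R (P (Suc i)) A" "\<And>x. x \<in> carrier (P (Suc i)) \<Longrightarrow> \<alpha> (a x) = f' (\<delta> i x)" by metis
  have "a (\<delta> (Suc i) x) = \<zero>\<^bsub>A\<^esub>" if x: "x \<in> carrier (P (Suc (Suc i)))" for x
  proof -
    have "\<alpha> (a (\<delta> (Suc i) x)) = f' \<zero>\<^bsub>P i\<^esub>" using a(2) d_d[OF x] x by simp
    also have "\<dots> = \<alpha> \<zero>\<^bsub>A\<^esub>"
      using linear_map_zero[OF module_P mods(2) f'(1)] linear_map_zero[OF mods(1,2) \<alpha>(1)] by simp
    finally show ?thesis
      using \<alpha>(2) linear_map_closed[OF a(1)] x module.axioms(2)[OF mods(1)] abelian_group.axioms(1)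
        abelian_monoid.zero_closed by (metis d_closed inj_onD)
  qed
  then have "is_coboundary R P \<delta> A (Suc i) a"
    using vA a(1) unfolding cohomology_vanishes_def is_cocycle_def by blast
  then obtain b where b: "b \<in> linear_maps R (P i) A" "\<And>x. x \<in> carrier (P (Suc i)) \<Longrightarrow> a x = b (\<delta> i x)" by auto
  have \<alpha>b: "(\<lambda>x. \<alpha> (b x)) \<in> linear_maps R (P i) B" by (rule linear_maps_comp[OF b(1) \<alpha>(1)])
  \<comment> \<open>Subtracting \<open>b\<close> turns the lift of \<open>f\<close> into a cocycle
    with the same image in \<open>C\<close>.\<close>
  let ?h = "\<lambda>x. f' x \<ominus>\<^bsub>B\<^esub> \<alpha> (b x)"
  have h: "?h \<in> linear_maps R (P i) B" by (rule linear_maps_minus[OF mods(2) f'(1) \<alpha>b])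
  have "?h (\<delta> i x) = \<zero>\<^bsub>B\<^esub>" if x: "x \<in> carrier (P (Suc i))" for x
    using a(2)[OF x] b(2)[OF x] linear_map_closed[OF fd x] by (simp add: B.M.r_neg a_minus_def)
  then have "is_coboundary R P \<delta> B i ?h"
    using vB h unfolding cohomology_vanishes_def is_cocycle_def by blast
  then have "is_coboundary R P \<delta> C i (\<lambda>x. \<beta> (?h x))" by (rule is_coboundary_map[OF \<beta>(1) mods(2,3)])
  moreover have "\<beta> (?h x) = f x" if x: "x \<in> carrier (P i)" for x
  proof -
    have "\<alpha> (b x) \<in> \<alpha> ` carrier A" using linear_map_closed[OF b(1) x] by blast
    then have "\<alpha> (b x) \<in> carrier B" "\<beta> (\<alpha> (b x)) = \<zero>\<^bsub>C\<^esub>" unfolding ex by auto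
    then show ?thesis using linear_map_minus[OF mods(2,3) \<beta>(1)] linear_map_closed[OF f'(1) x] f'(2)[OF x]
      linear_map_closed[OF fl x] by (simp add: a_minus_def)
  qed
  ultimately show "is_coboundary R P \<delta> C i f" using is_coboundary_cong[of P i "\<lambda>x. \<beta> (?h x)" f] by blast
qed

text \<open>Injectivity of \<open>H^i(A) \<rightarrow> H^i(B)\<close> when the preceding cohomology
  of \<open>C\<close> vanishes. In degree \<open>0\<close> it is injectivity of
  \<open>\<alpha>\<close>; otherwise a primitive in \<open>B\<close> is corrected until it takes
  values in \<open>A\<close>.\<close>

lemma is_coboundary_inject:
  assumes mods: "module R A" "module R B" "module R C"
    and \<alpha>: "\<alpha> \<in> linear_maps R A B" "inj_on \<alpha> (carrier A)"
    and \<beta>: "\<beta> \<in> linear_maps R B C" "\<beta> ` carrier B = carrier C"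
    and ex: "\<alpha> ` carrier A = {y \<in> carrier B. \<beta> y = \<zero>\<^bsub>C\<^esub>}"
    and vC: "\<And>j. i = Suc j \<Longrightarrow> cohomology_vanishes R P \<delta> C j"
    and f: "f \<in> linear_maps R (P i) A" and af: "is_coboundary R P \<delta> B i (\<lambda>x. \<alpha> (f x))"
  shows "is_coboundary R P \<delta> A i f"
proof (cases i)
  case 0
  interpret A: module R A by fact
  have "f x = \<zero>\<^bsub>A\<^esub>" if x: "x \<in> carrier (P 0)" for x
  proof -
    have "\<alpha> (f x) = \<alpha> \<zero>\<^bsub>A\<^esub>" using af 0 x linear_map_zero[OF mods(1,2) \<alpha>(1)] by simp
    then show ?thesis using \<alpha>(2) linear_map_closed[OF f] x 0 by (auto dest: inj_onD)
  qed
  then show ?thesis using 0 by simp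
next
  case (Suc j)
  interpret A: module R A by fact
  interpret B: module R B by fact
  interpret C: module R C by fact
  obtain g where g: "g \<in> linear_maps R (P j) B" "\<And>x. x \<in> carrier (P (Suc j)) \<Longrightarrow> \<alpha> (f x) = g (\<delta> j x)"
    using af Suc by auto
  have f: "f \<in> linear_maps R (P (Suc j)) A" using f Suc by simp
  have \<alpha>f: "\<alpha> (f x) \<in> carrier B \<and> \<beta> (\<alpha> (f x)) = \<zero>\<^bsub>C\<^esub>" if "x \<in> carrier (P (Suc j))" for x
    using linear_map_closed[OF f that] ex by blast
  have "is_cocycle R P \<delta> C j (\<lambda>x. \<beta> (g x))"
    unfolding is_cocycle_def using linear_maps_comp[OF g(1) \<beta>(1)] g(2) \<alpha>f by simp
  then have cob: "is_coboundary R P \<delta> C j (\<lambda>x. \<beta> (g x))" using vC[OF Suc] unfolding cohomology_vanishes_def by blast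
  \<comment> \<open>The correction term: a cocycle in \<open>B\<close> with the same image in
    \<open>C\<close> as the primitive \<open>g\<close>. It is zero in degree \<open>0\<close> and
    otherwise the differential of a lift of a primitive of \<open>\<beta> g\<close>.\<close>
  have "\<exists>h\<in>linear_maps R (P j) B. (\<forall>x\<in>carrier (P j). \<beta> (h x) = \<beta> (g x)) \<and>
      (\<forall>x\<in>carrier (P (Suc j)). h (\<delta> j x) = \<zero>\<^bsub>B\<^esub>)"
  proof (cases j)
    case 0
    then show ?thesis using cob linear_maps_const_zero[OF mods(2), of "P j"] linear_map_zero[OF mods(2,3) \<beta>(1)]
      by (intro bexI[of _ "\<lambda>_. \<zero>\<^bsub>B\<^esub>"]) auto
  next
    case (Suc k)
    then obtain h where h: "h \<in> linear_maps R (P k) C" "\<And>x. x \<in> carrier (P (Suc k)) \<Longrightarrow> \<beta> (g x) = h (\<delta> k x)"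
      using cob by auto
    obtain h' where h': "h' \<in> linear_maps R (P k) B" "\<And>x. x \<in> carrier (P k) \<Longrightarrow> \<beta> (h' x) = h x"
      by (rule projective_lift[OF projective mods(2,3) \<beta>(1) h(1)]) (use linear_map_closed[OF h(1)] \<beta>(2) in auto)
    show ?thesis
    proof (intro bexI conjI ballI)
      show "(\<lambda>x. h' (\<delta> k x)) \<in> linear_maps R (P j) B" using linear_maps_comp[OF d_linear h'(1)] Suc by simp
      show "h' (\<delta> k (\<delta> j x)) = \<zero>\<^bsub>B\<^esub>" if "x \<in> carrier (P (Suc j))" for x
        using d_d[of x k] that Suc linear_map_zero[OF module_P mods(2) h'(1)] by simp
    qed (use Suc h(2) h'(2) in auto)
  qed
  then obtain h where h: "h \<in> linear_maps R (P j) B" "\<And>x. x \<in> carrier (P j) \<Longrightarrow> \<beta> (h x) = \<beta> (g x)"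
    "\<And>x. x \<in> carrier (P (Suc j)) \<Longrightarrow> h (\<delta> j x) = \<zero>\<^bsub>B\<^esub>" by blast
  let ?u = "\<lambda>x. g x \<ominus>\<^bsub>B\<^esub> h x"
  have u: "?u \<in> linear_maps R (P j) B" by (rule linear_maps_minus[OF mods(2) g(1) h(1)])
  have "?u x \<in> \<alpha> ` carrier A" if x: "x \<in> carrier (P j)" for x
    unfolding ex using linear_map_closed[OF u x] linear_map_minus[OF mods(2,3) \<beta>(1)]
      linear_map_closed[OF g(1) x] linear_map_closed[OF h(1) x] h(2)[OF x] linear_map_closed[OF \<beta>(1)]
    by (simp add: C.M.r_neg a_minus_def)
  with projective_lift[OF projective mods(1,2) \<alpha>(1) u] obtain g'
    where g': "g' \<in> linear_maps R (P j) A" "\<And>x. x \<in> carrier (P j) \<Longrightarrow> \<alpha> (g' x) = ?u x" by metis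
  have "f x = g' (\<delta> j x)" if x: "x \<in> carrier (P (Suc j))" for x
  proof -
    have "\<alpha> (g' (\<delta> j x)) = \<alpha> (f x)"
      using g'(2)[of "\<delta> j x"] x g(2)[OF x] h(3)[OF x] \<alpha>f[OF x] by (simp add: a_minus_def)
    then show ?thesis using \<alpha>(2) linear_map_closed[OF f x] linear_map_closed[OF g'(1)] x
      by (metis d_closed inj_onD)
  qed
  then show ?thesis using g'(1) Suc by auto
qed

text \<open>The segment \<open>H^(i-1)(C) \<rightarrow> H^i(A) \<rightarrow> H^i(B)\<close> of the
  long exact sequence.\<close>

lemma cohomology_vanishes_sub:
  assumes mods: "module R A" "module R B" "module R C"
    and \<alpha>: "\<alpha> \<in> linear_maps R A B" "inj_on \<alpha> (carrier A)"
    and \<beta>: "\<beta> \<in> linear_maps R B C" "\<beta> ` carrier B = carrier C"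
    and ex: "\<alpha> ` carrier A = {y \<in> carrier B. \<beta> y = \<zero>\<^bsub>C\<^esub>}"
    and vC: "\<And>j. i = Suc j \<Longrightarrow> cohomology_vanishes R P \<delta> C j"
    and vB: "cohomology_vanishes R P \<delta> B i"
  shows "cohomology_vanishes R P \<delta> A i"
  unfolding cohomology_vanishes_def
proof (intro allI impI)
  fix f assume f: "is_cocycle R P \<delta> A i f"
  have "is_coboundary R P \<delta> B i (\<lambda>x. \<alpha> (f x))"
    using is_cocycle_map[OF \<alpha>(1) mods(1,2) f] vB unfolding cohomology_vanishes_def by blast
  from is_coboundary_inject[OF mods \<alpha> \<beta> ex _ is_cocycleD(1)[OF f] this]
  show "is_coboundary R P \<delta> A i f" using vC by blast
qed

text \<open>Left exactness of \<open>Hom\<close>: in degree \<open>0\<close> an injection alone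
  transfers the vanishing.\<close>

lemma cohomology_0_vanishes_sub:
  assumes mods: "module R A" "module R B"
    and \<alpha>: "\<alpha> \<in> linear_maps R A B" "inj_on \<alpha> (carrier A)"
    and vB: "cohomology_vanishes R P \<delta> B 0"
  shows "cohomology_vanishes R P \<delta> A 0"
  unfolding cohomology_vanishes_def
proof (intro allI impI)
  interpret A: module R A by fact
  fix f assume f: "is_cocycle R P \<delta> A 0 f"
  have *: "is_coboundary R P \<delta> B 0 (\<lambda>x. \<alpha> (f x))"
    using is_cocycle_map[OF \<alpha>(1) mods(1,2) f] vB unfolding cohomology_vanishes_def by blast
  have "f x = \<zero>\<^bsub>A\<^esub>" if x: "x \<in> carrier (P 0)" for x
  proof -
    have "\<alpha> (f x) = \<alpha> \<zero>\<^bsub>A\<^esub>" using * x linear_map_zero[OF mods(1,2) \<alpha>(1)] by simp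
    then show ?thesis using \<alpha>(2) linear_map_closed[OF is_cocycleD(1)[OF f] x] by (auto dest: inj_onD)
  qed
  then show "is_coboundary R P \<delta> A 0 f" by simp
qed

section \<open>Null-homotopies and the action of the annihilator\<close>

text \<open>A chain endomorphism over the zero map of \<open>M\<close>. Once \<open>s'\<close> is
  given in degree \<open>i\<close>, the difference of \<open>w (Suc i)\<close> and
  \<open>s' \<delta>\<close> takes values in cycles, which are boundaries, and so lifts.\<close>

lemma null_homotopy:
  assumes w: "\<And>i. w i \<in> linear_maps R (P i) (P i)"
    and chain: "\<And>i x. x \<in> carrier (P (Suc i)) \<Longrightarrow> \<delta> i (w (Suc i) x) = w i (\<delta> i x)"
    and aug: "\<And>x. x \<in> carrier (P 0) \<Longrightarrow> \<epsilon> (w 0 x) = \<zero>\<^bsub>M\<^esub>"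
  shows "\<exists>s\<in>linear_maps R (P 0) (P (Suc 0)). \<forall>x\<in>carrier (P 0). w 0 x = \<delta> 0 (s x)"
    and "\<exists>s\<in>linear_maps R (P (Suc i)) (P (Suc (Suc i))). \<exists>s'\<in>linear_maps R (P i) (P (Suc i)).
      \<forall>x\<in>carrier (P (Suc i)). w (Suc i) x = \<delta> (Suc i) (s x) \<oplus>\<^bsub>P (Suc i)\<^esub> s' (\<delta> i x)"
proof -
  have "w 0 x \<in> \<delta> 0 ` carrier (P (Suc 0))" if "x \<in> carrier (P 0)" for x
    unfolding d_image_0 using aug that linear_map_closed[OF w that] by simp
  with projective_lift[OF projective module_P module_P d_linear w[of 0]]
  show base: "\<exists>s\<in>linear_maps R (P 0) (P (Suc 0)). \<forall>x\<in>carrier (P 0). w 0 x = \<delta> 0 (s x)" by metis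
  have step: "\<exists>s\<in>linear_maps R (P (Suc i)) (P (Suc (Suc i))).
      \<forall>x\<in>carrier (P (Suc i)). w (Suc i) x = \<delta> (Suc i) (s x) \<oplus>\<^bsub>P (Suc i)\<^esub> s' (\<delta> i x)"
    if s': "s' \<in> linear_maps R (P i) (P (Suc i))"
      "\<And>x. x \<in> carrier (P (Suc i)) \<Longrightarrow> w i (\<delta> i x) = \<delta> i (s' (\<delta> i x))" for s' i
  proof -
    interpret Q: module R "P (Suc i)" by (rule module_P)
    interpret Q': module R "P i" by (rule module_P)
    let ?v = "\<lambda>x. w (Suc i) x \<ominus>\<^bsub>P (Suc i)\<^esub> s' (\<delta> i x)"
    have sd: "(\<lambda>x. s' (\<delta> i x)) \<in> linear_maps R (P (Suc i)) (P (Suc i))"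
      by (rule linear_maps_comp[OF d_linear s'(1)])
    have v: "?v \<in> linear_maps R (P (Suc i)) (P (Suc i))" by (rule linear_maps_minus[OF module_P w sd])
    have "?v x \<in> \<delta> (Suc i) ` carrier (P (Suc (Suc i)))" if x: "x \<in> carrier (P (Suc i))" for x
    proof -
      have "\<delta> i (?v x) = \<delta> i (w (Suc i) x) \<ominus>\<^bsub>P i\<^esub> \<delta> i (s' (\<delta> i x))"
        using linear_map_minus[OF module_P module_P d_linear] linear_map_closed[OF w x]
          linear_map_closed[OF sd x] by blast
      also have "\<dots> = \<zero>\<^bsub>P i\<^esub>"
        using chain[OF x] s'(2)[OF x] linear_map_closed[OF sd x] by (simp add: Q'.M.r_neg a_minus_def)
      finally show ?thesis unfolding d_image_Suc using linear_map_closed[OF v x] by simp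
    qed
    with projective_lift[OF projective module_P module_P d_linear v]
    obtain s where s: "s \<in> linear_maps R (P (Suc i)) (P (Suc (Suc i)))"
      "\<And>x. x \<in> carrier (P (Suc i)) \<Longrightarrow> \<delta> (Suc i) (s x) = ?v x" by metis
    have "w (Suc i) x = \<delta> (Suc i) (s x) \<oplus>\<^bsub>P (Suc i)\<^esub> s' (\<delta> i x)" if x: "x \<in> carrier (P (Suc i))" for x
      using s(2)[OF x] linear_map_closed[OF w x] linear_map_closed[OF sd x]
      by (simp add: a_minus_def Q.M.a_assoc Q.M.l_neg)
    then show ?thesis using s(1) by blast
  qed
  \<comment> \<open>The induction retains only what the next step uses of the homotopy: on
    boundaries its second term vanishes because of \<open>\<delta> \<delta> = 0\<close>.\<close>
  have ind: "\<exists>s'\<in>linear_maps R (P i) (P (Suc i)). \<forall>x\<in>carrier (P (Suc i)). w i (\<delta> i x) = \<delta> i (s' (\<delta> i x))" for i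
  proof (induct i)
    case 0 then show ?case using base by auto
  next
    case (Suc i)
    then obtain s' where s': "s' \<in> linear_maps R (P i) (P (Suc i))"
      "\<And>x. x \<in> carrier (P (Suc i)) \<Longrightarrow> w i (\<delta> i x) = \<delta> i (s' (\<delta> i x))" by blast
    from step[OF this] obtain s where s: "s \<in> linear_maps R (P (Suc i)) (P (Suc (Suc i)))"
      "\<And>x. x \<in> carrier (P (Suc i)) \<Longrightarrow> w (Suc i) x = \<delta> (Suc i) (s x) \<oplus>\<^bsub>P (Suc i)\<^esub> s' (\<delta> i x)" by blast
    interpret Q: module R "P (Suc i)" by (rule module_P)
    have "w (Suc i) (\<delta> (Suc i) x) = \<delta> (Suc i) (s (\<delta> (Suc i) x))" if x: "x \<in> carrier (P (Suc (Suc i)))" for x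
      using s(2)[of "\<delta> (Suc i) x"] x d_d[OF x] linear_map_zero[OF module_P module_P s'(1)]
        linear_map_closed[OF s(1)] by simp
    then show ?case using s(1) by blast
  qed
  show "\<exists>s\<in>linear_maps R (P (Suc i)) (P (Suc (Suc i))). \<exists>s'\<in>linear_maps R (P i) (P (Suc i)).
      \<forall>x\<in>carrier (P (Suc i)). w (Suc i) x = \<delta> (Suc i) (s x) \<oplus>\<^bsub>P (Suc i)\<^esub> s' (\<delta> i x)"
    using ind[of i] step[of _ i] by blast
qed

text \<open>Multiplication by \<open>a\<close> lifts the zero map of \<open>M\<close>, so it equals
  \<open>\<delta> s + s' \<delta>\<close>. A cocycle kills the first term, and the second exhibits
  \<open>a f\<close> as a coboundary.\<close>

lemma is_coboundary_annihilator:
  assumes N: "module R N" and a: "a \<in> carrier R" and ann: "\<And>m. m \<in> carrier M \<Longrightarrow> a \<odot>\<^bsub>M\<^esub> m = \<zero>\<^bsub>M\<^esub>"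
    and f: "is_cocycle R P \<delta> N i f"
  shows "is_coboundary R P \<delta> N i (\<lambda>x. a \<odot>\<^bsub>N\<^esub> f x)"
proof -
  interpret N: module R N by fact
  let ?w = "\<lambda>i x. a \<odot>\<^bsub>P i\<^esub> x"
  have w: "?w i \<in> linear_maps R (P i) (P i)" for i
    by (rule linear_maps_smult[OF module_P linear_maps_id a])
  have c: "\<delta> i (?w (Suc i) x) = ?w i (\<delta> i x)" if "x \<in> carrier (P (Suc i))" for i x
    using linear_map_smult[OF d_linear a that] .
  have e: "\<epsilon> (?w 0 x) = \<zero>\<^bsub>M\<^esub>" if "x \<in> carrier (P 0)" for x
    using linear_map_smult[OF augmentation_linear a that] ann linear_map_closed[OF augmentation_linear that] by simp
  note fl = is_cocycleD(1)[OF f]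
  have af: "a \<odot>\<^bsub>N\<^esub> f x = f (?w i x)" if "x \<in> carrier (P i)" for x using linear_map_smult[OF fl a that] ..
  show ?thesis
  proof (cases i)
    case 0
    then show ?thesis
      using null_homotopy(1)[of ?w, OF w c e] af is_cocycleD(2)[OF f] linear_map_closed by fastforce
  next
    case (Suc j)
    obtain s s' where s: "s \<in> linear_maps R (P (Suc j)) (P (Suc (Suc j)))" "s' \<in> linear_maps R (P j) (P (Suc j))"
      "\<And>x. x \<in> carrier (P (Suc j)) \<Longrightarrow> ?w (Suc j) x = \<delta> (Suc j) (s x) \<oplus>\<^bsub>P (Suc j)\<^esub> s' (\<delta> j x)"
      using null_homotopy(2)[of ?w j, OF w c e] by blast
    have "a \<odot>\<^bsub>N\<^esub> f x = f (s' (\<delta> j x))" if x: "x \<in> carrier (P (Suc j))" for x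
    proof -
      have sx: "s x \<in> carrier (P (Suc (Suc j)))" "s' (\<delta> j x) \<in> carrier (P (Suc j))"
        using linear_map_closed[OF s(1) x] linear_map_closed[OF s(2)] x by auto
      have "a \<odot>\<^bsub>N\<^esub> f x = f (\<delta> (Suc j) (s x)) \<oplus>\<^bsub>N\<^esub> f (s' (\<delta> j x))"
        using af[of x] s(3)[OF x] x Suc sx linear_map_add[OF fl] by simp
      then show ?thesis using is_cocycleD(2)[OF f] sx Suc linear_map_closed[OF fl] by simp
    qed
    then show ?thesis using Suc linear_maps_comp[OF s(2), of f N] fl by auto
  qed
qed

end


section \<open>Existence and comparison of resolutions\<close>

lemma (in proj_resolution) comparison:
  assumes Q: "proj_resolution R Q \<gamma> \<eta> M"
  shows "\<exists>u. (\<forall>i. u i \<in> linear_maps R (P i) (Q i)) \<and>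
    (\<forall>i. \<forall>x\<in>carrier (P (Suc i)). \<gamma> i (u (Suc i) x) = u i (\<delta> i x)) \<and>
    (\<forall>x\<in>carrier (P 0). \<eta> (u 0 x) = \<epsilon> x)"
proof -
  interpret Q: proj_resolution R Q \<gamma> \<eta> M by fact
  \<comment> \<open>The last conjunct is precisely the condition for the next lift, so degree
    \<open>0\<close> and the higher degrees are handled by the same choice principle.\<close>
  let ?A = "\<lambda>n u. u \<in> linear_maps R (P n) (Q n) \<and> (n = 0 \<longrightarrow> (\<forall>x\<in>carrier (P 0). \<eta> (u x) = \<epsilon> x)) \<and>
    (\<forall>x\<in>carrier (P (Suc n)). u (\<delta> n x) \<in> \<gamma> n ` carrier (Q (Suc n)))"
  let ?B = "\<lambda>n u u'. \<forall>x\<in>carrier (P (Suc n)). \<gamma> n (u' x) = u (\<delta> n x)"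
  have base: "\<exists>u. ?A 0 u"
  proof -
    have "\<epsilon> x \<in> \<eta> ` carrier (Q 0)" if "x \<in> carrier (P 0)" for x
      unfolding Q.augmentation_surj using linear_map_closed[OF augmentation_linear that] .
    with projective_lift[OF projective Q.module_P module_M Q.augmentation_linear augmentation_linear]
    obtain u where u: "u \<in> linear_maps R (P 0) (Q 0)" "\<And>x. x \<in> carrier (P 0) \<Longrightarrow> \<eta> (u x) = \<epsilon> x" by metis
    have "u (\<delta> 0 x) \<in> \<gamma> 0 ` carrier (Q (Suc 0))" if "x \<in> carrier (P (Suc 0))" for x
      unfolding Q.d_image_0 using u(2)[of "\<delta> 0 x"] augmentation_d[OF that] linear_map_closed[OF u(1)] that by simp
    then show ?thesis using u by blast
  qed
  have step: "\<exists>u'. ?A (Suc n) u' \<and> ?B n u u'" if u: "?A n u" for n u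
  proof -
    have ul: "u \<in> linear_maps R (P n) (Q n)" using u by blast
    note ud = linear_maps_comp[OF d_linear ul]
    obtain u' where u': "u' \<in> linear_maps R (P (Suc n)) (Q (Suc n))"
      "\<And>x. x \<in> carrier (P (Suc n)) \<Longrightarrow> \<gamma> n (u' x) = u (\<delta> n x)"
      using projective_lift[OF projective Q.module_P Q.module_P Q.d_linear ud] u by metis
    have "u' (\<delta> (Suc n) x) \<in> \<gamma> (Suc n) ` carrier (Q (Suc (Suc n)))" if "x \<in> carrier (P (Suc (Suc n)))" for x
      unfolding Q.d_image_Suc using u'(2)[of "\<delta> (Suc n) x"] d_d[OF that] linear_map_closed[OF u'(1)] that
        linear_map_zero[OF module_P Q.module_P ul] by simp
    then show ?thesis using u' by blast
  qed
  have "\<exists>u. \<forall>n. ?A n (u n) \<and> ?B n (u n) (u (Suc n))"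
    using base step by (rule dependent_nat_choice[of ?A ?B])
  then obtain u where u: "\<forall>n. ?A n (u n) \<and> ?B n (u n) (u (Suc n))" by (rule exE)
  show ?thesis
  proof (intro exI[of _ u] conjI allI)
    show "u i \<in> linear_maps R (P i) (Q i)" for i using spec[OF u, of i] by simp
    show "\<forall>x\<in>carrier (P (Suc i)). \<gamma> i (u (Suc i) x) = u i (\<delta> i x)" for i using spec[OF u, of i] by simp
    show "\<forall>x\<in>carrier (P 0). \<eta> (u 0 x) = \<epsilon> x" using spec[OF u, of 0] by simp
  qed
qed

text \<open>
  If \<open>u\<close> and \<open>v\<close> compare the two resolutions, then \<open>id - v u\<close> is null-homotopic. In degree
  \<open>Suc d\<close> this map is the identity, because \<open>u\<close> passes through zero.
\<close>

lemma (in proj_resolution) top_differential_splits: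
  assumes Q: "proj_resolution R Q \<gamma> \<eta> M" and tQ: "trivial_module (Q (Suc d))"
    and tP: "trivial_module (P (Suc (Suc d)))"
  obtains s where "s \<in> linear_maps R (P d) (P (Suc d))"
    "\<And>x. x \<in> carrier (P (Suc d)) \<Longrightarrow> s (\<delta> d x) = x"
proof -
  interpret Q: proj_resolution R Q \<gamma> \<eta> M by fact
  obtain u where u: "\<And>i. u i \<in> linear_maps R (P i) (Q i)"
    "\<And>i x. x \<in> carrier (P (Suc i)) \<Longrightarrow> \<gamma> i (u (Suc i) x) = u i (\<delta> i x)"
    "\<And>x. x \<in> carrier (P 0) \<Longrightarrow> \<eta> (u 0 x) = \<epsilon> x"
    using comparison[OF Q] by blast
  obtain v where v: "\<And>i. v i \<in> linear_maps R (Q i) (P i)"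
    "\<And>i x. x \<in> carrier (Q (Suc i)) \<Longrightarrow> \<delta> i (v (Suc i) x) = v i (\<gamma> i x)"
    "\<And>x. x \<in> carrier (Q 0) \<Longrightarrow> \<epsilon> (v 0 x) = \<eta> x"
    using Q.comparison[OF proj_resolution_axioms] by blast
  have vu: "(\<lambda>x. v i (u i x)) \<in> linear_maps R (P i) (P i)" for i by (rule linear_maps_comp[OF u(1) v(1)])
  let ?w = "\<lambda>i x. x \<ominus>\<^bsub>P i\<^esub> v i (u i x)"
  have w: "?w i \<in> linear_maps R (P i) (P i)" for i
    by (rule linear_maps_minus[OF module_P linear_maps_id vu])
  have c: "\<delta> i (?w (Suc i) x) = ?w i (\<delta> i x)" if x: "x \<in> carrier (P (Suc i))" for i x
    using linear_map_minus[OF module_P module_P d_linear x linear_map_closed[OF vu x]]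
      v(2)[OF linear_map_closed[OF u(1) x]] u(2)[OF x] by simp
  have e: "\<epsilon> (?w 0 x) = \<zero>\<^bsub>M\<^esub>" if x: "x \<in> carrier (P 0)" for x
  proof -
    interpret M: module R M by (rule module_M)
    show ?thesis
      using linear_map_minus[OF module_P module_M augmentation_linear x linear_map_closed[OF vu x]]
        v(3)[OF linear_map_closed[OF u(1) x]] u(3)[OF x] linear_map_closed[OF augmentation_linear x]
      by (simp add: a_minus_def M.M.r_neg)
  qed
  obtain s s' where s: "s \<in> linear_maps R (P (Suc d)) (P (Suc (Suc d)))"
    "s' \<in> linear_maps R (P d) (P (Suc d))"
    "\<And>x. x \<in> carrier (P (Suc d)) \<Longrightarrow> ?w (Suc d) x = \<delta> (Suc d) (s x) \<oplus>\<^bsub>P (Suc d)\<^esub> s' (\<delta> d x)"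
    using null_homotopy(2)[of ?w d, OF w c e] by blast
  interpret P: module R "P (Suc d)" by (rule module_P)
  \<comment> \<open>As \<open>P (Suc (Suc d))\<close> is zero as well, only the term
    \<open>s' \<delta>\<close> of the homotopy survives.\<close>
  have "s' (\<delta> d x) = x" if x: "x \<in> carrier (P (Suc d))" for x
  proof -
    have "u (Suc d) x = \<zero>\<^bsub>Q (Suc d)\<^esub>"
      using linear_map_closed[OF u(1) x] tQ by (simp add: trivial_module_def)
    then have "v (Suc d) (u (Suc d) x) = \<zero>\<^bsub>P (Suc d)\<^esub>"
      using linear_map_zero[OF Q.module_P module_P v(1)] by simp
    moreover have "s x = \<zero>\<^bsub>P (Suc (Suc d))\<^esub>"
      using linear_map_closed[OF s(1) x] tP by (simp add: trivial_module_def)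
    then have "\<delta> (Suc d) (s x) = \<zero>\<^bsub>P (Suc d)\<^esub>" using linear_map_zero[OF module_P module_P d_linear] by simp
    moreover have "s' (\<delta> d x) \<in> carrier (P (Suc d))" using linear_map_closed[OF s(2)] x by simp
    ultimately show ?thesis using s(3)[OF x] x P.M.add.inv_one by (simp add: a_minus_def a_inv_def)
  qed
  then show thesis using s(2) that by blast
qed

text \<open>A prefix-free code: every entry is preceded by the marker \<open>p\<close>, and \<open>q\<close> ends the word.\<close>

definition mark_list :: "'c \<Rightarrow> 'c \<Rightarrow> 'c list \<Rightarrow> 'c list"
  where "mark_list p q u = concat (map (\<lambda>x. [p, x]) u) @ [q]"

lemma mark_list_cancel:
  assumes "p \<noteq> q" "mark_list p q u @ r = mark_list p q u' @ r'"
  shows "u = u' \<and> r = r'"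
  using assms(2)
proof (induct u arbitrary: u')
  case Nil
  then show ?case using assms(1) by (cases u') (auto simp: mark_list_def)
next
  case (Cons x u)
  then show ?case using assms(1) by (cases u') (auto simp: mark_list_def)
qed

text \<open>Covering a module of lists by a free module yields lists of lists; flattening them
  brings the cover back into the same type, so that covers can be iterated. The two letters are
  taken from \<open>'m\<close> because \<open>'a\<close> may have only one element.\<close>

lemma inj_list_pairs:
  assumes "m0 \<noteq> (m1 :: 'm)"
  shows "\<exists>E :: ('a \<times> ('a \<times> 'm) list) list \<Rightarrow> ('a \<times> 'm) list. inj E"
proof -
  define p where "p = (undefined :: 'a, m0)"
  define q where "q = (undefined :: 'a, m1)"
  have pq: "p \<noteq> q" using assms by (simp add: p_def q_def)
  \<comment> \<open>The ring entry \<open>a\<close> joins the word \<open>u\<close> as an extra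
    first letter, with \<open>m0\<close> as padding.\<close>
  define E where "E l = concat (map (\<lambda>(a, u). mark_list p q ((a, m0) # u)) l)" for l
  have ne: "mark_list p q u @ r \<noteq> []" for u r by (simp add: mark_list_def)
  have E_Cons: "E ((a, u) # l) = mark_list p q ((a, m0) # u) @ E l" for a u l by (simp add: E_def)
  have "E l = E l' \<Longrightarrow> l = l'" for l l'
  proof (induct l arbitrary: l')
    case Nil
    show ?case
    proof (cases l')
      case (Cons y ys)
      obtain b v where y: "y = (b, v)" by fastforce
      have "E [] = []" by (simp add: E_def)
      then show ?thesis using Nil.prems ne unfolding Cons y E_Cons by metis
    qed simp
  next
    case (Cons x l)
    obtain a u where x: "x = (a, u)" by fastforce
    show ?case
    proof (cases l')
      case Nil
      have "E [] = []" by (simp add: E_def)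
      then show ?thesis using Cons.prems ne unfolding Nil x E_Cons by metis
    next
      case l': (Cons y ys)
      obtain b v where y: "y = (b, v)" by fastforce
      have "(a, m0) # u = (b, m0) # v \<and> E l = E ys"
        using Cons.prems unfolding l' x y E_Cons by (rule mark_list_cancel[OF pq])
      then show ?thesis using Cons.hyps l' x y by simp
    qed
  qed
  then show ?thesis by (metis injI)
qed

context cring begin

text \<open>The free module on the whole carrier, recoded into the fixed auxiliary type. The
  injection \<open>j\<close> allows both the resolved module and its syzygies as \<open>K\<close>;
  nothing minimal is claimed.\<close>

lemma exists_projective_cover:
  fixes K :: "('a, 'k) module" and j :: "'k \<Rightarrow> ('a \<times> 'm) list"
  assumes K: "module R K" and j: "inj j" and m: "m0 \<noteq> (m1 :: 'm)"
  shows "\<exists>(F :: ('a, 'm) aux_module) \<pi>. projective_module R F \<and> \<pi> \<in> linear_maps R F K \<and>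
    \<pi> ` carrier F = carrier K"
proof -
  interpret K: module R K by fact
  let ?F = "free_module R (carrier K)"
  obtain J :: "('k \<Rightarrow> 'a) \<Rightarrow> ('a \<times> 'k) list" where J: "inj_on J (carrier ?F)"
    using free_module_inj_list[of R "carrier K"] by blast
  obtain E :: "('a \<times> ('a \<times> 'm) list) list \<Rightarrow> ('a \<times> 'm) list" where E: "inj E"
    using inj_list_pairs[OF m] by blast
  define H where "H f = E (map (map_prod id j) (J f))" for f
  have mj: "inj (map (map_prod id j))" using j by (intro inj_mapI prod.inj_map) auto
  have H: "inj_on H (carrier ?F)"
  proof (rule inj_onI)
    fix f g assume fg: "f \<in> carrier ?F" "g \<in> carrier ?F" and "H f = H g"
    then have "map (map_prod id j) (J f) = map (map_prod id j) (J g)" unfolding H_def using injD[OF E] by blast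
    then have "J f = J g" by (rule injD[OF mj])
    then show "f = g" using inj_onD[OF J] fg by blast
  qed
  note tr = transport_module[OF module_free_module H]
  have db: "dual_basis R ?F (carrier K) free_basis (\<lambda>x f. f x)" by (rule dual_basis_free_module)
  let ?\<pi> = "\<lambda>f. finsum K (\<lambda>s. f s \<odot>\<^bsub>K\<^esub> s) {s \<in> carrier K. f s \<noteq> \<zero>}"
  have \<pi>: "?\<pi> \<in> linear_maps R ?F K"
    by (rule dual_basis_combination[OF module_free_module K db]) auto
  have "x \<in> ?\<pi> ` carrier ?F" if x: "x \<in> carrier K" for x
  proof (rule image_eqI)
    show "free_basis x \<in> carrier ?F" by (rule free_basis_carrier[OF x])
    have "?\<pi> (free_basis x) = finsum K (\<lambda>s. (if s = x then \<one> else \<zero>) \<odot>\<^bsub>K\<^esub> s) {x}"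
      using x by (intro finsum_smult_superset[OF K]) auto
    then show "x = ?\<pi> (free_basis x)" using x by simp
  qed
  then have \<pi>s: "?\<pi> ` carrier ?F = carrier K" using linear_map_closed[OF \<pi>] by blast
  have "(\<lambda>y. ?\<pi> (inv_into (carrier ?F) H y)) \<in> linear_maps R (transport_module H ?F) K"
    by (rule linear_maps_comp[OF tr(3) \<pi>])
  moreover have "(\<lambda>y. ?\<pi> (inv_into (carrier ?F) H y)) ` carrier (transport_module H ?F) = carrier K"
  proof -
    have "inv_into (carrier ?F) H ` H ` carrier ?F = carrier ?F" using H by (rule inv_into_image_cancel) simp
    moreover have "(\<lambda>y. ?\<pi> (inv_into (carrier ?F) H y)) ` H ` carrier ?F = ?\<pi> ` inv_into (carrier ?F) H ` H ` carrier ?F"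
      by (rule image_image[symmetric])
    ultimately show ?thesis unfolding carrier_transport_module using \<pi>s by argo
  qed
  moreover have "projective_module R (transport_module H ?F)"
    using dual_basis_projective[OF tr(1) dual_basis_transport[OF module_free_module H db]] .
  ultimately show ?thesis by blast
qed

lemma exists_projective_resolution:
  fixes M :: "('a, 'm) module"
  assumes M: "module R M" and m: "m0 \<noteq> (m1 :: 'm)"
  shows "\<exists>(P :: nat \<Rightarrow> ('a, 'm) aux_module) \<delta> \<epsilon>. projective_resolution R P \<delta> \<epsilon> M"
proof -
  have "inj (\<lambda>x :: 'm. [(undefined :: 'a, x)])" by (simp add: inj_def)
  from exists_projective_cover[OF M this m] obtain F0 :: "('a, 'm) aux_module" and \<epsilon>
    where F0: "projective_module R F0" "\<epsilon> \<in> linear_maps R F0 M" "\<epsilon> ` carrier F0 = carrier M" by blast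
  have "\<exists>(F :: ('a, 'm) aux_module) \<pi>. module R K \<longrightarrow> projective_module R F \<and> \<pi> \<in> linear_maps R F K \<and>
      \<pi> ` carrier F = carrier K" for K :: "('a, 'm) aux_module"
    using exists_projective_cover[of K "\<lambda>x. x", OF _ _ m] by (auto simp: inj_def)
  then obtain F :: "('a, 'm) aux_module \<Rightarrow> ('a, 'm) aux_module" and \<pi>
    where F: "\<And>K. module R K \<Longrightarrow> projective_module R (F K) \<and> \<pi> K \<in> linear_maps R (F K) K \<and>
      \<pi> K ` carrier (F K) = carrier K" by metis
  \<comment> \<open>The next syzygy: the kernel of the chosen cover of \<open>K\<close>. Iterating
    it gives the modules \<open>K n\<close>, each a submodule of \<open>P n\<close>.\<close>
  define ker where "ker K = sub_module (F K) {x \<in> carrier (F K). \<pi> K x = \<zero>\<^bsub>K\<^esub>}" for K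
  define K where "K n = (ker ^^ n) (sub_module F0 {x \<in> carrier F0. \<epsilon> x = \<zero>\<^bsub>M\<^esub>})" for n
  have K_Suc: "K (Suc n) = ker (K n)" for n by (simp add: K_def)
  have F0m: "module R F0" using F0(1) by (simp add: projective_module_def)
  have K: "module R (K n)" for n
  proof (induct n)
    case 0 then show ?case using module_kernel(2)[OF F0m M F0(2)] by (simp add: K_def)
  next
    case (Suc n)
    then have "module R (F (K n))" "\<pi> (K n) \<in> linear_maps R (F (K n)) (K n)"
      using F[of "K n"] by (auto simp: projective_module_def)
    then show ?case unfolding K_Suc ker_def using module_kernel(2)[OF _ Suc] by blast
  qed
  define P where "P n = (case n of 0 \<Rightarrow> F0 | Suc n \<Rightarrow> F (K n))" for n
  define \<delta> where "\<delta> n = \<pi> (K n)" for n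
  have P_simps: "P 0 = F0" "P (Suc n) = F (K n)" for n by (auto simp: P_def)
  have K_sub: "\<exists>A. K n = sub_module (P n) A \<and> A \<subseteq> carrier (P n)" for n
    by (cases n) (auto simp: K_Suc P_simps ker_def, auto simp: K_def)
  have K_zero: "\<zero>\<^bsub>K n\<^esub> = \<zero>\<^bsub>P n\<^esub>" for n
  proof -
    obtain A where "K n = sub_module (P n) A" using K_sub by blast
    then show ?thesis by simp
  qed
  have "projective_resolution R P \<delta> \<epsilon> M"
    unfolding projective_resolution_def
  proof (intro conjI allI)
    show "projective_module R (P i)" for i
      using F0(1) F[OF K] by (cases i) (auto simp: P_simps)
    show "\<delta> i \<in> linear_maps R (P (Suc i)) (P i)" for i
    proof -
      obtain A where A: "K i = sub_module (P i) A" "A \<subseteq> carrier (P i)" using K_sub by blast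
      have "\<delta> i \<in> linear_maps R (P (Suc i)) (K i)" using F[OF K] by (simp add: \<delta>_def P_simps)
      then show ?thesis using A linear_maps_into_sub_module by metis
    qed
    show "\<epsilon> \<in> linear_maps R (P 0) M" "\<epsilon> ` carrier (P 0) = carrier M" using F0 by (auto simp: P_simps)
    have im: "\<delta> i ` carrier (P (Suc i)) = carrier (K i)" for i using F[OF K] by (simp add: \<delta>_def P_simps)
    show "\<delta> 0 ` carrier (P 1) = a_kernel (P 0) M \<epsilon>"
      using im[of 0] by (simp add: K_def P_simps(1) a_kernel_def')
    show "\<delta> (Suc i) ` carrier (P (Suc (Suc i))) = a_kernel (P (Suc i)) (P i) (\<delta> i)" for i
      unfolding im K_Suc ker_def by (simp add: a_kernel_def' P_simps(2) K_zero \<delta>_def)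
  qed
  then show ?thesis by blast
qed

section \<open>The cyclic module \<open>R/I\<close> and its \<open>Ext\<close>\<close>

lemma submodule_ideal:
  assumes "ideal I R" shows "submodule I R (regular_module R)"
proof -
  interpret I: ideal I R by fact
  show ?thesis
    by (rule module_sub_module[OF module_regular]) (auto simp: I.a_subset I.I_l_closed I.Icarr)
qed

lemma quotient_by_ideal_annihilated:
  assumes "ideal I R" "a \<in> I" "X \<in> carrier (quotient_module (regular_module R) I)"
  shows "a \<odot>\<^bsub>quotient_module (regular_module R) I\<^esub> X = \<zero>\<^bsub>quotient_module (regular_module R) I\<^esub>"
proof -
  interpret I: ideal I R by fact
  note q = quotient_module[OF module_regular submodule_ideal[OF assms(1)]]
  obtain r where r: "r \<in> carrier R" "X = I +>\<^bsub>regular_module R\<^esub> r" using q(3) assms(3) by auto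
  have "a \<odot>\<^bsub>quotient_module (regular_module R) I\<^esub> X = I +>\<^bsub>regular_module R\<^esub> (a \<otimes> r)"
    using linear_map_smult[OF q(2), of a r] r I.Icarr[OF assms(2)] by simp
  then show ?thesis using q(4)[of "a \<otimes> r"] r I.I_r_closed[OF assms(2) r(1)] I.Icarr by simp
qed

text \<open>
  Degree 0 of the cohomology is \<open>Hom(R/I, N)\<close>, which is the set of elements of \<open>N\<close> killed by \<open>I\<close>.
\<close>

lemma cohomology_0_torsion:
  assumes I: "ideal I R" and res: "proj_resolution R P \<delta> \<epsilon> (quotient_module (regular_module R) I)"
    and N: "module R N" and v: "cohomology_vanishes R P \<delta> N 0"
    and n: "n \<in> carrier N" and ann: "\<And>a. a \<in> I \<Longrightarrow> a \<odot>\<^bsub>N\<^esub> n = \<zero>\<^bsub>N\<^esub>"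
  shows "n = \<zero>\<^bsub>N\<^esub>"
proof -
  interpret I: ideal I R by fact
  interpret N: module R N by fact
  interpret proj_resolution R P \<delta> \<epsilon> "quotient_module (regular_module R) I" by fact
  let ?Q = "quotient_module (regular_module R) I"
  note q = quotient_module[OF module_regular submodule_ideal[OF I]]
  let ?c = "\<lambda>r. I +>\<^bsub>regular_module R\<^esub> r"
  \<comment> \<open>The map from \<open>R/I\<close> to \<open>N\<close> sending the class of
    \<open>r\<close> to \<open>r n\<close>; it is well defined because \<open>I\<close> kills
    \<open>n\<close>.\<close>
  define \<theta> where "\<theta> X = (SOME r. r \<in> carrier R \<and> ?c r = X) \<odot>\<^bsub>N\<^esub> n" for X
  have \<theta>: "\<theta> (?c r) = r \<odot>\<^bsub>N\<^esub> n" if r: "r \<in> carrier R" for r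
  proof -
    define r' where "r' = (SOME r'. r' \<in> carrier R \<and> ?c r' = ?c r)"
    have "r' \<in> carrier R \<and> ?c r' = ?c r" unfolding r'_def by (rule someI[of _ r]) (use r in simp)
    then have r': "r' \<in> carrier R" "?c r' = ?c r" by auto
    interpret Q: module R ?Q by (rule q(1))
    have "?c (r' \<ominus> r) = ?c r' \<ominus>\<^bsub>?Q\<^esub> ?c r"
      using linear_map_minus[OF module_regular q(1,2), of r' r] r r'(1) by (simp add: regular_module_minus)
    also have "\<dots> = \<zero>\<^bsub>?Q\<^esub>"
      using linear_map_closed[OF q(2), of r] r r'(2) by (simp add: a_minus_def Q.M.r_neg)
    finally have "r' \<ominus> r \<in> I" using q(4)[of "r' \<ominus> r"] r r' by simp
    then have "(r' \<ominus> r) \<odot>\<^bsub>N\<^esub> n = \<zero>\<^bsub>N\<^esub>" by (rule ann)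
    moreover have "r' = (r' \<ominus> r) \<oplus> r" using r r' by (simp add: a_minus_def a_assoc l_neg)
    ultimately have "r' \<odot>\<^bsub>N\<^esub> n = r \<odot>\<^bsub>N\<^esub> n"
      using N.smult_l_distr[of "r' \<ominus> r" r n] r r' n by simp
    then show ?thesis by (simp add: \<theta>_def r'_def)
  qed
  have rep: "\<exists>r\<in>carrier R. X = ?c r" if "X \<in> carrier ?Q" for X using q(3) that by auto
  have \<theta>l: "\<theta> \<in> linear_maps R ?Q N"
  proof (rule linear_mapsI)
    show "\<theta> X \<in> carrier N" if "X \<in> carrier ?Q" for X using rep[OF that] \<theta> n by auto
    fix X Y assume "X \<in> carrier ?Q" "Y \<in> carrier ?Q"
    then obtain x y where "x \<in> carrier R" "y \<in> carrier R" "X = ?c x" "Y = ?c y" using rep by metis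
    then show "\<theta> (X \<oplus>\<^bsub>?Q\<^esub> Y) = \<theta> X \<oplus>\<^bsub>N\<^esub> \<theta> Y"
      using linear_map_add[OF q(2), of x y, symmetric] \<theta> n by (simp add: N.smult_l_distr)
  next
    fix a X assume a: "a \<in> carrier R" and "X \<in> carrier ?Q"
    then obtain x where "x \<in> carrier R" "X = ?c x" using rep by metis
    then show "\<theta> (a \<odot>\<^bsub>?Q\<^esub> X) = a \<odot>\<^bsub>N\<^esub> \<theta> X"
      using linear_map_smult[OF q(2) a, of x, symmetric] \<theta> n a by (simp add: N.smult_assoc1)
  qed
  have "is_cocycle R P \<delta> N 0 (\<lambda>x. \<theta> (\<epsilon> x))"
    using linear_maps_comp[OF augmentation_linear \<theta>l] augmentation_d linear_map_zero[OF module_M N \<theta>l]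
    by (simp add: is_cocycle_def)
  then have "is_coboundary R P \<delta> N 0 (\<lambda>x. \<theta> (\<epsilon> x))" using v unfolding cohomology_vanishes_def by blast
  then have z: "\<theta> (\<epsilon> x) = \<zero>\<^bsub>N\<^esub>" if "x \<in> carrier (P 0)" for x using that by simp
  have "?c \<one> \<in> \<epsilon> ` carrier (P 0)" unfolding augmentation_surj using q(3) by auto
  then have "\<theta> (?c \<one>) = \<zero>\<^bsub>N\<^esub>" using z by auto
  then show ?thesis using \<theta>[of \<one>] n by simp
qed

text \<open>Here \<open>1\<close> annihilates \<open>R/I\<close>, so multiplication by
  \<open>1\<close> is zero on cohomology.\<close>

lemma cohomology_vanishes_unit_ideal:
  assumes I: "ideal I R" and res: "proj_resolution R P \<delta> \<epsilon> (quotient_module (regular_module R) I)"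
    and N: "module R N" and one: "\<one> \<in> I"
  shows "cohomology_vanishes R P \<delta> N i"
  unfolding cohomology_vanishes_def
proof (intro allI impI)
  interpret N: module R N by fact
  fix f assume f: "is_cocycle R P \<delta> N i f"
  have "is_coboundary R P \<delta> N i (\<lambda>x. \<one> \<odot>\<^bsub>N\<^esub> f x)"
    by (rule proj_resolution.is_coboundary_annihilator[OF res N one_closed quotient_by_ideal_annihilated[OF I one] f])
  then show "is_coboundary R P \<delta> N i f"
    by (subst is_coboundary_cong[of P i f "\<lambda>x. \<one> \<odot>\<^bsub>N\<^esub> f x"])
      (use linear_map_closed[OF is_cocycleD(1)[OF f]] in auto)
qed

text \<open>Unfolds the choice in \<open>Ext\<close> once and for all; one resolution serves every
  degree \<open>i\<close>.\<close>

lemma Ext_resolution: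
  assumes I: "ideal I R"
  obtains P :: "nat \<Rightarrow> ('a, 'a set) aux_module" and \<delta> \<epsilon>
  where "proj_resolution R P \<delta> \<epsilon> (quotient_module (regular_module R) I)"
    "\<And>i. trivial_module (Ext R i (quotient_module (regular_module R) I) (regular_module R)) \<longleftrightarrow>
      cohomology_vanishes R P \<delta> (regular_module R) i"
proof -
  let ?Q = "quotient_module (regular_module R) I"
  note q = quotient_module[OF module_regular submodule_ideal[OF I]]
  define X where "X = (SOME (P :: nat \<Rightarrow> ('a, 'a set) aux_module, \<delta>). \<exists>\<epsilon>. projective_resolution R P \<delta> \<epsilon> ?Q)"
  \<comment> \<open>The two letters for the coding: a type of sets always has two elements, even
    over the zero ring.\<close>
  have "({} :: 'a set) \<noteq> UNIV" by simp
  from exists_projective_resolution[OF q(1) this]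
  obtain P0 :: "nat \<Rightarrow> ('a, 'a set) aux_module" and \<delta>0 \<epsilon>0 where "projective_resolution R P0 \<delta>0 \<epsilon>0 ?Q" by blast
  then have "\<exists>X :: (nat \<Rightarrow> ('a, 'a set) aux_module) \<times> _. case X of (P, \<delta>) \<Rightarrow> \<exists>\<epsilon>. projective_resolution R P \<delta> \<epsilon> ?Q"
    by (intro exI[of _ "(P0, \<delta>0)"]) auto
  then have "case X of (P, \<delta>) \<Rightarrow> \<exists>\<epsilon>. projective_resolution R P \<delta> \<epsilon> ?Q"
    unfolding X_def by (rule someI_ex)
  then obtain P \<delta> \<epsilon> where X: "X = (P, \<delta>)" and "projective_resolution R P \<delta> \<epsilon> ?Q" by (cases X) auto
  then have res: "proj_resolution R P \<delta> \<epsilon> ?Q" using q(1) by (simp add: proj_resolution_def)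
  have "Ext R i ?Q (regular_module R) = Hom_cohomology R P \<delta> (regular_module R) i" for i
    using X unfolding X_def Ext_def by simp
  then show thesis
    using that[OF res] proj_resolution.trivial_Hom_cohomology_iff[OF res module_regular] by simp
qed

end


section \<open>The Koszul complex\<close>

text \<open>Integer degrees make the terms below \<open>0\<close> empty, so degree \<open>-1\<close>
  and truncations require no separate treatment.\<close>

definition koszul_basis :: "nat \<Rightarrow> int \<Rightarrow> bool list set"
  where "koszul_basis n k = {b. length b = n \<and> int (count_list b True) = k}"

lemma finite_koszul_basis: "finite (koszul_basis n k)"
  by (rule finite_subset[OF _ finite_lists_length_eq[of UNIV n]]) (auto simp: koszul_basis_def)

lemma koszul_basis_empty: "k < 0 \<or> k > int n \<Longrightarrow> koszul_basis n k = {}"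
proof (rule equals0I)
  fix b assume "k < 0 \<or> k > int n" "b \<in> koszul_basis n k"
  then show False using count_le_length[of b True] by (auto simp: koszul_basis_def)
qed

lemma free_module_empty: "cring R \<Longrightarrow> carrier (free_module R {}) = {\<lambda>x. \<zero>\<^bsub>R\<^esub>}"
  using cring.cring_simprules(2)[of R] by (auto simp: free_module_carrier)

context cring begin

text \<open>
  The Koszul cochain complex of a list of ring elements. A basis element of the exterior algebra
  is a list of booleans marking its factors, and the degree is the number of marks. The recursion
  is that of the mapping cone of the first element, which makes all sign rules automatic.
\<close>

fun koszul_d :: "'a list \<Rightarrow> (bool list \<Rightarrow> 'a) \<Rightarrow> bool list \<Rightarrow> 'a"
  where
    "koszul_d (x # xs) f (True # b) =
      (x \<otimes> f (False # b)) \<ominus> koszul_d xs (\<lambda>b. f (True # b)) b"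
  | "koszul_d (x # xs) f (False # b) = koszul_d xs (\<lambda>b. f (False # b)) b"
  | "koszul_d [] f b = \<zero>"
  | "koszul_d (x # xs) f [] = \<zero>"

text \<open>Contraction with the \<open>j\<close>-th basis element: a homotopy from \<open>0\<close> to multiplication by \<open>xs ! j\<close>.\<close>

fun koszul_h :: "'a list \<Rightarrow> nat \<Rightarrow> (bool list \<Rightarrow> 'a) \<Rightarrow> bool list \<Rightarrow> 'a"
  where
    "koszul_h (x # xs) 0 f (True # b) = \<zero>"
  | "koszul_h (x # xs) 0 f (False # b) = f (True # b)"
  | "koszul_h (x # xs) (Suc j) f (True # b) = \<ominus> koszul_h xs j (\<lambda>b. f (True # b)) b"
  | "koszul_h (x # xs) (Suc j) f (False # b) = koszul_h xs j (\<lambda>b. f (False # b)) b"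
  | "koszul_h [] j f b = \<zero>"
  | "koszul_h (x # xs) j f [] = \<zero>"

abbreviation koszul_module :: "'a list \<Rightarrow> int \<Rightarrow> ('a, bool list \<Rightarrow> 'a) module"
  where "koszul_module xs k \<equiv> free_module R (koszul_basis (length xs) k)"

lemma koszul_module_carrier:
  "f \<in> carrier (koszul_module xs k) \<longleftrightarrow>
    (\<forall>b. f b \<in> carrier R) \<and> (\<forall>b. b \<notin> koszul_basis (length xs) k \<longrightarrow> f b = \<zero>)"
  using finite_koszul_basis by (simp add: free_module_carrier)

lemma koszul_d_closed: "(\<And>b. f b \<in> carrier R) \<Longrightarrow> set xs \<subseteq> carrier R \<Longrightarrow> koszul_d xs f b \<in> carrier R"
  by (induct xs f b rule: koszul_d.induct) auto

lemma koszul_h_closed: "(\<And>b. f b \<in> carrier R) \<Longrightarrow> koszul_h xs j f b \<in> carrier R"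
  by (induct xs j f b rule: koszul_h.induct) auto

lemma minus_add_minus:
  "a \<in> carrier R \<Longrightarrow> b \<in> carrier R \<Longrightarrow> c \<in> carrier R \<Longrightarrow> d \<in> carrier R \<Longrightarrow>
    (a \<oplus> b) \<ominus> (c \<oplus> d) = (a \<ominus> c) \<oplus> (b \<ominus> d)"
  by (simp add: a_minus_def minus_add a_ac)

lemma koszul_d_add:
  assumes "\<And>b. f b \<in> carrier R" "\<And>b. g b \<in> carrier R" "set xs \<subseteq> carrier R"
  shows "koszul_d xs (\<lambda>b. f b \<oplus> g b) b = koszul_d xs f b \<oplus> koszul_d xs g b"
  using assms
  by (induct xs f b arbitrary: g rule: koszul_d.induct)
    (auto simp: r_distr minus_add_minus koszul_d_closed)

lemma koszul_d_smult:
  assumes "\<And>b. f b \<in> carrier R" "r \<in> carrier R" "set xs \<subseteq> carrier R"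
  shows "koszul_d xs (\<lambda>b. r \<otimes> f b) b = r \<otimes> koszul_d xs f b"
  using assms
  by (induct xs f b rule: koszul_d.induct)
    (auto simp: a_minus_def r_distr r_minus m_lcomm koszul_d_closed)

lemma koszul_d_uminus:
  assumes "\<And>b. f b \<in> carrier R" "set xs \<subseteq> carrier R"
  shows "koszul_d xs (\<lambda>b. \<ominus> f b) b = \<ominus> koszul_d xs f b"
  using koszul_d_smult[of f "\<ominus> \<one>" xs b] assms koszul_d_closed[of f xs b] by (simp add: l_minus)

lemma koszul_d_minus:
  assumes "\<And>b. f b \<in> carrier R" "\<And>b. g b \<in> carrier R" "set xs \<subseteq> carrier R"
  shows "koszul_d xs (\<lambda>b. f b \<ominus> g b) b = koszul_d xs f b \<ominus> koszul_d xs g b"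
  using koszul_d_add[of f "\<lambda>b. \<ominus> g b" xs b] koszul_d_uminus[of g xs b] assms by (simp add: a_minus_def)

lemma koszul_d_zero:
  assumes "set xs \<subseteq> carrier R" shows "koszul_d xs (\<lambda>b. \<zero>) b = \<zero>"
  using koszul_d_smult[of "\<lambda>_. \<zero>" \<zero> xs b] assms koszul_d_closed[of "\<lambda>_. \<zero>" xs b] by simp

lemma koszul_h_minus:
  assumes "\<And>b. f b \<in> carrier R" "\<And>b. g b \<in> carrier R"
  shows "koszul_h xs j (\<lambda>b. f b \<ominus> g b) b = koszul_h xs j f b \<ominus> koszul_h xs j g b"
  using assms
  by (induct xs j f b arbitrary: g rule: koszul_h.induct)
    (auto simp: a_minus_def minus_add koszul_h_closed)

lemma koszul_h_smult:
  assumes "\<And>b. f b \<in> carrier R" "r \<in> carrier R"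
  shows "koszul_h xs j (\<lambda>b. r \<otimes> f b) b = r \<otimes> koszul_h xs j f b"
  using assms
  by (induct xs j f b rule: koszul_h.induct) (auto simp: r_minus koszul_h_closed)

lemma koszul_d_d:
  assumes "\<And>b. f b \<in> carrier R" "set xs \<subseteq> carrier R"
  shows "koszul_d xs (koszul_d xs f) b = \<zero>"
  using assms
proof (induct xs f b rule: koszul_d.induct)
  case (1 x xs f b)
  \<comment> \<open>On a word starting with \<open>True\<close>, \<open>p\<close> is
    \<open>x\<close> times the differential of the unmarked part, and the inner
    \<open>\<zero>\<close> is the double differential of the marked part.\<close>
  have "p \<ominus> (p \<ominus> \<zero>) = \<zero>" if "p \<in> carrier R" for p using that by algebra
  then show ?case using 1 by (simp add: koszul_d_minus koszul_d_smult koszul_d_closed)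
qed auto

text \<open>For the first element the mapping cone gives the identity directly. For a later element
  both operators change sign on the marked half, so the identity for the tail is inherited
  there.\<close>

lemma koszul_homotopy:
  assumes "\<And>b. f b \<in> carrier R" "set xs \<subseteq> carrier R" "j < length xs" "length b = length xs"
  shows "koszul_d xs (koszul_h xs j f) b \<oplus> koszul_h xs j (koszul_d xs f) b = xs ! j \<otimes> f b"
  using assms
proof (induct xs j f b rule: koszul_h.induct)
  case (1 x xs f b)
  then show ?case using koszul_d_zero[of xs b] by (simp add: a_minus_def)
next
  case (2 x xs f b)
  then show ?case using koszul_d_closed[of "\<lambda>b. f (True # b)" xs b] by (simp add: a_minus_def a_lcomm r_neg)
next
  case (3 x xs j f b)
  \<comment> \<open>The cross term \<open>p\<close>, the first element times the contraction of the
    unmarked part, cancels; \<open>q\<close> and \<open>r\<close> are the two summands for the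
    tail.\<close>
  have *: "(p \<ominus> \<ominus> q) \<oplus> \<ominus> (p \<ominus> r) = q \<oplus> r" if "p \<in> carrier R" "q \<in> carrier R" "r \<in> carrier R" for p q r
    using that by algebra
  show ?case
    using 3 by (simp add: koszul_d_uminus koszul_h_minus koszul_h_smult koszul_h_closed koszul_d_closed *)
qed auto

lemma koszul_d_support:
  assumes "\<And>b. f b \<noteq> \<zero> \<Longrightarrow> b \<in> koszul_basis (length xs) k" "\<And>b. f b \<in> carrier R" "set xs \<subseteq> carrier R"
    "koszul_d xs f b \<noteq> \<zero>"
  shows "b \<in> koszul_basis (length xs) (k + 1)"
  using assms
proof (induct xs arbitrary: f b k)
  case (Cons x xs)
  obtain a c where b: "b = a # c" using Cons.prems(4) by (cases b) auto
  \<comment> \<open>Dropping a leading mark lowers the degree by one, dropping an unmarked letter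
    does not.\<close>
  have IH: "c \<in> koszul_basis (length xs) ((if a then k - 1 else k) + 1)"
    if "koszul_d xs (\<lambda>b. f (a # b)) c \<noteq> \<zero>"
  proof (rule Cons.hyps[OF _ _ _ that])
    show "b \<in> koszul_basis (length xs) (if a then k - 1 else k)" if "f (a # b) \<noteq> \<zero>" for b
      using Cons.prems(1)[OF that] by (auto simp: koszul_basis_def)
  qed (use Cons.prems in auto)
  show ?case
  proof (cases "koszul_d xs (\<lambda>b. f (a # b)) c \<noteq> \<zero>")
    case True
    then show ?thesis using IH unfolding b by (auto simp: koszul_basis_def)
  next
    case False
    then have a: "a" and "x \<otimes> f (False # c) \<noteq> \<zero>" using Cons.prems b by (cases a; simp add: a_minus_def)+
    then have "f (False # c) \<noteq> \<zero>" using Cons.prems by auto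
    then show ?thesis using Cons.prems(1)[of "False # c"] a unfolding b by (auto simp: koszul_basis_def)
  qed
qed simp

lemma koszul_h_support:
  assumes "\<And>b. f b \<noteq> \<zero> \<Longrightarrow> b \<in> koszul_basis (length xs) k" "\<And>b. f b \<in> carrier R"
    "koszul_h xs j f b \<noteq> \<zero>"
  shows "b \<in> koszul_basis (length xs) (k - 1)"
  using assms
proof (induct xs arbitrary: f b k j)
  case (Cons x xs)
  obtain a c where b: "b = a # c" using Cons.prems(3) by (cases b) auto
  show ?case
  proof (cases j)
    case 0
    then show ?thesis using Cons.prems(1)[of "True # c"] Cons.prems(3) unfolding b
      by (cases a) (auto simp: koszul_basis_def)
  next
    case (Suc i)
    have "koszul_h xs i (\<lambda>b. f (a # b)) c \<noteq> \<zero>" using Cons.prems(3) Suc b by (cases a) auto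
    then have "c \<in> koszul_basis (length xs) ((if a then k - 1 else k) - 1)"
    proof (rule Cons.hyps[rotated 2])
      show "b \<in> koszul_basis (length xs) (if a then k - 1 else k)" if "f (a # b) \<noteq> \<zero>" for b
        using Cons.prems(1)[OF that] by (auto simp: koszul_basis_def)
    qed (use Cons.prems in auto)
    then show ?thesis unfolding b by (auto simp: koszul_basis_def)
  qed
qed simp

lemma koszul_d_linear:
  assumes "set xs \<subseteq> carrier R"
  shows "koszul_d xs \<in> linear_maps R (koszul_module xs k) (koszul_module xs (k + 1))"
proof (rule linear_mapsI)
  fix f assume "f \<in> carrier (koszul_module xs k)"
  then show "koszul_d xs f \<in> carrier (koszul_module xs (k + 1))"
    using koszul_d_closed[of f xs] koszul_d_support[of f xs k] assms unfolding koszul_module_carrier by blast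
qed (use assms in \<open>auto simp: koszul_module_carrier fun_eq_iff koszul_d_add koszul_d_smult\<close>)

text \<open>On a cocycle the homotopy identity reduces to \<open>d (h f) = x f\<close>; hence the
  generators kill the Koszul cohomology.\<close>

lemma koszul_cocycle_annihilated:
  assumes xs: "set xs \<subseteq> carrier R" and f: "f \<in> carrier (koszul_module xs k)"
    and z: "koszul_d xs f = (\<lambda>b. \<zero>)" and x: "x \<in> set xs"
  shows "(\<lambda>b. x \<otimes> f b) \<in> koszul_d xs ` carrier (koszul_module xs (k - 1))"
proof -
  obtain j where j: "j < length xs" "x = xs ! j" using x by (auto simp: in_set_conv_nth)
  have fc: "f b \<in> carrier R" for b using f unfolding koszul_module_carrier by blast
  have h: "koszul_h xs j f \<in> carrier (koszul_module xs (k - 1))"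
    using koszul_h_closed[of f xs j] koszul_h_support[of f xs k j] f unfolding koszul_module_carrier by blast
  have "koszul_d xs (koszul_h xs j f) b = x \<otimes> f b" for b
  proof (cases "length b = length xs")
    case True
    have "koszul_h xs j (\<lambda>b. \<zero>) b = \<zero>"
      using koszul_h_smult[of "\<lambda>_. \<zero>" \<zero> xs j b] koszul_h_closed[of "\<lambda>_. \<zero>" xs j b] by simp
    moreover have "koszul_d xs (koszul_h xs j f) b \<in> carrier R"
      using koszul_h_closed[of f xs j] fc xs by (intro koszul_d_closed) auto
    ultimately show ?thesis using koszul_homotopy[of f xs j b] fc xs j True by (simp add: z)
  next
    case False
    then have "b \<notin> koszul_basis (length xs) k" for k by (simp add: koszul_basis_def)
    then show ?thesis
      using linear_map_closed[OF koszul_d_linear[OF xs] h] f xs x unfolding koszul_module_carrier by auto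
  qed
  then have "(\<lambda>b. x \<otimes> f b) = koszul_d xs (koszul_h xs j f)" by auto
  then show ?thesis using h by blast
qed

lemma koszul_d_in_ideal:
  assumes "ideal I R" "set xs \<subseteq> I" "\<And>b. f b \<in> carrier R"
  shows "koszul_d xs f b \<in> I"
  using assms(2,3)
proof (induct xs arbitrary: f b)
  interpret I: ideal I R by fact
  {
    case Nil
    then show ?case using I.a_subgroup by (simp add: I.zero_closed)
  next
    case (Cons x xs)
    show ?case
    proof (cases b)
      case b: (Cons a c)
      have "koszul_d xs (\<lambda>b. f (a # b)) c \<in> I" using Cons.prems by (intro Cons.hyps) auto
      then show ?thesis using Cons.prems unfolding b
        by (cases a) (auto simp: a_minus_def intro!: I.a_closed I.a_inv_closed I.I_r_closed)
    qed simp
  }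
qed

text \<open>Being an ideal, the annihilator of an element contains the ideal generated by
  \<open>xs\<close> as soon as it contains \<open>xs\<close>.\<close>

lemma module_annihilator_ideal:
  assumes N: "module R N" and n: "n \<in> carrier N"
  shows "ideal {a \<in> carrier R. a \<odot>\<^bsub>N\<^esub> n = \<zero>\<^bsub>N\<^esub>} R"
proof -
  interpret N: module R N by fact
  show ?thesis
  proof (rule idealI)
    show "subgroup {a \<in> carrier R. a \<odot>\<^bsub>N\<^esub> n = \<zero>\<^bsub>N\<^esub>} (add_monoid R)"
    proof (rule group.subgroupI)
      show "group (add_monoid R)" by (rule a_group)
      show "inv\<^bsub>add_monoid R\<^esub> a \<in> {a \<in> carrier R. a \<odot>\<^bsub>N\<^esub> n = \<zero>\<^bsub>N\<^esub>}"
        if "a \<in> {a \<in> carrier R. a \<odot>\<^bsub>N\<^esub> n = \<zero>\<^bsub>N\<^esub>}" for a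
        using that n N.smult_l_minus[of a n] by (simp add: a_inv_def[symmetric])
    qed (use n in \<open>auto simp: N.smult_l_distr\<close>)
    show "x \<otimes> a \<in> {a \<in> carrier R. a \<odot>\<^bsub>N\<^esub> n = \<zero>\<^bsub>N\<^esub>}"
      if "a \<in> {a \<in> carrier R. a \<odot>\<^bsub>N\<^esub> n = \<zero>\<^bsub>N\<^esub>}" "x \<in> carrier R" for a x
      using that n by (auto simp: N.smult_assoc1)
    then show "a \<otimes> x \<in> {a \<in> carrier R. a \<odot>\<^bsub>N\<^esub> n = \<zero>\<^bsub>N\<^esub>}"
      if "a \<in> {a \<in> carrier R. a \<odot>\<^bsub>N\<^esub> n = \<zero>\<^bsub>N\<^esub>}" "x \<in> carrier R" for a x
      using that by (simp add: m_comm[of a x])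
  qed (rule ring_axioms)
qed

definition koszul_exact :: "'a list \<Rightarrow> int \<Rightarrow> bool"
  where "koszul_exact xs k \<longleftrightarrow>
    koszul_d xs ` carrier (koszul_module xs (k - 1)) =
      {f \<in> carrier (koszul_module xs k). koszul_d xs f = (\<lambda>b. \<zero>)}"

lemma koszul_image_subset:
  assumes "set xs \<subseteq> carrier R"
  shows "koszul_d xs ` carrier (koszul_module xs (k - 1)) \<subseteq>
      {f \<in> carrier (koszul_module xs k). koszul_d xs f = (\<lambda>b. \<zero>)}"
  using linear_map_closed[OF koszul_d_linear[OF assms, of "k - 1"]] koszul_d_d[OF _ assms]
  by (auto simp: koszul_module_carrier)

lemma koszul_exact_negative:
  assumes xs: "set xs \<subseteq> carrier R" and "k < 0"
  shows "koszul_exact xs k"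
proof -
  have "koszul_d xs (\<lambda>b. \<zero>) = (\<lambda>b. \<zero>)" using koszul_d_zero[OF xs] by auto
  then show ?thesis using assms(2) unfolding koszul_exact_def
    by (auto simp: koszul_basis_empty free_module_empty[OF is_cring])
qed

text \<open>
  Vanishing of \<open>Ext\<close> up to degree \<open>d\<close> forces the Koszul cohomology to vanish up to degree \<open>d\<close>:
  exactness below \<open>k\<close> resolves the boundaries in degree \<open>k\<close> by free modules, so
  \<open>Hom(R/I, H\<^sup>k)\<close> vanishes by dimension shifting; but \<open>H\<^sup>k\<close> is killed by \<open>I\<close>.
\<close>

lemma koszul_exact_of_cohomology_vanishes:
  assumes xs: "set xs \<subseteq> carrier R"
    and res: "proj_resolution R P \<delta> \<epsilon> (quotient_module (regular_module R) (genideal R (set xs)))"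
    and van: "\<And>i. i \<le> d \<Longrightarrow> cohomology_vanishes R P \<delta> (regular_module R) i"
    and k: "k \<le> d"
  shows "koszul_exact xs (int k)"
  using k
proof (induct k rule: less_induct)
  case (less k)
  let ?I = "genideal R (set xs)"
  have I: "ideal ?I R" by (rule genideal_ideal[OF xs])
  interpret proj_resolution R P \<delta> \<epsilon> "quotient_module (regular_module R) ?I" by fact
  let ?K = "koszul_module xs" and ?d = "koszul_d xs"
  define B where "B j = ?d ` carrier (?K (j - 1))" for j
  have mK: "module R (?K j)" for j by (rule module_free_module)
  have dl: "?d \<in> linear_maps R (?K (j - 1)) (?K j)" for j using koszul_d_linear[OF xs, of "j - 1"] by simp
  have Bsub: "B j \<subseteq> carrier (?K j)" for j unfolding B_def using linear_map_closed[OF dl] by blast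
  have mB: "module R (sub_module (?K j) (B j))" for j unfolding B_def by (rule module_image(2)[OF mK mK dl])
  have vK: "cohomology_vanishes R P \<delta> (?K j) i" if "i \<le> d" for i j
    by (rule cohomology_vanishes_finite_dual_basis[OF van[OF that] mK dual_basis_free_module finite_koszul_basis])
  \<comment> \<open>Each step along \<open>0 \<rightarrow> B j \<rightarrow> K j \<rightarrow> B
    (j+1) \<rightarrow> 0\<close> costs one cohomological degree, starting from
    \<open>B 0 = 0\<close>, where every degree vanishes. The bound \<open>Suc d\<close> is just
    enough for the final use with \<open>i = 1\<close> and \<open>j = k\<close>.\<close>
  have vB: "cohomology_vanishes R P \<delta> (sub_module (?K (int j)) (B (int j))) i"
    if "j \<le> k" "j = 0 \<or> i + j \<le> Suc d" for i j
    using that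
  proof (induct j arbitrary: i)
    case 0
    have "B 0 = {\<lambda>b. \<zero>}"
      using koszul_d_zero[OF xs]
      by (simp add: B_def koszul_basis_empty free_module_empty[OF is_cring] fun_eq_iff)
    then have z: "f x = (\<lambda>b. \<zero>)" if "f \<in> linear_maps R (P i) (sub_module (?K 0) (B 0))" "x \<in> carrier (P i)" for f x
      using linear_map_closed[OF that] by simp
    have "is_coboundary R P \<delta> (sub_module (?K 0) (B 0)) i f"
      if f: "is_cocycle R P \<delta> (sub_module (?K 0) (B 0)) i f" for f
    proof (cases i)
      case 0 then show ?thesis using z[OF is_cocycleD(1)[OF f]] by simp
    next
      case (Suc l)
      then show ?thesis using z[OF is_cocycleD(1)[OF f]] linear_maps_const_zero[OF mB[of 0], of "P l"]
        by (auto intro!: bexI[of _ "\<lambda>_ b. \<zero>"])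
    qed
    then show ?case by (simp add: cohomology_vanishes_def)
  next
    case (Suc j)
    have i: "i \<le> d" and j: "j < k" using Suc.prems by auto
    have ex: "B (int j) = {f \<in> carrier (?K (int j)). ?d f = (\<lambda>b. \<zero>)}"
      using less.hyps[OF j] j less.prems unfolding koszul_exact_def B_def by simp
    have Suc_j: "int (Suc j) - 1 = int j" by simp
    show ?case
    proof (rule cohomology_vanishes_quotient[where \<alpha> = "\<lambda>x. x" and \<beta> = ?d])
      show "module R (sub_module (?K (int j)) (B (int j)))" "module R (?K (int j))"
        "module R (sub_module (?K (int (Suc j))) (B (int (Suc j))))" by (rule mB mK)+
      show "(\<lambda>x. x) \<in> linear_maps R (sub_module (?K (int j)) (B (int j))) (?K (int j))"
        by (rule linear_maps_from_sub_module[OF linear_maps_id Bsub])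
      show "?d \<in> linear_maps R (?K (int j)) (sub_module (?K (int (Suc j))) (B (int (Suc j))))"
        using dl[of "int (Suc j)"] unfolding Suc_j
        by (rule linear_maps_sub_moduleI) (simp add: B_def Suc_j)
      show "?d ` carrier (?K (int j)) = carrier (sub_module (?K (int (Suc j))) (B (int (Suc j))))"
        by (simp add: B_def)
      show "cohomology_vanishes R P \<delta> (?K (int j)) i" by (rule vK[OF i])
      show "cohomology_vanishes R P \<delta> (sub_module (?K (int j)) (B (int j))) (Suc i)"
        using Suc.prems by (intro Suc.hyps) auto
    qed (auto simp: ex inj_on_def)
  qed
  let ?Z = "{f \<in> carrier (?K (int k)). ?d f = (\<lambda>b. \<zero>)}"
  let ?KZ = "sub_module (?K (int k)) ?Z"
  have dlk: "?d \<in> linear_maps R (?K (int k)) (?K (int k + 1))" by (rule koszul_d_linear[OF xs])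
  have mZ: "module R ?KZ" using module_kernel(2)[OF mK mK dlk] by simp
  have dZ: "?d \<in> linear_maps R (?K (int k - 1)) ?KZ"
    using koszul_image_subset[OF xs, of "int k"] by (intro linear_maps_sub_moduleI[OF dl]) blast
  have sB: "submodule (B (int k)) R ?KZ" unfolding B_def by (rule module_image(1)[OF mK mZ dZ])
  note q = quotient_module[OF mZ sB]
  let ?H = "quotient_module ?KZ (B (int k))"
  have BZ: "B (int k) \<subseteq> ?Z" using koszul_image_subset[OF xs, of "int k"] by (simp add: B_def)
  \<comment> \<open>\<open>H\<close> is the module of cocycles modulo \<open>B k\<close>. Cocycles
    inherit vanishing in degree \<open>0\<close> from the free module containing them, and
    \<open>B k\<close> contributes vanishing in degree \<open>1\<close>.\<close>
  have vH: "cohomology_vanishes R P \<delta> ?H 0"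
  proof (rule cohomology_vanishes_quotient[where \<alpha> = "\<lambda>x. x" and \<beta> = "\<lambda>x. B (int k) +>\<^bsub>?KZ\<^esub> x"])
    show "module R (sub_module (?K (int k)) (B (int k)))" by (rule mB)
    show "module R ?KZ" by (rule mZ)
    show "module R ?H" by (rule q(1))
    show "(\<lambda>x. x) \<in> linear_maps R (sub_module (?K (int k)) (B (int k))) ?KZ"
      using linear_maps_from_sub_module[OF linear_maps_id[of R ?KZ], of "B (int k)"] BZ by simp
    show "(\<lambda>x. B (int k) +>\<^bsub>?KZ\<^esub> x) \<in> linear_maps R ?KZ ?H" by (rule q(2))
    show "(\<lambda>x. B (int k) +>\<^bsub>?KZ\<^esub> x) ` carrier ?KZ = carrier ?H" by (rule q(3))
    show "(\<lambda>x. x) ` carrier (sub_module (?K (int k)) (B (int k))) =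
        {y \<in> carrier ?KZ. B (int k) +>\<^bsub>?KZ\<^esub> y = \<zero>\<^bsub>?H\<^esub>}" using q(4) BZ by auto
    have "(\<lambda>x. x) \<in> linear_maps R ?KZ (?K (int k))"
      by (rule linear_maps_from_sub_module[OF linear_maps_id]) auto
    then show "cohomology_vanishes R P \<delta> ?KZ 0"
      by (rule cohomology_0_vanishes_sub[OF mZ mK _ _ vK]) auto
    show "cohomology_vanishes R P \<delta> (sub_module (?K (int k)) (B (int k))) (Suc 0)"
      using less.prems by (intro vB) auto
  qed auto
  have "z \<in> B (int k)" if z: "z \<in> ?Z" for z
  proof -
    have zK: "z \<in> carrier ?KZ" using z by simp
    let ?z = "B (int k) +>\<^bsub>?KZ\<^esub> z"
    have zH: "?z \<in> carrier ?H" using linear_map_closed[OF q(2) zK] .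
    have "set xs \<subseteq> {a \<in> carrier R. a \<odot>\<^bsub>?H\<^esub> ?z = \<zero>\<^bsub>?H\<^esub>}"
    proof
      fix x assume x: "x \<in> set xs"
      have xz: "(\<lambda>b. x \<otimes> z b) \<in> B (int k)"
        using koszul_cocycle_annihilated[OF xs _ _ x] z unfolding B_def by blast
      have "x \<odot>\<^bsub>?H\<^esub> ?z = B (int k) +>\<^bsub>?KZ\<^esub> (x \<odot>\<^bsub>?KZ\<^esub> z)"
        using linear_map_smult[OF q(2) _ zK, of x] x xs by auto
      also have "\<dots> = \<zero>\<^bsub>?H\<^esub>" using q(4)[of "x \<odot>\<^bsub>?KZ\<^esub> z"] xz BZ by auto
      finally show "x \<in> {a \<in> carrier R. a \<odot>\<^bsub>?H\<^esub> ?z = \<zero>\<^bsub>?H\<^esub>}" using x xs by blast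
    qed
    then have "?I \<subseteq> {a \<in> carrier R. a \<odot>\<^bsub>?H\<^esub> ?z = \<zero>\<^bsub>?H\<^esub>}"
      by (rule genideal_minimal[OF module_annihilator_ideal[OF q(1) zH]])
    then have "?z = \<zero>\<^bsub>?H\<^esub>" by (intro cohomology_0_torsion[OF I res q(1) vH zH]) blast
    then show ?thesis using q(4)[OF zK] by simp
  qed
  then show ?case using BZ unfolding koszul_exact_def B_def by blast
qed

text \<open>The fully marked basis element is a cocycle for lack of a higher degree. Exactness makes
  it a boundary, and coefficients of boundaries lie in the ideal.\<close>

lemma koszul_exact_top:
  assumes xs: "set xs \<subseteq> carrier R" and ex: "koszul_exact xs (int (length xs))"
  shows "\<one> \<in> genideal R (set xs)"
proof -
  let ?t = "replicate (length xs) True"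
  have t: "?t \<in> koszul_basis (length xs) (int (length xs))"
    by (induct xs) (auto simp: koszul_basis_def)
  have f: "free_basis ?t \<in> carrier (koszul_module xs (int (length xs)))" by (rule free_basis_carrier[OF t])
  have "koszul_d xs (free_basis ?t) = (\<lambda>b. \<zero>)"
    using linear_map_closed[OF koszul_d_linear[OF xs] f]
    by (simp add: koszul_basis_empty free_module_empty[OF is_cring])
  then obtain g where g: "g \<in> carrier (koszul_module xs (int (length xs) - 1))"
    "free_basis ?t = koszul_d xs g" using ex f unfolding koszul_exact_def by blast
  have "koszul_d xs g ?t \<in> genideal R (set xs)"
    using g(1) genideal_self[OF xs]
    by (intro koszul_d_in_ideal[OF genideal_ideal[OF xs]]) (auto simp: koszul_module_carrier)
  then show ?thesis using fun_cong[OF g(2), of ?t] by simp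
qed

text \<open>Unrestricted vanishing permits the bound to be the number of generators, which is the
  top Koszul degree.\<close>

lemma cohomology_vanishes_imp_unit_ideal:
  assumes xs: "set xs \<subseteq> carrier R"
    and res: "proj_resolution R P \<delta> \<epsilon> (quotient_module (regular_module R) (genideal R (set xs)))"
    and van: "\<And>i. cohomology_vanishes R P \<delta> (regular_module R) i"
  shows "\<one> \<in> genideal R (set xs)"
  by (rule koszul_exact_top[OF xs koszul_exact_of_cohomology_vanishes[OF xs res van order_refl]])

end


section \<open>Projective dimension and the criterion\<close>

context proj_resolution begin

text \<open>Serves to replace a cokernel by a copy in \<open>'a list\<close>, where
  \<open>fPD\<close> sees it.\<close>

lemma resolution_of_isomorphic:
  assumes M': "module R M'" and \<phi>: "\<phi> \<in> linear_maps R M M'" "inj_on \<phi> (carrier M)" "\<phi> ` carrier M = carrier M'"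
  shows "proj_resolution R P \<delta> (\<lambda>x. \<phi> (\<epsilon> x)) M'"
proof -
  interpret M: module R M by (rule module_M)
  have "\<phi> (\<epsilon> x) = \<zero>\<^bsub>M'\<^esub> \<longleftrightarrow> \<epsilon> x = \<zero>\<^bsub>M\<^esub>" if "x \<in> carrier (P 0)" for x
    using linear_map_zero[OF module_M M' \<phi>(1)] inj_onD[OF \<phi>(2), of "\<epsilon> x" "\<zero>\<^bsub>M\<^esub>"]
      linear_map_closed[OF augmentation_linear that] by auto
  moreover have "(\<lambda>x. \<phi> (\<epsilon> x)) ` carrier (P 0) = carrier M'"
    using augmentation_surj \<phi>(3) by (metis image_image)
  ultimately show ?thesis
    using projective d_linear linear_maps_comp[OF augmentation_linear \<phi>(1)] d_image_0 d_image_Suc M'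
    by (auto simp: proj_resolution_def projective_resolution_def a_kernel_def' cong: conj_cong)
qed

text \<open>Serves to bring the terms of a resolution into the auxiliary type demanded by
  \<open>has_finite_projective_resolution\<close>.\<close>

lemma resolution_transport:
  assumes J: "\<And>i. inj_on (J i) (carrier (P i))"
  shows "proj_resolution R (\<lambda>i. transport_module (J i) (P i))
    (\<lambda>i y. J i (\<delta> i (inv_into (carrier (P (Suc i))) (J (Suc i)) y)))
    (\<lambda>y. \<epsilon> (inv_into (carrier (P 0)) (J 0) y)) M"
    (is "proj_resolution R ?T ?d ?e M")
proof -
  let ?J' = "\<lambda>i. inv_into (carrier (P i)) (J i)"
  note t = transport_module[OF module_P J]
  have J'J [simp]: "?J' i (J i x) = x" if "x \<in> carrier (P i)" for i x using J that by simp
  have zero: "\<zero>\<^bsub>?T i\<^esub> = J i \<zero>\<^bsub>P i\<^esub>" for i by (simp add: transport_module_def)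
  have zP: "\<zero>\<^bsub>P i\<^esub> \<in> carrier (P i)" for i
    using module.axioms(2)[OF module_P] abelian_group.axioms(1) abelian_monoid.zero_closed by metis
  have Jz: "J i x = J i \<zero>\<^bsub>P i\<^esub> \<longleftrightarrow> x = \<zero>\<^bsub>P i\<^esub>" if "x \<in> carrier (P i)" for i x
    using inj_onD[OF J _ that zP] by auto
  have img: "?d i ` carrier (?T (Suc i)) = J i ` \<delta> i ` carrier (P (Suc i))" for i
    by (force simp: image_iff)
  show ?thesis
    unfolding proj_resolution_def projective_resolution_def
  proof (intro conjI allI module_M)
    show "projective_module R (?T i)" for i
      by (rule projective_retract[OF projective t(1) t(3,2)]) (auto simp: f_inv_into_f)
    show "?d i \<in> linear_maps R (?T (Suc i)) (?T i)" for i
      by (rule linear_maps_comp[OF linear_maps_comp[OF t(3) d_linear] t(2)])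
    show "?e \<in> linear_maps R (?T 0) M" by (rule linear_maps_comp[OF t(3) augmentation_linear])
    show "?e ` carrier (?T 0) = carrier M" using augmentation_surj by (simp add: image_image)
    show "?d 0 ` carrier (?T 1) = a_kernel (?T 0) M ?e"
      unfolding One_nat_def img d_image_0 by (auto simp: a_kernel_def')
    show "?d (Suc i) ` carrier (?T (Suc (Suc i))) = a_kernel (?T (Suc i)) (?T i) (?d i)" for i
      unfolding img d_image_Suc by (auto simp: a_kernel_def' zero Jz)
  qed
qed

lemma is_coboundary_finsum:
  assumes N: "module R N" and S: "finite S" and f: "\<And>s. s \<in> S \<Longrightarrow> is_coboundary R P \<delta> N i (f s)"
    and cl: "\<And>s x. s \<in> S \<Longrightarrow> x \<in> carrier (P i) \<Longrightarrow> f s x \<in> carrier N"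
  shows "is_coboundary R P \<delta> N i (\<lambda>x. finsum N (\<lambda>s. f s x) S)"
  using S f cl
proof (induct S)
  interpret N: module R N by fact
  {
    case empty
    have "is_coboundary R P \<delta> N i (\<lambda>x. \<zero>\<^bsub>N\<^esub>)"
      using linear_maps_const_zero[OF N] by (cases i) (auto intro: bexI[of _ "\<lambda>_. \<zero>\<^bsub>N\<^esub>"])
    then show ?case by simp
  next
    case (insert a S)
    have "is_coboundary R P \<delta> N i (\<lambda>x. f a x \<oplus>\<^bsub>N\<^esub> finsum N (\<lambda>s. f s x) S)"
      using insert by (intro is_coboundary_add[OF N]) auto
    then show ?case
      by (subst is_coboundary_cong[of P i _ "\<lambda>x. f a x \<oplus>\<^bsub>N\<^esub> finsum N (\<lambda>s. f s x) S"])
        (use insert in \<open>auto intro!: N.M.finsum_insert\<close>)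
  }
qed

end

section \<open>From the bound on \<open>fPD\<close> to unit ideals\<close>

lemma (in cring) finsum_in_ideal:
  assumes "ideal I R" "finite A" "\<And>a. a \<in> A \<Longrightarrow> f a \<in> I"
  shows "finsum R f A \<in> I"
  using assms(2,3)
proof (induct A)
  interpret I: ideal I R by fact
  {
    case empty then show ?case by (simp add: I.zero_closed)
  next
    case (insert a A)
    then have "f \<in> A \<rightarrow> carrier R" "f a \<in> carrier R" using I.Icarr by auto
    then show ?case using insert I.a_closed by simp
  }
qed

text \<open>Expanding \<open>y\<close> in the standard basis writes \<open>\<phi> y\<close> as a
  combination of the entries of \<open>y\<close>.\<close>

lemma (in cring) linear_functional_in_ideal:
  assumes I: "ideal I R" and X: "finite X" and y: "y \<in> carrier (free_module R X)" "\<And>b. y b \<in> I"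
    and \<phi>: "\<phi> \<in> linear_maps R (free_module R X) (regular_module R)"
  shows "\<phi> y \<in> I"
proof -
  interpret I: ideal I R by fact
  note d = dual_basis_free_module[of X] and F = module_free_module[of X]
  interpret F: module R "free_module R X" by (rule F)
  interpret r: module R "regular_module R" by (rule module_regular)
  have yc: "y b \<in> carrier R" for b using y(2) I.Icarr by blast
  have e: "free_basis b \<in> carrier (free_module R X)" if "b \<in> X" for b by (rule free_basis_carrier[OF that])
  have fin: "finsum (regular_module R) g X = finsum R g X" for g
    by (simp add: finsum_def finprod_def regular_module_def)
  have "y = finsum (free_module R X) (\<lambda>b. y b \<odot>\<^bsub>free_module R X\<^esub> free_basis b) X"
    by (rule finite_dual_basis[OF F d X y(1)])
  then have "\<phi> y = \<phi> (finsum (free_module R X) (\<lambda>b. y b \<odot>\<^bsub>free_module R X\<^esub> free_basis b) X)" by simp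
  also have "\<dots> = finsum R (\<lambda>b. \<phi> (y b \<odot>\<^bsub>free_module R X\<^esub> free_basis b)) X"
    unfolding fin[symmetric]
    by (rule linear_map_finsum[OF F module_regular \<phi> _ X]) (intro Pi_I F.smult_closed yc e)
  also have "\<dots> \<in> I"
  proof (rule finsum_in_ideal[OF I X])
    fix b assume b: "b \<in> X"
    have "\<phi> (y b \<odot>\<^bsub>free_module R X\<^esub> free_basis b) = y b \<otimes> \<phi> (free_basis b)"
      using linear_map_smult[OF \<phi> yc e[OF b]] by simp
    then show "\<phi> (y b \<odot>\<^bsub>free_module R X\<^esub> free_basis b) \<in> I"
      using I.I_r_closed[OF y(2)] linear_map_closed[OF \<phi> e[OF b]] by simp
  qed
  finally show ?thesis .
qed

text \<open>
  The dual Koszul complex truncated at degree \<open>Suc d\<close> is a finite free resolution of length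
  \<open>Suc d\<close>. If its cokernel has projective dimension at most \<open>d\<close>, then the first map \<open>R \<rightarrow> R\<^sup>n\<close>,
  which is given by the generators of \<open>I\<close>, is split injective.
\<close>

lemma (in cring) unit_ideal_of_fPD_le:
  assumes fPD: "fPD R \<le> enat d" and xs: "set xs \<subseteq> carrier R"
    and ex: "\<And>k. k \<le> d \<Longrightarrow> koszul_exact xs (int k)"
  shows "\<one> \<in> genideal R (set xs)"
proof -
  let ?K = "koszul_module xs" and ?d = "koszul_d xs"
  \<comment> \<open>Cohomological degrees are reversed: \<open>P (Suc d)\<close> is the Koszul term
    of degree \<open>0\<close>, and beyond it the degrees are negative and the modules zero.\<close>
  define P where "P j = ?K (int (Suc d) - int j)" for j
  have mP: "module R (P j)" for j unfolding P_def by (rule module_free_module)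
  have pP: "projective_module R (P j)" for j
    unfolding P_def by (rule dual_basis_projective[OF module_free_module dual_basis_free_module])
  have fgP: "fg_module R (P j)" for j
    unfolding P_def by (rule finite_dual_basis_fg[OF module_free_module dual_basis_free_module finite_koszul_basis])
  have dP: "?d \<in> linear_maps R (P (Suc j)) (P j)" for j
  proof -
    have "int (Suc d) - int (Suc j) + 1 = int (Suc d) - int j" by simp
    then show ?thesis using koszul_d_linear[OF xs, of "int (Suc d) - int (Suc j)"] unfolding P_def by metis
  qed
  have tP: "trivial_module (P i)" if "i > Suc d" for i
    using that by (simp add: P_def trivial_module_def koszul_basis_empty free_module_empty[OF is_cring])
  let ?B = "?d ` carrier (P (Suc 0))"
  let ?C = "quotient_module (P 0) ?B"
  let ?\<pi> = "\<lambda>x. ?B +>\<^bsub>P 0\<^esub> x"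
  have sB: "submodule ?B R (P 0)" by (rule module_image(1)[OF mP mP dP])
  note q = quotient_module[OF mP sB]
  have res: "proj_resolution R P (\<lambda>_. ?d) ?\<pi> ?C"
    unfolding proj_resolution_def projective_resolution_def
  proof (intro conjI allI pP dP q(1-3))
    show "?d ` carrier (P 1) = a_kernel (P 0) ?C ?\<pi>"
      using q(4) linear_map_closed[OF dP[of 0]] by (auto simp: a_kernel_def')
    show "?d ` carrier (P (Suc (Suc i))) = a_kernel (P (Suc i)) (P i) ?d" for i
    proof -
      \<comment> \<open>Exactness at \<open>P (Suc i)\<close> is Koszul exactness in degree
        \<open>d - i\<close>: given for \<open>i \<le> d\<close>, and automatic in the negative
        degrees beyond.\<close>
      have "koszul_exact xs (int d - int i)"
      proof (cases "i \<le> d")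
        case True
        then show ?thesis using ex[of "d - i"] by (simp add: of_nat_diff)
      next
        case False
        then show ?thesis by (intro koszul_exact_negative[OF xs]) simp
      qed
      moreover have "P (Suc (Suc i)) = ?K (int d - int i - 1)" "P (Suc i) = ?K (int d - int i)"
        by (simp_all add: P_def algebra_simps)
      ultimately show ?thesis by (simp add: koszul_exact_def a_kernel_def' P_def)
    qed
  qed
  interpret P: proj_resolution R P "\<lambda>_. ?d" ?\<pi> ?C by (rule res)
  have fgC: "fg_module R ?C" by (rule fg_module_surj[OF mP q(1) fgP q(2,3)])
  obtain L :: "(bool list \<Rightarrow> 'a) set \<Rightarrow> 'a list" where L: "inj_on L (carrier ?C)"
    using fg_module_inj_list[OF q(1) fgC] by blast
  let ?C' = "transport_module L ?C"
  note tC = transport_module[OF q(1) L]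
  \<comment> \<open>Elements are coded as lists over \<open>'a\<close> and then padded with empty
    lists to match the auxiliary type.\<close>
  have "\<exists>J :: (bool list \<Rightarrow> 'a) \<Rightarrow> ('a \<times> 'a list) list. inj_on J (carrier (P i))" for i
  proof -
    obtain J :: "(bool list \<Rightarrow> 'a) \<Rightarrow> 'a list" where J: "inj_on J (carrier (P i))"
      using fg_module_inj_list[OF mP fgP] by blast
    have "inj (map (\<lambda>a :: 'a. (a, [] :: 'a list)))" by (intro inj_mapI) (simp add: inj_def)
    then have "inj_on (\<lambda>x. map (\<lambda>a. (a, [])) (J x)) (carrier (P i))"
      using J by (auto simp: inj_on_def)
    then show ?thesis by blast
  qed
  then obtain J :: "nat \<Rightarrow> (bool list \<Rightarrow> 'a) \<Rightarrow> ('a \<times> 'a list) list"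
    where J: "\<And>i. inj_on (J i) (carrier (P i))" by metis
  note tP' = transport_module[OF mP J]
  have "proj_resolution R P (\<lambda>_. ?d) (\<lambda>x. L (?\<pi> x)) ?C'"
    by (rule P.resolution_of_isomorphic[OF tC(1,2) L]) simp
  then interpret P': proj_resolution R P "\<lambda>_. ?d" "\<lambda>x. L (?\<pi> x)" ?C' .
  have "has_finite_projective_resolution R ?C'"
    unfolding has_finite_projective_resolution_def
  proof (intro exI conjI allI impI)
    show "projective_resolution R (\<lambda>i. transport_module (J i) (P i))
      (\<lambda>i y. J i (?d (inv_into (carrier (P (Suc i))) (J (Suc i)) y)))
      (\<lambda>y. L (?\<pi> (inv_into (carrier (P 0)) (J 0) y))) ?C'"
      using P'.resolution_transport[OF J] by (simp add: proj_resolution_def)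
    show "trivial_module (transport_module (J i) (P i))" if "Suc d < i" for i
      using tP[OF that] by (simp add: trivial_module_def transport_module_def)
    show "fg_module R (transport_module (J i) (P i))" for i
      by (rule fg_module_surj[OF mP tP'(1) fgP tP'(2)]) simp
  qed
  then have "proj_dim R ?C' \<le> fPD R" using tC(1) unfolding fPD_def by (intro Sup_upper) blast
  \<comment> \<open>The strict inequality yields an actual resolution of some length
    \<open>n \<le> d\<close>, whose term in degree \<open>Suc d\<close> is zero.\<close>
  then have "proj_dim R ?C' < enat (Suc d)" using fPD by (meson enat_ord_simps(2) lessI order.strict_trans1 order_trans)
  then obtain n where n: "n < Suc d" "has_projective_resolution_of_length R ?C' n"
    unfolding proj_dim_def Inf_less_iff by auto
  then obtain Q :: "nat \<Rightarrow> ('a, 'a list) aux_module" and \<gamma> \<eta>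
    where Q: "projective_resolution R Q \<gamma> \<eta> ?C'" "\<forall>i>n. trivial_module (Q i)"
    unfolding has_projective_resolution_of_length_def by blast
  have "proj_resolution R Q \<gamma> \<eta> ?C'" using Q(1) tC(1) by (simp add: proj_resolution_def)
  then interpret Q: proj_resolution R Q \<gamma> \<eta> ?C' .
  have "trivial_module (Q (Suc d))" "trivial_module (P (Suc (Suc d)))" using Q(2) n(1) tP by auto
  then obtain s where s: "s \<in> linear_maps R (P d) (P (Suc d))" "\<And>x. x \<in> carrier (P (Suc d)) \<Longrightarrow> s (?d x) = x"
    using P'.top_differential_splits[OF \<open>proj_resolution R Q \<gamma> \<eta> ?C'\<close>] by blast
  \<comment> \<open>The only basis word of degree \<open>0\<close>. Its differential has entries in
    the ideal, and \<open>s\<close> sends that differential back to the basis element, whose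
    coefficient is \<open>1\<close>.\<close>
  let ?f = "replicate (length xs) False"
  have f: "?f \<in> koszul_basis (length xs) 0" by (induct xs) (auto simp: koszul_basis_def)
  have e: "free_basis ?f \<in> carrier (P (Suc d))" using free_basis_carrier[OF f] by (simp add: P_def)
  have I: "ideal (genideal R (set xs)) R" by (rule genideal_ideal[OF xs])
  have "s (?d (free_basis ?f)) ?f \<in> genideal R (set xs)"
  proof (rule linear_functional_in_ideal[where \<phi> = "\<lambda>y. s y ?f" and y = "?d (free_basis ?f)", OF I finite_koszul_basis])
    show "?d (free_basis ?f) \<in> carrier (?K 1)"
      using linear_map_closed[OF dP e] by (simp add: P_def)
    show "?d (free_basis ?f) b \<in> genideal R (set xs)" for b
      using genideal_self[OF xs] by (intro koszul_d_in_ideal[OF I]) auto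
    have "P d = ?K 1" by (simp add: P_def)
    then have "s \<in> linear_maps R (?K 1) (free_module R (koszul_basis (length xs) 0))" using s(1) by (simp add: P_def)
    then show "(\<lambda>y. s y ?f) \<in> linear_maps R (?K 1) (regular_module R)"
      by (rule linear_maps_comp[OF _ linear_maps_free_coordinate])
  qed
  then show ?thesis using s(2)[OF e] by simp
qed

text \<open>
  A constructive form of Nakayama's lemma for the cokernel of the dual of \<open>\<phi>\<close>: the summands of a
  dual basis are removed one at a time.
\<close>

lemma (in cring) split_of_local_splittings:
  assumes A: "module R A" and B: "module R B" and \<phi>: "\<phi> \<in> linear_maps R A B"
    and key: "\<And>e f. e \<in> carrier A \<Longrightarrow> f \<in> linear_maps R A (regular_module R) \<Longrightarrow>
      \<exists>\<psi>\<in>linear_maps R B (regular_module R). \<exists>r\<in>carrier R.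
        \<one> = \<psi> (\<phi> e) \<oplus> r \<otimes> (\<one> \<ominus> f e)"
    and S: "finite S" and d: "dual_basis R A S b c"
  shows "\<exists>\<Psi>\<in>linear_maps R B A. \<forall>x\<in>carrier A. \<Psi> (\<phi> x) = x"
proof -
  interpret A: module R A by fact
  interpret B: module R B by fact
  have c: "c s \<in> linear_maps R A (regular_module R)" "x \<in> carrier A \<Longrightarrow> c s x \<in> carrier R" if "s \<in> S" for s x
    using dual_basisD(2,3)[OF d that] by auto
  \<comment> \<open>The identity of \<open>A\<close> is written as a map through
    \<open>\<phi>\<close> plus a correction indexed by \<open>T\<close>. Initially \<open>T\<close>
    is all of \<open>S\<close> and the first part is zero; at \<open>T = {}\<close> a left inverse
    remains.\<close>
  have main: "(\<exists>\<Psi>\<in>linear_maps R B A. \<exists>E\<in>T \<rightarrow> carrier A. \<forall>x\<in>carrier A.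
        x = \<Psi> (\<phi> x) \<oplus>\<^bsub>A\<^esub> finsum A (\<lambda>s. c s x \<odot>\<^bsub>A\<^esub> E s) T) \<Longrightarrow>
      \<exists>\<Psi>\<in>linear_maps R B A. \<forall>x\<in>carrier A. x = \<Psi> (\<phi> x)" if "finite T" "T \<subseteq> S" for T
    using that
  proof (induct T)
    case empty
    then show ?case using linear_map_closed[OF \<phi>] linear_map_closed[of _ R B A] by (metis A.M.r_zero A.M.finsum_empty)
  next
    case (insert t T)
    then obtain \<Psi> E where \<Psi>: "\<Psi> \<in> linear_maps R B A" and E: "E \<in> insert t T \<rightarrow> carrier A"
      and x_eq: "\<And>x. x \<in> carrier A \<Longrightarrow> x = \<Psi> (\<phi> x) \<oplus>\<^bsub>A\<^esub> finsum A (\<lambda>s. c s x \<odot>\<^bsub>A\<^esub> E s) (insert t T)"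
      by blast
    have tS: "t \<in> S" and TS: "T \<subseteq> S" using insert by auto
    define e where "e = E t"
    have e: "e \<in> carrier A" using E by (auto simp: e_def)
    have ET: "E s \<in> carrier A" if "s \<in> T" for s using E that by auto
    obtain \<psi> r where \<psi>: "\<psi> \<in> linear_maps R B (regular_module R)" and r: "r \<in> carrier R"
      and one: "\<one> = \<psi> (\<phi> e) \<oplus> r \<otimes> (\<one> \<ominus> c t e)"
      using key[OF e c(1)[OF tS]] by blast
    have R: "module R (regular_module R)" by (rule module_regular)
    note \<psi>\<phi> = linear_maps_comp[OF \<phi> \<psi>]
    \<comment> \<open>Chosen so that the equation for \<open>\<one>\<close> gives
      \<open>\<mu> e = r \<ominus> \<one>\<close>. Evaluating \<open>\<mu>\<close> on the expansion
      of \<open>x\<close> can then be solved for the coordinate \<open>c t x\<close>.\<close>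
    define \<mu> where "\<mu> z = r \<otimes> c t z \<ominus> \<psi> (\<phi> z)" for z
    have cl: "\<psi> (\<phi> z) \<in> carrier R" "c t z \<in> carrier R" if "z \<in> carrier A" for z
      using linear_map_closed[OF \<psi>\<phi> that] c(2)[OF tS that] by auto
    have \<mu>: "\<mu> \<in> linear_maps R A (regular_module R)"
    proof (rule linear_maps_cong[OF A linear_maps_minus[OF R linear_maps_smult[OF R c(1)[OF tS] r] \<psi>\<phi>]])
      show "\<mu> z = r \<odot>\<^bsub>regular_module R\<^esub> c t z \<ominus>\<^bsub>regular_module R\<^esub> \<psi> (\<phi> z)" if "z \<in> carrier A" for z
        using cl[OF that] r by (simp add: \<mu>_def regular_module_minus)
    qed
    have \<mu>c: "\<mu> z \<in> carrier R" if "z \<in> carrier A" for z using linear_map_closed[OF \<mu> that] by simp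
    \<comment> \<open>Solving gives \<open>c t x\<close> as
      \<open>\<psi> (\<phi> x) \<oplus> \<mu> (\<Psi> (\<phi> x))\<close> plus \<open>\<mu>\<close>
      of the remaining sum. The first part, times \<open>e\<close>, is absorbed into
      \<open>\<Psi>'\<close>, the second into the vectors \<open>E'\<close>.\<close>
    define \<Psi>' where "\<Psi>' y = \<Psi> y \<oplus>\<^bsub>A\<^esub> (\<psi> y \<oplus> \<mu> (\<Psi> y)) \<odot>\<^bsub>A\<^esub> e" for y
    define E' where "E' s = E s \<oplus>\<^bsub>A\<^esub> \<mu> (E s) \<odot>\<^bsub>A\<^esub> e" for s
    have "(\<lambda>y. \<psi> y \<oplus> \<mu> (\<Psi> y)) \<in> linear_maps R B (regular_module R)"
      using linear_maps_add[OF R \<psi> linear_maps_comp[OF \<Psi> \<mu>]] by simp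
    then have \<Psi>': "\<Psi>' \<in> linear_maps R B A"
      unfolding \<Psi>'_def[abs_def] by (intro linear_maps_add[OF A \<Psi>] linear_maps_smult_const[OF A _ e])
    have E': "E' \<in> T \<rightarrow> carrier A" using ET \<mu>c e by (auto simp: E'_def)
    have "x = \<Psi>' (\<phi> x) \<oplus>\<^bsub>A\<^esub> finsum A (\<lambda>s. c s x \<odot>\<^bsub>A\<^esub> E' s) T" if x: "x \<in> carrier A" for x
    proof -
      define a where "a = \<Psi> (\<phi> x)"
      define u where "u = finsum A (\<lambda>s. c s x \<odot>\<^bsub>A\<^esub> E s) T"
      define l where "l = c t x"
      have cs: "c s x \<in> carrier R" if "s \<in> T" for s using c(2) TS that x by blast
      have a: "a \<in> carrier A" unfolding a_def using linear_map_closed[OF linear_maps_comp[OF \<phi> \<Psi>] x] .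
      have u: "u \<in> carrier A" unfolding u_def using cs ET by (intro A.M.finsum_closed) auto
      have l: "l \<in> carrier R" unfolding l_def using cl(2)[OF x] .
      have "finsum A (\<lambda>s. c s x \<odot>\<^bsub>A\<^esub> E s) (insert t T) = l \<odot>\<^bsub>A\<^esub> e \<oplus>\<^bsub>A\<^esub> u"
        unfolding u_def l_def e_def using insert.hyps cs ET e cl(2)[OF x]
        by (intro A.M.finsum_insert) (auto simp: e_def)
      then have x_sum: "x = a \<oplus>\<^bsub>A\<^esub> (l \<odot>\<^bsub>A\<^esub> e \<oplus>\<^bsub>A\<^esub> u)" using x_eq[OF x] by (simp add: a_def)
      have fin: "finsum (regular_module R) g T = finsum R g T" for g
        by (simp add: finsum_def finprod_def regular_module_def)
      have \<mu>u: "\<mu> u = finsum R (\<lambda>s. c s x \<otimes> \<mu> (E s)) T"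
      proof -
        have "\<mu> u = finsum R (\<lambda>s. \<mu> (c s x \<odot>\<^bsub>A\<^esub> E s)) T"
          unfolding u_def fin[symmetric] using cs ET insert.hyps by (intro linear_map_finsum[OF A R \<mu>]) auto
        also have "\<dots> = finsum R (\<lambda>s. c s x \<otimes> \<mu> (E s)) T"
          using cs ET \<mu>c linear_map_smult[OF \<mu>] by (intro finsum_cong') auto
        finally show ?thesis .
      qed
      have \<mu>sum: "finsum A (\<lambda>s. (c s x \<otimes> \<mu> (E s)) \<odot>\<^bsub>A\<^esub> e) T = \<mu> u \<odot>\<^bsub>A\<^esub> e"
      proof -
        have "(\<lambda>r. r \<odot>\<^bsub>A\<^esub> e) \<in> linear_maps R (regular_module R) A"
          by (rule linear_maps_smult_const[OF A linear_maps_id e])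
        from linear_map_finsum[OF R A this _ insert.hyps(1), of "\<lambda>s. c s x \<otimes> \<mu> (E s)"]
        show ?thesis unfolding \<mu>u fin using cs ET \<mu>c by auto
      qed
      have "finsum A (\<lambda>s. c s x \<odot>\<^bsub>A\<^esub> E' s) T =
          finsum A (\<lambda>s. c s x \<odot>\<^bsub>A\<^esub> E s \<oplus>\<^bsub>A\<^esub> (c s x \<otimes> \<mu> (E s)) \<odot>\<^bsub>A\<^esub> e) T"
        using cs ET \<mu>c e by (intro A.M.finsum_cong') (auto simp: E'_def A.smult_r_distr A.smult_assoc1)
      also have "\<dots> = u \<oplus>\<^bsub>A\<^esub> \<mu> u \<odot>\<^bsub>A\<^esub> e"
        unfolding u_def[symmetric] \<mu>sum[symmetric]
        using cs ET \<mu>c e by (subst u_def, intro A.M.finsum_addf) auto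
      finally have sum: "finsum A (\<lambda>s. c s x \<odot>\<^bsub>A\<^esub> E' s) T = u \<oplus>\<^bsub>A\<^esub> \<mu> u \<odot>\<^bsub>A\<^esub> e" .
      define p q where "p = \<psi> (\<phi> e)" and "q = \<psi> (\<phi> x)"
      have pq: "p \<in> carrier R" "q \<in> carrier R" unfolding p_def q_def using cl e x by auto
      have ce: "c t e \<in> carrier R" using cl e by auto
      have \<mu>x: "\<mu> x = \<mu> a \<oplus> (l \<otimes> \<mu> e \<oplus> \<mu> u)"
        using arg_cong[OF x_sum, of \<mu>] linear_map_add[OF \<mu>] linear_map_smult[OF \<mu> l e] a u l e by simp
      have "\<mu> e = r \<ominus> (p \<oplus> r \<otimes> (\<one> \<ominus> c t e))"
        using pq ce r unfolding \<mu>_def p_def[symmetric] by algebra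
      then have \<mu>e: "\<mu> e = r \<ominus> \<one>" using one by (simp add: p_def)
      have "q \<oplus> \<mu> x = r \<otimes> l"
        using pq l r unfolding \<mu>_def q_def[symmetric] l_def[symmetric] by algebra
      then have eq: "q \<oplus> (\<mu> a \<oplus> (l \<otimes> (r \<ominus> \<one>) \<oplus> \<mu> u)) = r \<otimes> l" unfolding \<mu>x \<mu>e .
      have "(q \<oplus> \<mu> a) \<oplus> \<mu> u =
          ((q \<oplus> (\<mu> a \<oplus> (l \<otimes> (r \<ominus> \<one>) \<oplus> \<mu> u))) \<ominus> r \<otimes> l) \<oplus> l"
        using pq l r \<mu>c[OF a] \<mu>c[OF u] by algebra
      also have "\<dots> = l" unfolding eq using l r by algebra
      finally have coeff: "(q \<oplus> \<mu> a) \<oplus> \<mu> u = l" .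
      have "\<Psi>' (\<phi> x) \<oplus>\<^bsub>A\<^esub> finsum A (\<lambda>s. c s x \<odot>\<^bsub>A\<^esub> E' s) T =
          (a \<oplus>\<^bsub>A\<^esub> (q \<oplus> \<mu> a) \<odot>\<^bsub>A\<^esub> e) \<oplus>\<^bsub>A\<^esub> (u \<oplus>\<^bsub>A\<^esub> \<mu> u \<odot>\<^bsub>A\<^esub> e)"
        unfolding sum by (simp add: \<Psi>'_def a_def q_def)
      also have "\<dots> = a \<oplus>\<^bsub>A\<^esub> (((q \<oplus> \<mu> a) \<odot>\<^bsub>A\<^esub> e \<oplus>\<^bsub>A\<^esub> \<mu> u \<odot>\<^bsub>A\<^esub> e) \<oplus>\<^bsub>A\<^esub> u)"
        using a u e pq \<mu>c by (simp add: A.M.a_ac)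
      also have "(q \<oplus> \<mu> a) \<odot>\<^bsub>A\<^esub> e \<oplus>\<^bsub>A\<^esub> \<mu> u \<odot>\<^bsub>A\<^esub> e = l \<odot>\<^bsub>A\<^esub> e"
        using A.smult_l_distr[of "q \<oplus> \<mu> a" "\<mu> u" e] e pq \<mu>c a u coeff by simp
      finally show ?thesis using x_sum by simp
    qed
    then show ?case using insert.hyps(3) TS \<Psi>' E' by blast
  qed
  have "\<exists>\<Psi>\<in>linear_maps R B A. \<forall>x\<in>carrier A. x = \<Psi> (\<phi> x)"
  proof (rule main[OF S subset_refl], intro bexI ballI)
    show "(\<lambda>y. \<zero>\<^bsub>A\<^esub>) \<in> linear_maps R B A" by (rule linear_maps_const_zero[OF A])
    show "b \<in> S \<rightarrow> carrier A" using dual_basisD(1)[OF d] by auto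
    fix x assume x: "x \<in> carrier A"
    have "(\<lambda>s. c s x \<odot>\<^bsub>A\<^esub> b s) \<in> S \<rightarrow> carrier A" using dual_basisD(1)[OF d] c(2) x by auto
    then have "finsum A (\<lambda>s. c s x \<odot>\<^bsub>A\<^esub> b s) S \<in> carrier A" by (rule A.M.finsum_closed)
    then show "x = \<zero>\<^bsub>A\<^esub> \<oplus>\<^bsub>A\<^esub> finsum A (\<lambda>s. c s x \<odot>\<^bsub>A\<^esub> b s) S"
      using finite_dual_basis[OF A d S x] by simp
  qed
  then show ?thesis by metis
qed

section \<open>From the criterion to shorter resolutions\<close>

text \<open>With \<open>Z j\<close> the image of \<open>\<gamma> j\<close>, the sequence \<open>0
  \<rightarrow> Z j \<rightarrow> Q j \<rightarrow> Z (j-1) \<rightarrow> 0\<close> lowers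
  \<open>i\<close> and \<open>j\<close> together. The condition \<open>i \<le> j\<close> ensures
  that degree \<open>0\<close> is reached before the syzygies run out.\<close>

lemma (in proj_resolution) cohomology_vanishes_image:
  assumes Q: "proj_resolution R Q \<gamma> \<eta> M'"
    and v: "\<And>i j. i < k \<Longrightarrow> cohomology_vanishes R P \<delta> (Q j) i"
    and i: "i < k" "i \<le> j"
  shows "cohomology_vanishes R P \<delta> (sub_module (Q j) (\<gamma> j ` carrier (Q (Suc j)))) i"
  using i
proof (induct i arbitrary: j)
  interpret Q: proj_resolution R Q \<gamma> \<eta> M' by fact
  have mZ: "module R (sub_module (Q j) (\<gamma> j ` carrier (Q (Suc j))))" for j
    by (rule module_image(2)[OF Q.module_P Q.module_P Q.d_linear])
  have inc: "(\<lambda>x. x) \<in> linear_maps R (sub_module (Q j) (\<gamma> j ` carrier (Q (Suc j)))) (Q j)" for j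
    by (rule linear_maps_from_sub_module[OF linear_maps_id]) auto
  {
    case 0
    show ?case by (rule cohomology_0_vanishes_sub[OF mZ Q.module_P inc]) (use 0 v in auto)
  next
    case (Suc i)
    then obtain j' where j: "j = Suc j'" by (cases j) auto
    have \<gamma>: "\<gamma> j' \<in> linear_maps R (Q j) (sub_module (Q j') (\<gamma> j' ` carrier (Q (Suc j'))))"
      using Q.d_linear[of j'] unfolding j by (rule linear_maps_sub_moduleI) auto
    show ?case
    proof (rule cohomology_vanishes_sub[OF mZ Q.module_P mZ inc _ \<gamma>])
      show "cohomology_vanishes R P \<delta> (sub_module (Q j') (\<gamma> j' ` carrier (Q (Suc j')))) l"
        if "Suc i = Suc l" for l using Suc j that by simp
      show "cohomology_vanishes R P \<delta> (Q j) (Suc i)" using v Suc.prems by blast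
    qed (auto simp: j Q.d_image_Suc)
  }
qed

text \<open>
  Let \<open>0 \<rightarrow> Q\<^sub>n \<rightarrow> Q\<^sub>n\<^sub>-\<^sub>1 \<rightarrow> \<dots>\<close> be exact with \<open>n = Suc m\<close>, and let \<open>e \<in> Q\<^sub>n\<close> be unimodular modulo \<open>I\<close> with
  image in \<open>I Q\<^sub>n\<^sub>-\<^sub>1\<close>. By induction, \<open>Ext\<^sup>k(R/I, Q\<^sub>n) \<rightarrow> Ext\<^sup>k(R/I, Q\<^sub>n\<^sub>-\<^sub>1)\<close> is injective for \<open>k < n\<close>. The
  element \<open>e\<close> embeds \<open>Ext\<^sup>k(R/I, R)\<close> into the source, and the composite is zero because \<open>I\<close> kills
  \<open>Ext\<close>; so \<open>Ext\<^sup>k(R/I, R) = 0\<close>.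
\<close>

lemma (in proj_resolution) cohomology_vanishes_below_length:
  assumes Q: "proj_resolution R Q \<gamma> \<eta> M'" and fg: "\<And>j. fg_module R (Q j)"
    and top: "trivial_module (Q (Suc (Suc m)))"
    and ann: "\<And>a x. a \<in> I \<Longrightarrow> x \<in> carrier M \<Longrightarrow> a \<odot>\<^bsub>M\<^esub> x = \<zero>\<^bsub>M\<^esub>" and IR: "I \<subseteq> carrier R"
    and e: "e \<in> carrier (Q (Suc m))" and l: "l \<in> linear_maps R (Q (Suc m)) (regular_module R)"
    and le: "\<one> \<ominus> l e \<in> I"
    and S: "finite S" and b: "dual_basis R (Q m) S b c" and ce: "\<And>s. s \<in> S \<Longrightarrow> c s (\<gamma> m e) \<in> I"
    and k: "k \<le> m"
  shows "cohomology_vanishes R P \<delta> (regular_module R) k"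
  using k
proof (induct k rule: less_induct)
  case (less k)
  interpret Q: proj_resolution R Q \<gamma> \<eta> M' by fact
  interpret M: module R M by (rule module_M)
  interpret Qm: module R "Q m" by (rule Q.module_P)
  interpret Qn: module R "Q (Suc m)" by (rule Q.module_P)
  have R: "module R (regular_module R)" by (rule M.R.module_regular)
  \<comment> \<open>The induction hypothesis concerns \<open>R\<close> only; finite dual bases
    extend it to every term of \<open>Q\<close>.\<close>
  have vQ: "cohomology_vanishes R P \<delta> (Q j) i" if i: "i < k" for i j
  proof -
    obtain T t where "finite T" "dual_basis R (Q j) T (\<lambda>x. x) t"
      using fg_projective_dual_basis[OF Q.projective fg] by metis
    moreover have "cohomology_vanishes R P \<delta> (regular_module R) i" using less i by simp
    ultimately show ?thesis using cohomology_vanishes_finite_dual_basis Q.module_P by blast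
  qed
  have inj: "inj_on (\<gamma> m) (carrier (Q (Suc m)))"
  proof (rule inj_onI)
    fix x y assume xy: "x \<in> carrier (Q (Suc m))" "y \<in> carrier (Q (Suc m))" "\<gamma> m x = \<gamma> m y"
    have "\<gamma> m (x \<ominus>\<^bsub>Q (Suc m)\<^esub> y) = \<zero>\<^bsub>Q m\<^esub>"
      using linear_map_minus[OF Q.module_P Q.module_P Q.d_linear xy(1,2)] xy Q.d_closed[OF xy(2)]
      by (simp add: a_minus_def Qm.M.r_neg)
    moreover have "x \<ominus>\<^bsub>Q (Suc m)\<^esub> y \<in> carrier (Q (Suc m))" using xy by simp
    ultimately have "x \<ominus>\<^bsub>Q (Suc m)\<^esub> y \<in> \<gamma> (Suc m) ` carrier (Q (Suc (Suc m)))" using Q.d_image_Suc[of m] by blast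
    then have "x \<ominus>\<^bsub>Q (Suc m)\<^esub> y = \<zero>\<^bsub>Q (Suc m)\<^esub>"
      using top linear_map_zero[OF Q.module_P Q.module_P Q.d_linear] by (auto simp: trivial_module_def)
    moreover have "x = (x \<ominus>\<^bsub>Q (Suc m)\<^esub> y) \<oplus>\<^bsub>Q (Suc m)\<^esub> y"
      using xy by (simp add: a_minus_def Qn.M.a_assoc Qn.M.l_neg)
    ultimately show "x = y" using xy by simp
  qed
  \<comment> \<open>The cokernel of \<open>\<gamma> m\<close> is a syzygy in \<open>Q m'\<close> if
    \<open>m = Suc m'\<close>. For \<open>m = 0\<close> it is \<open>M'\<close> itself; then
    \<open>k = 0\<close>, and no cohomology of the cokernel enters.\<close>
  have inject: "is_coboundary R P \<delta> (Q (Suc m)) k f"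
    if f: "f \<in> linear_maps R (P k) (Q (Suc m))" "is_coboundary R P \<delta> (Q m) k (\<lambda>x. \<gamma> m (f x))" for f
  proof (cases m)
    case 0
    show ?thesis
      by (rule is_coboundary_inject[OF Q.module_P Q.module_P Q.module_M Q.d_linear inj _ _ _ _ f, of \<eta>])
        (use 0 less.prems Q.augmentation_linear Q.augmentation_surj Q.d_image_0 in auto)
  next
    case (Suc m')
    let ?Z = "sub_module (Q m') (\<gamma> m' ` carrier (Q (Suc m')))"
    have Z: "module R ?Z" by (rule module_image(2)[OF Q.module_P Q.module_P Q.d_linear])
    have \<gamma>: "\<gamma> m' \<in> linear_maps R (Q m) ?Z"
      using Q.d_linear[of m'] unfolding Suc by (rule linear_maps_sub_moduleI) auto
    show ?thesis
    proof (rule is_coboundary_inject[OF Q.module_P Q.module_P Z Q.d_linear inj \<gamma> _ _ _ f])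
      show "cohomology_vanishes R P \<delta> ?Z j" if "k = Suc j" for j
        by (rule cohomology_vanishes_image[OF Q vQ]) (use that less.prems Suc in auto)
    qed (auto simp: Suc Q.d_image_Suc)
  qed
  show ?case
    unfolding cohomology_vanishes_def
  proof (intro allI impI)
    fix f assume f: "is_cocycle R P \<delta> (regular_module R) k f"
    note fl = is_cocycleD(1)[OF f]
    have fc: "f x \<in> carrier R" if "x \<in> carrier (P k)" for x using linear_map_closed[OF fl that] by simp
    let ?F = "\<lambda>x. f x \<odot>\<^bsub>Q (Suc m)\<^esub> e"
    have F: "?F \<in> linear_maps R (P k) (Q (Suc m))" by (rule linear_maps_smult_const[OF Q.module_P fl e])
    have \<gamma>e: "\<gamma> m e \<in> carrier (Q m)" using e by simp
    have cob: "is_coboundary R P \<delta> (regular_module R) k (\<lambda>x. a \<otimes> f x)" if a: "a \<in> I" for a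
    proof -
      have "a \<in> carrier R" using a IR by blast
      from is_coboundary_annihilator[OF R this ann[OF a] f] show ?thesis by simp
    qed
    have bQ: "b s \<in> carrier (Q m)" if "s \<in> S" for s using dual_basisD(1)[OF b that] .
    have cR: "c s (\<gamma> m e) \<in> carrier R" if "s \<in> S" for s using dual_basisD(3)[OF b that \<gamma>e] .
    \<comment> \<open>The dual basis expansion of the image of \<open>f x\<close> times
      \<open>e\<close>: each summand contains an element of \<open>I\<close> times the cocycle
      \<open>f\<close>, hence is a coboundary.\<close>
    have "is_coboundary R P \<delta> (Q m) k (\<lambda>x. finsum (Q m) (\<lambda>s. (c s (\<gamma> m e) \<otimes> f x) \<odot>\<^bsub>Q m\<^esub> b s) S)"
    proof (rule is_coboundary_finsum[OF Q.module_P S])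
      fix s assume s: "s \<in> S"
      have "(\<lambda>r. r \<odot>\<^bsub>Q m\<^esub> b s) \<in> linear_maps R (regular_module R) (Q m)"
        by (rule linear_maps_smult_const[OF Q.module_P linear_maps_id bQ[OF s]])
      from is_coboundary_map[OF this R Q.module_P cob[OF ce[OF s]]]
      show "is_coboundary R P \<delta> (Q m) k (\<lambda>x. (c s (\<gamma> m e) \<otimes> f x) \<odot>\<^bsub>Q m\<^esub> b s)" .
      show "(c s (\<gamma> m e) \<otimes> f x) \<odot>\<^bsub>Q m\<^esub> b s \<in> carrier (Q m)" if "x \<in> carrier (P k)" for x
        using cR[OF s] fc[OF that] bQ[OF s] by simp
    qed
    moreover have "finsum (Q m) (\<lambda>s. (c s (\<gamma> m e) \<otimes> f x) \<odot>\<^bsub>Q m\<^esub> b s) S = \<gamma> m (?F x)"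
      if x: "x \<in> carrier (P k)" for x
    proof -
      have "\<gamma> m (?F x) = f x \<odot>\<^bsub>Q m\<^esub> \<gamma> m e" by (rule linear_map_smult[OF Q.d_linear fc[OF x] e])
      also have "\<dots> = f x \<odot>\<^bsub>Q m\<^esub> finsum (Q m) (\<lambda>s. c s (\<gamma> m e) \<odot>\<^bsub>Q m\<^esub> b s) S"
        using finite_dual_basis[OF Q.module_P b S \<gamma>e] by simp
      also have "\<dots> = finsum (Q m) (\<lambda>s. f x \<odot>\<^bsub>Q m\<^esub> (c s (\<gamma> m e) \<odot>\<^bsub>Q m\<^esub> b s)) S"
        using S fc[OF x] cR bQ by (intro Qm.finsum_smult_ldistr) auto
      also have "\<dots> = finsum (Q m) (\<lambda>s. (c s (\<gamma> m e) \<otimes> f x) \<odot>\<^bsub>Q m\<^esub> b s) S"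
        using fc[OF x] cR bQ by (intro Qm.M.finsum_cong') (auto simp: Qm.smult_assoc1[symmetric] M.R.m_comm)
      finally show ?thesis ..
    qed
    ultimately have "is_coboundary R P \<delta> (Q m) k (\<lambda>x. \<gamma> m (?F x))"
      using is_coboundary_cong[of P k "\<lambda>x. finsum (Q m) (\<lambda>s. (c s (\<gamma> m e) \<otimes> f x) \<odot>\<^bsub>Q m\<^esub> b s) S" "\<lambda>x. \<gamma> m (?F x)"]
      by blast
    then have "is_coboundary R P \<delta> (Q (Suc m)) k ?F" by (rule inject[OF F])
    then have "is_coboundary R P \<delta> (regular_module R) k (\<lambda>x. l (?F x))"
      by (rule is_coboundary_map[OF l Q.module_P R])
    \<comment> \<open>The functional \<open>l\<close> recovers \<open>f\<close> up to the factor
      \<open>l e\<close>; the defect \<open>\<one> \<ominus> l e\<close> lies in \<open>I\<close>,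
      so its multiple of \<open>f\<close> is a coboundary too.\<close>
    then have "is_coboundary R P \<delta> (regular_module R) k (\<lambda>x. l (?F x) \<oplus> (\<one> \<ominus> l e) \<otimes> f x)"
      using is_coboundary_add[OF R _ cob[OF le]] by simp
    moreover have "l (?F x) \<oplus> (\<one> \<ominus> l e) \<otimes> f x = f x" if x: "x \<in> carrier (P k)" for x
    proof -
      have le: "l e \<in> carrier R" using linear_map_closed[OF l e] by simp
      have "l (?F x) = f x \<otimes> l e" using linear_map_smult[OF l fc[OF x] e] by simp
      then show ?thesis using le fc[OF x] by (simp, algebra)
    qed
    ultimately show "is_coboundary R P \<delta> (regular_module R) k f"
      using is_coboundary_cong[of P k "\<lambda>x. l (?F x) \<oplus> (\<one> \<ominus> l e) \<otimes> f x" f] by blast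
  qed
qed

text \<open>Since functionals can be added and scaled, a single \<open>\<psi>\<close> and a single
  \<open>r\<close> describe each element. Membership of \<open>1\<close> thereby takes the form that
  the splitting argument consumes.\<close>

lemma (in cring) ideal_of_linear_combinations:
  assumes B: "module R B" and y: "y \<in> carrier B" and z: "z \<in> carrier R"
  shows "ideal {\<psi> y \<oplus> r \<otimes> z | \<psi> r. \<psi> \<in> linear_maps R B (regular_module R) \<and> r \<in> carrier R} R"
    (is "ideal ?I R")
proof (rule idealI)
  have R: "module R (regular_module R)" by (rule module_regular)
  have cl: "\<psi> y \<in> carrier R" if "\<psi> \<in> linear_maps R B (regular_module R)" for \<psi>
    using linear_map_closed[OF that y] by simp
  show mult: "x \<otimes> a \<in> ?I" if a: "a \<in> ?I" and x: "x \<in> carrier R" for a x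
  proof -
    obtain \<psi> r where \<psi>: "\<psi> \<in> linear_maps R B (regular_module R)" "r \<in> carrier R" "a = \<psi> y \<oplus> r \<otimes> z"
      using a by blast
    have "(\<lambda>v. x \<otimes> \<psi> v) \<in> linear_maps R B (regular_module R)" using linear_maps_smult[OF R \<psi>(1) x] by simp
    moreover have "x \<otimes> a = x \<otimes> \<psi> y \<oplus> (x \<otimes> r) \<otimes> z" using \<psi> cl x z by (simp add: r_distr m_assoc)
    ultimately show ?thesis using \<psi>(2) x
      by (intro CollectI exI[of _ "\<lambda>v. x \<otimes> \<psi> v"] exI[of _ "x \<otimes> r"]) simp
  qed
  then show "a \<otimes> x \<in> ?I" if "a \<in> ?I" "x \<in> carrier R" for a x
  proof -
    have "a \<in> carrier R" using that(1) cl z by auto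
    then show ?thesis using mult[OF that] that(2) by (simp add: m_comm)
  qed
  show "subgroup ?I (add_monoid R)"
  proof (rule group.subgroupI)
    show "group (add_monoid R)" by (rule a_group)
    show "?I \<subseteq> carrier (add_monoid R)" using cl z by auto
    show "?I \<noteq> {}" using linear_maps_const_zero[OF R, of B] by blast
    show "inv\<^bsub>add_monoid R\<^esub> a \<in> ?I" if a: "a \<in> ?I" for a
    proof -
      have "a \<in> carrier R" using a cl z by auto
      then have "inv\<^bsub>add_monoid R\<^esub> a = (\<ominus> \<one>) \<otimes> a" by (simp add: l_minus a_inv_def[symmetric])
      then show ?thesis using mult[OF a, of "\<ominus> \<one>"] by simp
    qed
    show "a \<otimes>\<^bsub>add_monoid R\<^esub> b \<in> ?I" if "a \<in> ?I" "b \<in> ?I" for a b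
    proof -
      obtain \<psi> r where \<psi>: "\<psi> \<in> linear_maps R B (regular_module R)" "r \<in> carrier R" "a = \<psi> y \<oplus> r \<otimes> z"
        using \<open>a \<in> ?I\<close> by blast
      obtain \<psi>' r' where \<psi>': "\<psi>' \<in> linear_maps R B (regular_module R)" "r' \<in> carrier R" "b = \<psi>' y \<oplus> r' \<otimes> z"
        using \<open>b \<in> ?I\<close> by blast
      have "(\<lambda>v. \<psi> v \<oplus> \<psi>' v) \<in> linear_maps R B (regular_module R)" using linear_maps_add[OF R \<psi>(1) \<psi>'(1)] by simp
      moreover have "a \<oplus> b = (\<psi> y \<oplus> \<psi>' y) \<oplus> (r \<oplus> r') \<otimes> z" using \<psi> \<psi>' cl z by (simp add: l_distr a_ac)
      ultimately show ?thesis using \<psi>(2) \<psi>'(2)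
        by (intro CollectI exI[of _ "\<lambda>v. \<psi> v \<oplus> \<psi>' v"] exI[of _ "r \<oplus> r'"]) simp
    qed
  qed
qed (rule ring_axioms)

lemma (in proj_resolution) top_differential_splits_of_criterion:
  assumes fg: "\<And>i. fg_module R (P i)" and top: "trivial_module (P (Suc (Suc m)))" and md: "d \<le> m"
    and crit: "\<And>xs. set xs \<subseteq> carrier R \<Longrightarrow>
      (\<And>i. i \<le> d \<Longrightarrow> trivial_module
        (Ext R i (quotient_module (regular_module R) (genideal R (set xs))) (regular_module R))) \<Longrightarrow>
      \<one> \<in> genideal R (set xs)"
  shows "\<exists>\<Psi>\<in>linear_maps R (P m) (P (Suc m)). \<forall>x\<in>carrier (P (Suc m)). \<Psi> (\<delta> m x) = x"
proof -
  interpret M: module R M by (rule module_M)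
  obtain S c where S: "finite S" and c: "dual_basis R (P m) S (\<lambda>x. x) c"
    using fg_projective_dual_basis[OF projective fg] by metis
  obtain T t where T: "finite T" "dual_basis R (P (Suc m)) T (\<lambda>x. x) t"
    using fg_projective_dual_basis[OF projective fg] by metis
  show ?thesis
  proof (rule M.R.split_of_local_splittings[OF module_P module_P d_linear _ T])
    fix e f assume e: "e \<in> carrier (P (Suc m))" and f: "f \<in> linear_maps R (P (Suc m)) (regular_module R)"
    have fe: "f e \<in> carrier R" using linear_map_closed[OF f e] by simp
    have de: "\<delta> m e \<in> carrier (P m)" using e by simp
    \<comment> \<open>Generators of the smallest ideal modulo which \<open>f e\<close> is
      \<open>1\<close> and all coordinates of \<open>\<delta> m e\<close> vanish; a finite dual
      basis of \<open>P m\<close> makes them finite in number.\<close>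
    obtain xs where xs: "set xs = insert (\<one> \<ominus> f e) ((\<lambda>s. c s (\<delta> m e)) ` S)"
      using finite_list[of "insert (\<one> \<ominus> f e) ((\<lambda>s. c s (\<delta> m e)) ` S)"] S by auto
    have xsR: "set xs \<subseteq> carrier R" unfolding xs using fe dual_basisD(3)[OF c _ de] by auto
    let ?I = "genideal R (set xs)"
    have I: "ideal ?I R" by (rule M.R.genideal_ideal[OF xsR])
    have IR: "?I \<subseteq> carrier R" using I by (meson additive_subgroup.a_subset ideal.axioms(1))
    have xsI: "set xs \<subseteq> ?I" by (rule M.R.genideal_self[OF xsR])
    obtain P' :: "nat \<Rightarrow> ('a, 'a set) aux_module" and \<delta>' \<epsilon>'
      where res: "proj_resolution R P' \<delta>' \<epsilon>' (quotient_module (regular_module R) ?I)"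
        and Ext: "\<And>i. trivial_module (Ext R i (quotient_module (regular_module R) ?I) (regular_module R)) \<longleftrightarrow>
          cohomology_vanishes R P' \<delta>' (regular_module R) i"
      using M.R.Ext_resolution[OF I] by blast
    have "cohomology_vanishes R P' \<delta>' (regular_module R) k" if "k \<le> m" for k
      by (rule proj_resolution.cohomology_vanishes_below_length[OF res proj_resolution_axioms fg top
            M.R.quotient_by_ideal_annihilated[OF I] IR e f _ S c _ that])
        (use xsI xs in auto)
    then have one: "\<one> \<in> ?I" using md by (intro crit[OF xsR]) (simp add: Ext)
    let ?L = "{\<psi> (\<delta> m e) \<oplus> r \<otimes> (\<one> \<ominus> f e) | \<psi> r. \<psi> \<in> linear_maps R (P m) (regular_module R) \<and> r \<in> carrier R}"
    have "set xs \<subseteq> ?L"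
    proof -
      have "c s (\<delta> m e) \<in> ?L" if s: "s \<in> S" for s
      proof -
        have "c s (\<delta> m e) = c s (\<delta> m e) \<oplus> \<zero> \<otimes> (\<one> \<ominus> f e)" using dual_basisD(3)[OF c s de] fe by simp
        then show ?thesis using dual_basisD(2)[OF c s] M.R.zero_closed by blast
      qed
      moreover have "\<one> \<ominus> f e = (\<lambda>v. \<zero>) (\<delta> m e) \<oplus> \<one> \<otimes> (\<one> \<ominus> f e)" using fe by simp
      then have "\<one> \<ominus> f e \<in> ?L"
        using linear_maps_const_zero[OF M.R.module_regular, of "P m"] M.R.one_closed
        by (intro CollectI exI[of _ "\<lambda>_. \<zero>"] exI[of _ \<one>]) (simp add: regular_module_def)
      ultimately show ?thesis unfolding xs by blast
    qed
    moreover have "ideal ?L R" using fe by (intro M.R.ideal_of_linear_combinations[OF module_P de]) simp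
    ultimately have "?I \<subseteq> ?L" by (intro M.R.genideal_minimal)
    then show "\<exists>\<psi>\<in>linear_maps R (P m) (regular_module R). \<exists>r\<in>carrier R.
        \<one> = \<psi> (\<delta> m e) \<oplus> r \<otimes> (\<one> \<ominus> f e)" using one by blast
  qed
qed

text \<open>If the top map \<open>\<delta> m\<close> splits, its target may be replaced by a complement of its image.\<close>

lemma (in proj_resolution) shorten_resolution:
  assumes fg: "\<And>i. fg_module R (P i)" and top: "\<And>i. i > Suc m \<Longrightarrow> trivial_module (P i)"
    and \<Psi>: "\<Psi> \<in> linear_maps R (P m) (P (Suc m))" "\<And>x. x \<in> carrier (P (Suc m)) \<Longrightarrow> \<Psi> (\<delta> m x) = x"
  obtains P' where "proj_resolution R P' \<delta> \<epsilon> M" "\<And>i. fg_module R (P' i)" "\<And>i. i > m \<Longrightarrow> trivial_module (P' i)"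
proof -
  \<comment> \<open>In degree \<open>m\<close> the kernel of \<open>\<Psi>\<close> complements the
    image of \<open>\<delta> m\<close>; above \<open>m\<close> only zero is kept. Differentials and
    augmentation stay the same maps.\<close>
  define A where "A i = (if i < m then carrier (P i)
    else if i = m then {y \<in> carrier (P m). \<Psi> y = \<zero>\<^bsub>P (Suc m)\<^esub>} else {\<zero>\<^bsub>P i\<^esub>})" for i
  let ?P' = "\<lambda>i. sub_module (P i) (A i)"
  \<comment> \<open>A retraction onto the new terms. It makes them direct summands, so they remain
    projective and finitely generated.\<close>
  define p where "p i y = (if i < m then y else if i = m then y \<ominus>\<^bsub>P m\<^esub> \<delta> m (\<Psi> y) else \<zero>\<^bsub>P i\<^esub>)" for i y
  have zero: "\<zero>\<^bsub>P i\<^esub> \<in> carrier (P i)" for i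
    using module.axioms(2)[OF module_P] abelian_group.axioms(1) abelian_monoid.zero_closed by metis
  have dz: "\<delta> i \<zero>\<^bsub>P (Suc i)\<^esub> = \<zero>\<^bsub>P i\<^esub>" for i by (rule linear_map_zero[OF module_P module_P d_linear])
  have AP: "A i \<subseteq> carrier (P i)" for i using zero by (auto simp: A_def)
  interpret Pm: module R "P m" by (rule module_P)
  interpret Pn: module R "P (Suc m)" by (rule module_P)
  have d\<Psi>: "(\<lambda>y. \<delta> m (\<Psi> y)) \<in> linear_maps R (P m) (P m)" by (rule linear_maps_comp[OF \<Psi>(1) d_linear])
  have mA: "module R (?P' i)" for i
  proof -
    interpret Pi: module R "P i" by (rule module_P)
    consider "i < m" | "i = m" | "i > m" by linarith
    then show ?thesis
    proof cases
      case 1 then show ?thesis using module_P by (simp add: A_def)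
    next
      case 2 then show ?thesis using module_kernel(2)[OF module_P module_P \<Psi>(1)] by (simp add: A_def)
    next
      case 3 then show ?thesis by (intro module_sub_module(2)[OF module_P]) (auto simp: A_def)
    qed
  qed
  have pA: "p i y \<in> A i" if y: "y \<in> carrier (P i)" for i y
  proof (cases "i = m")
    case True
    have \<Psi>y: "\<Psi> y \<in> carrier (P (Suc m))" using linear_map_closed[OF \<Psi>(1)] y True by simp
    have "\<Psi> (y \<ominus>\<^bsub>P m\<^esub> \<delta> m (\<Psi> y)) = \<Psi> y \<ominus>\<^bsub>P (Suc m)\<^esub> \<Psi> (\<delta> m (\<Psi> y))"
      using linear_map_minus[OF module_P module_P \<Psi>(1)] y True \<Psi>y by simp
    also have "\<dots> = \<zero>\<^bsub>P (Suc m)\<^esub>" using \<Psi>(2)[OF \<Psi>y] \<Psi>y by (simp add: a_minus_def Pn.M.r_neg)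
    finally show ?thesis using True y \<Psi>y by (simp add: p_def A_def)
  qed (use y in \<open>auto simp: p_def A_def\<close>)
  have pl: "p i \<in> linear_maps R (P i) (?P' i)" for i
  proof (rule linear_maps_sub_moduleI[OF _ pA])
    show "p i \<in> linear_maps R (P i) (P i)"
    proof (cases "i = m")
      case True
      then show ?thesis using linear_maps_minus[OF module_P linear_maps_id d\<Psi>] by (simp add: p_def[abs_def])
    next
      case False
      then show ?thesis using linear_maps_id linear_maps_const_zero[OF module_P]
        by (cases "i < m") (auto simp: p_def[abs_def])
    qed
  qed
  have pid: "p i y = y" if y: "y \<in> A i" for i y
  proof (cases "i = m")
    case True
    then have "y \<in> carrier (P m)" "\<Psi> y = \<zero>\<^bsub>P (Suc m)\<^esub>" using y by (auto simp: A_def)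
    then show ?thesis using True dz[of m] Pm.M.add.inv_one by (simp add: p_def a_minus_def a_inv_def)
  qed (use y in \<open>auto simp: p_def A_def\<close>)
  have psurj: "p i ` carrier (P i) = A i" for i using pA pid AP by (force simp: image_iff)
  have inc: "(\<lambda>x. x) \<in> linear_maps R (?P' i) (P i)" for i by (rule linear_maps_from_sub_module[OF linear_maps_id AP])
  have proj: "projective_module R (?P' i)" for i
    by (rule projective_retract[OF projective mA inc pl]) (simp add: pid)
  have fg': "fg_module R (?P' i)" for i by (rule fg_module_surj[OF module_P mA fg pl]) (simp add: psurj)
  have dA: "\<delta> i x \<in> A i" if x: "x \<in> A (Suc i)" for i x
  proof -
    consider "i < m" | "i = m" | "i > m" by linarith
    then show ?thesis
    proof cases
      case 1
      then show ?thesis using x AP[of "Suc i"] d_closed[of x i] by (auto simp: A_def)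
    next
      case 2
      then show ?thesis using x dz[of i] zero linear_map_zero[OF module_P module_P \<Psi>(1)] by (simp add: A_def)
    next
      case 3
      then show ?thesis using x dz[of i] by (simp add: A_def)
    qed
  qed
  have dl: "\<delta> i \<in> linear_maps R (?P' (Suc i)) (?P' i)" for i
    by (rule linear_maps_sub_moduleI[OF linear_maps_from_sub_module[OF d_linear AP]]) (simp add: dA)
  have el: "\<epsilon> \<in> linear_maps R (?P' 0) M" by (rule linear_maps_from_sub_module[OF augmentation_linear AP])
  text \<open>Elements of \<open>P m\<close> may be corrected by boundaries to lie in the complement.\<close>
  have gen: "f ` A i = f ` carrier (P i)"
    if f: "f \<in> linear_maps R (P i) N" and N: "module R N"
      and fd: "\<And>x. x \<in> carrier (P (Suc i)) \<Longrightarrow> f (\<delta> i x) = \<zero>\<^bsub>N\<^esub>" and i: "i \<le> m" for f i and N :: "('a, 'n) module"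
  proof (cases "i = m")
    case True
    interpret N: module R N by fact
    have "f y \<in> f ` A m" if y: "y \<in> carrier (P m)" for y
    proof (rule image_eqI)
      have \<Psi>y: "\<Psi> y \<in> carrier (P (Suc m))" using linear_map_closed[OF \<Psi>(1) y] .
      have "f (p m y) = f y \<ominus>\<^bsub>N\<^esub> f (\<delta> m (\<Psi> y))"
        using linear_map_minus[OF module_P N f] True y \<Psi>y by (simp add: p_def)
      then show "f y = f (p m y)"
        using fd[of "\<Psi> y"] \<Psi>y True linear_map_closed[OF f] y N.M.add.inv_one by (simp add: a_minus_def a_inv_def)
      show "p m y \<in> A m" by (rule pA[OF y])
    qed
    then show ?thesis using AP[of m] True by blast
  next
    case False then show ?thesis using i by (simp add: A_def)
  qed
  have ker_m: "x = \<zero>\<^bsub>P m\<^esub>" if x: "x \<in> A m" and d: "x \<in> \<delta> m ` carrier (P (Suc m))" for x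
  proof -
    obtain z where z: "z \<in> carrier (P (Suc m))" "x = \<delta> m z" using d by blast
    then have "z = \<zero>\<^bsub>P (Suc m)\<^esub>" using \<Psi>(2)[OF z(1)] x by (simp add: A_def)
    then show ?thesis using z(2) dz by simp
  qed
  \<comment> \<open>In this form exactness of the shortened complex follows from that of the old one
    by intersecting with the new terms.\<close>
  have exact: "\<delta> i ` A (Suc i) = A i \<inter> \<delta> i ` carrier (P (Suc i))" for i
  proof -
    consider "i < m" | "i = m" | "i > m" by linarith
    then show ?thesis
    proof cases
      case 1
      then have "\<delta> i ` A (Suc i) = \<delta> i ` carrier (P (Suc i))"
        by (intro gen[OF d_linear module_P]) (auto simp: d_d)
      then show ?thesis using 1 linear_map_closed[OF d_linear[of i]] by (auto simp: A_def)
    next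
      case 2
      then have "A (Suc i) = {\<zero>\<^bsub>P (Suc i)\<^esub>}" by (simp add: A_def)
      moreover have "\<zero>\<^bsub>P m\<^esub> \<in> A m \<inter> \<delta> m ` carrier (P (Suc m))"
        using dz[of m] zero linear_map_zero[OF module_P module_P \<Psi>(1)] by (force simp: A_def)
      ultimately show ?thesis using 2 dz[of i] ker_m by auto
    next
      case 3
      then have "A i = {\<zero>\<^bsub>P i\<^esub>}" "A (Suc i) = {\<zero>\<^bsub>P (Suc i)\<^esub>}" by (auto simp: A_def)
      then show ?thesis using dz[of i] zero[of "Suc i"] by force
    qed
  qed
  have "proj_resolution R ?P' \<delta> \<epsilon> M"
    unfolding proj_resolution_def projective_resolution_def
  proof (intro conjI allI proj dl el module_M)
    show "\<epsilon> ` carrier (?P' 0) = carrier M"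
      using gen[OF augmentation_linear module_M augmentation_d] augmentation_surj by simp
    show "\<delta> 0 ` carrier (?P' 1) = a_kernel (?P' 0) M \<epsilon>"
      using exact[of 0] AP[of 0] unfolding d_image_0 by (auto simp: a_kernel_def')
    show "\<delta> (Suc i) ` carrier (?P' (Suc (Suc i))) = a_kernel (?P' (Suc i)) (?P' i) (\<delta> i)" for i
      using exact[of "Suc i"] AP[of "Suc i"] unfolding d_image_Suc by (auto simp: a_kernel_def')
  qed
  moreover have "trivial_module (?P' i)" if "i > m" for i using that by (simp add: trivial_module_def A_def)
  ultimately show thesis using fg' that[of ?P'] by blast
qed

text \<open>As long as the length exceeds \<open>d\<close>, the top differential splits and the
  resolution loses its last term.\<close>

lemma (in cring) resolution_length_le_of_criterion:
  fixes M :: "('a, 'm) module" and P :: "nat \<Rightarrow> ('a, 'm) aux_module"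
  assumes crit: "\<And>xs. set xs \<subseteq> carrier R \<Longrightarrow>
      (\<And>i. i \<le> d \<Longrightarrow> trivial_module
        (Ext R i (quotient_module (regular_module R) (genideal R (set xs))) (regular_module R))) \<Longrightarrow>
      \<one> \<in> genideal R (set xs)"
    and "proj_resolution R P \<delta> \<epsilon> M" "\<And>i. fg_module R (P i)" "\<And>i. i > n \<Longrightarrow> trivial_module (P i)"
  shows "has_projective_resolution_of_length R M d"
  using assms(2-4)
proof (induct n arbitrary: P)
  case 0
  then show ?case unfolding has_projective_resolution_of_length_def proj_resolution_def by (metis gr_zeroI less_nat_zero_code)
next
  case (Suc m)
  show ?case
  proof (cases "d \<le> m")
    case True
    have "\<exists>\<Psi>\<in>linear_maps R (P m) (P (Suc m)). \<forall>x\<in>carrier (P (Suc m)). \<Psi> (\<delta> m x) = x"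
      by (rule proj_resolution.top_differential_splits_of_criterion[OF Suc.prems(1,2) _ True crit])
        (use Suc.prems(3) in auto)
    then obtain \<Psi> where \<Psi>: "\<Psi> \<in> linear_maps R (P m) (P (Suc m))"
      "\<And>x. x \<in> carrier (P (Suc m)) \<Longrightarrow> \<Psi> (\<delta> m x) = x" by blast
    obtain P' where "proj_resolution R P' \<delta> \<epsilon> M" "\<And>i. fg_module R (P' i)" "\<And>i. i > m \<Longrightarrow> trivial_module (P' i)"
      using proj_resolution.shorten_resolution[OF Suc.prems(1-3) \<Psi>] by blast
    then show ?thesis by (rule Suc.hyps)
  next
    \<comment> \<open>Now \<open>Suc m \<le> d\<close>, so the given resolution is already short
      enough.\<close>
    case False
    then have "\<forall>i>d. trivial_module (P i)" using Suc.prems(3) by auto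
    then show ?thesis using Suc.prems(1)
      unfolding has_projective_resolution_of_length_def proj_resolution_def by blast
  qed
qed

theorem theorem2p5:
  fixes R :: "('a, 'b) ring_scheme" and d :: nat
  assumes "cring R"
  shows "fPD R \<le> enat d \<longleftrightarrow>
    (\<forall>I. fg_ideal R I \<longrightarrow>
      (\<forall>i\<le>d. trivial_module (Ext R i (quotient_module (regular_module R) I) (regular_module R))) \<longrightarrow>
      (\<forall>i. trivial_module (Ext R i (quotient_module (regular_module R) I) (regular_module R))))"
    (is "_ \<longleftrightarrow> ?crit")
proof -
  interpret cring R by fact
  show ?thesis
  proof
    assume fPD: "fPD R \<le> enat d"
    show ?crit
    proof (intro allI impI)
      fix I i
      assume "fg_ideal R I"
        and triv: "\<forall>i\<le>d. trivial_module (Ext R i (quotient_module (regular_module R) I) (regular_module R))"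
      then obtain S where "finite S" "S \<subseteq> carrier R" "I = genideal R S" unfolding fg_ideal_def by blast
      \<comment> \<open>The Koszul complex is indexed by a list, hence an enumeration of the
        generators.\<close>
      then obtain xs where xs: "set xs \<subseteq> carrier R" "I = genideal R (set xs)" using finite_list by blast
      have I: "ideal I R" unfolding xs(2) by (rule genideal_ideal[OF xs(1)])
      obtain P :: "nat \<Rightarrow> ('a, 'a set) aux_module" and \<delta> \<epsilon>
        where res: "proj_resolution R P \<delta> \<epsilon> (quotient_module (regular_module R) I)"
          and Ext: "\<And>i. trivial_module (Ext R i (quotient_module (regular_module R) I) (regular_module R)) \<longleftrightarrow>
            cohomology_vanishes R P \<delta> (regular_module R) i"
        using Ext_resolution[OF I] by blast
      have "koszul_exact xs (int k)" if "k \<le> d" for k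
        using koszul_exact_of_cohomology_vanishes[OF xs(1) res[unfolded xs(2)] _ that] triv Ext by blast
      then have "\<one>\<^bsub>R\<^esub> \<in> I" unfolding xs(2) by (rule unit_ideal_of_fPD_le[OF fPD xs(1)])
      then show "trivial_module (Ext R i (quotient_module (regular_module R) I) (regular_module R))"
        unfolding Ext by (rule cohomology_vanishes_unit_ideal[OF I res module_regular])
    qed
  next
    assume crit: ?crit
    \<comment> \<open>The criterion upgrades vanishing up to \<open>d\<close> to vanishing in all
      degrees, which reaches the top Koszul degree of \<open>xs\<close> however many generators
      there are.\<close>
    have unit: "\<one>\<^bsub>R\<^esub> \<in> genideal R (set xs)"
      if xs: "set xs \<subseteq> carrier R" and triv: "\<And>i. i \<le> d \<Longrightarrow> trivial_module
        (Ext R i (quotient_module (regular_module R) (genideal R (set xs))) (regular_module R))" for xs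
    proof -
      have I: "ideal (genideal R (set xs)) R" by (rule genideal_ideal[OF xs])
      have "fg_ideal R (genideal R (set xs))" unfolding fg_ideal_def using xs by blast
      then have all: "trivial_module
          (Ext R i (quotient_module (regular_module R) (genideal R (set xs))) (regular_module R))" for i
        using crit triv by blast
      obtain P :: "nat \<Rightarrow> ('a, 'a set) aux_module" and \<delta> \<epsilon>
        where res: "proj_resolution R P \<delta> \<epsilon> (quotient_module (regular_module R) (genideal R (set xs)))"
          and Ext: "\<And>i. trivial_module (Ext R i (quotient_module (regular_module R) (genideal R (set xs)))
            (regular_module R)) \<longleftrightarrow> cohomology_vanishes R P \<delta> (regular_module R) i"
        using Ext_resolution[OF I] by blast
      show ?thesis using cohomology_vanishes_imp_unit_ideal[OF xs res] all Ext by blast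
    qed
    show "fPD R \<le> enat d"
      unfolding fPD_def
    proof (rule Sup_least, safe)
      fix M :: "('a, 'a list) module"
      assume M: "module R M" and "has_finite_projective_resolution R M"
      then obtain n and P :: "nat \<Rightarrow> ('a, 'a list) aux_module" and \<delta> \<epsilon>
        where "projective_resolution R P \<delta> \<epsilon> M" "\<forall>i>n. trivial_module (P i)" "\<forall>i. fg_module R (P i)"
        unfolding has_finite_projective_resolution_def by blast
      then have "has_projective_resolution_of_length R M d"
        using M by (intro resolution_length_le_of_criterion[OF unit]) (auto simp: proj_resolution_def)
      then show "proj_dim R M \<le> enat d" unfolding proj_dim_def by (intro Inf_lower) blast
    qed
  qed
qed

end
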